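(* Let $\kappa\subseteq X\times Y$ be the support of an $\mathfrak{I}$-decomposable masa-bimodule. Then $\kappa$ is operator synthetic if and only if it is strong operator Ditkin.
   Context: $(X,m)$ and $(Y,n)$ are standard measure spaces ($\sigma$-finite regular Borel measures for Borel structures arising from complete separable metrizable topologies), $H_1=L^2(X,m)$, $H_2=L^2(Y,n)$; $\mathcal{D}_1,\mathcal{D}_2$ are the algebras of multiplication operators by functions in $L^\infty(X,m)$, $L^\infty(Y,n)$; $M_g$ is multiplication by $g$. $\mathcal{B}(H_1,H_2)$ has the weak* topology as the dual of the trace class operators from $H_2$ to $H_1$. A masa-bimodule is a subspace $\mathcal{U}\subseteq\mathcal{B}(H_1,H_2)$ with $\mathcal{D}_2\mathcal{U}\mathcal{D}_1\subseteq\mathcal{U}$. $\mathrm{Ref}\,\mathcal{U}=\{T\in\mathcal{B}(H_1,H_2):Tx\in\overline{\mathcal{U}x}\ \forall x\in H_1\}$. $E\subseteq X\times Y$ is marginally null if $E\subseteq(X_0\times Y)\cup(X\times Y_0)$ with $m(X_0)=n(Y_0)=0$; two sets are marginally equivalent if their symmetric difference is marginally null. A set is $\omega$-open if it is marginally equivalent to a countable union $\bigcup_i\alpha_i\times\beta_i$ of measurable rectangles, and $\omega$-closed if its complement is $\omega$-open. Schur maps: let $\Gamma(X,Y)=L^2(X,m)\hat\otimes L^2(Y,n)$ (projective tensor product, norm $\|\cdot\|_\Gamma$), identified with the predual of $\mathcal{B}(H_1,H_2)$ via $\langle T,f\otimes g\rangle=(Tf,\overline{g})$, and its elements with functions $h(x,y)=\sum_i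 f_i(x)g_i(y)$, $\sum\|f_i\|_2^2<\infty$, $\sum\|g_i\|_2^2<\infty$, defined up to a marginally null set. A Schur multiplier is $\varphi\in L^\infty(X\times Y,m\times n)$ such that $\varphi h$ is equivalent with respect to $m\times n$ to a function in $\Gamma(X,Y)$ for every $h\in\Gamma(X,Y)$; the dual of the map $h\mapsto\varphi h$ is the Schur map $S_\varphi$. (The Schur maps are exactly the bounded weak* continuous masa-bimodule maps on $\mathcal{B}(H_1,H_2)$.) $\mathfrak{I}$ is the set of all idempotent Schur maps. A subspace is $\mathfrak{I}$-injective if it is the range $\mathrm{Ran}\,\phi$ of some $\phi\in\mathfrak{I}$. For weak* closed sets $\mathcal{M}_n$, $\limsup_n\mathcal{M}_n$ is the set of all weak* cluster points of sequences $(x_n)$ with $x_n\in\mathcal{M}_n$. A weak* closed subspace $\mathcal{V}\subseteq\mathcal{B}(H_1,H_2)$ is $\mathfrak{I}$-decomposable if there are $(\phi_n)_{n=1}^\infty\subseteq\mathfrak{I}$ and $\mathfrak{I}$-injective subspaces $(\mathcal{W}_n)_{n=1}^\infty$ such that (a) $\sup_n\|\phi_n\|<\infty$; (b) $\mathcal{V}\subseteq\mathrm{Ran}\,\phi_n+\mathcal{W}_n$ for each $n$; (c) $\mathcal{W}_n\subseteq\mathcal{V}$ for each $n$; (d) $\limsup_n\mathrm{Ran}\,\phi_n\subseteq\mathcal{V}$. For $\kappa$ $\omega$-closed, $\mathfrak{M}_{\max}(\kappa)$ is the set of $T\in\mathcal{B}(H_1,H_2)$ with $M_{\chi_\beta}TM_{\chi_\alpha}=0$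 for all measurable $\alpha\subseteq X$, $\beta\subseteq Y$ with $(\alpha\times\beta)\cap\kappa$ marginally null. The support of a weak* closed masa-bimodule $\mathcal{U}$ is the $\omega$-closed set $\kappa$ (unique up to marginal equivalence) with $\mathrm{Ref}\,\mathcal{U}=\mathfrak{M}_{\max}(\kappa)$. $\mathfrak{M}_{\min}(\kappa)$ is the smallest weak* closed masa-bimodule with support $\kappa$ (it exists). $\kappa$ is operator synthetic if $\mathfrak{M}_{\min}(\kappa)=\mathfrak{M}_{\max}(\kappa)$. Let $\Psi_{\min}(\kappa)=\mathfrak{M}_{\min}(\kappa)_\perp\subseteq\Gamma(X,Y)$ be the preannihilator; it equals the set of $h\in\Gamma(X,Y)$ with $h\chi_\kappa=0$ marginally almost everywhere. $\kappa$ is strong operator Ditkin if there is a sequence $(w_n)_{n\in\mathbb{N}}$ of Schur multipliers such that each $w_n$ vanishes on an $\omega$-open set containing $\kappa$ and $\|h-w_nh\|_\Gamma\to0$ for every $h\in\Psi_{\min}(\kappa)$. *)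

theory Defs
  imports "HOL-Analysis.Analysis"
begin

text \<open>A standard measure space: a sigma-finite regular Borel measure for the Borel structure of
  some complete separable metrizable topology on the underlying set.\<close>

definition standard_measure_space :: "'a measure \<Rightarrow> bool" where
  "standard_measure_space M \<longleftrightarrow> sigma_finite_measure M \<and>
     (\<exists>T. topspace T = space M \<and> completely_metrizable_space T \<and>
        (\<exists>D. countable D \<and> D \<subseteq> topspace T \<and> T closure_of D = topspace T) \<and>
        sets M = sigma_sets (topspace T) {U. openin T U} \<and>
        (\<forall>A\<in>sets M.
           emeasure M A = (INF U\<in>{U. openin T U \<and> A \<subseteq> U}. emeasure M U) \<and>
           emeasure M A = (SUP K\<in>{K. compactin T K \<and> K \<subseteq> A}. emeasure M K)))"

text \<open>The elements of \<open>L2 M\<close> are the classes modulo almost everywhere equality, each class being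
  the set of all its square-integrable representatives.  The representative picked by
  \<open>L2_rep\<close> is arbitrary; no notion below depends on this choice.\<close>

definition L2_class :: "'a measure \<Rightarrow> ('a \<Rightarrow> complex) \<Rightarrow> ('a \<Rightarrow> complex) set" where
  "L2_class M f = {g \<in> borel_measurable M.
     integrable M (\<lambda>x. (cmod (g x))\<^sup>2) \<and> (AE x in M. g x = f x)}"

definition L2 :: "'a measure \<Rightarrow> ('a \<Rightarrow> complex) set set" where
  "L2 M = L2_class M ` {f \<in> borel_measurable M. integrable M (\<lambda>x. (cmod (f x))\<^sup>2)}"

definition L2_rep :: "('a \<Rightarrow> complex) set \<Rightarrow> 'a \<Rightarrow> complex" where
  "L2_rep u = (SOME f. f \<in> u)"

definition L2_zero :: "'a measure \<Rightarrow> ('a \<Rightarrow> complex) set" where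
  "L2_zero M = L2_class M (\<lambda>x. 0)"

definition L2_add :: "'a measure \<Rightarrow> ('a \<Rightarrow> complex) set \<Rightarrow> ('a \<Rightarrow> complex) set \<Rightarrow> ('a \<Rightarrow> complex) set" where
  "L2_add M u v = L2_class M (\<lambda>x. L2_rep u x + L2_rep v x)"

definition L2_diff :: "'a measure \<Rightarrow> ('a \<Rightarrow> complex) set \<Rightarrow> ('a \<Rightarrow> complex) set \<Rightarrow> ('a \<Rightarrow> complex) set" where
  "L2_diff M u v = L2_class M (\<lambda>x. L2_rep u x - L2_rep v x)"

definition L2_mult :: "'a measure \<Rightarrow> ('a \<Rightarrow> complex) \<Rightarrow> ('a \<Rightarrow> complex) set \<Rightarrow> ('a \<Rightarrow> complex) set" where
  "L2_mult M g u = L2_class M (\<lambda>x. g x * L2_rep u x)"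

definition L2_cnj :: "'a measure \<Rightarrow> ('a \<Rightarrow> complex) set \<Rightarrow> ('a \<Rightarrow> complex) set" where
  "L2_cnj M u = L2_class M (\<lambda>x. cnj (L2_rep u x))"

definition L2_inner :: "'a measure \<Rightarrow> ('a \<Rightarrow> complex) set \<Rightarrow> ('a \<Rightarrow> complex) set \<Rightarrow> complex" where
  "L2_inner M u v = (\<integral>x. L2_rep u x * cnj (L2_rep v x) \<partial>M)"

definition L2_norm :: "'a measure \<Rightarrow> ('a \<Rightarrow> complex) set \<Rightarrow> real" where
  "L2_norm M u = sqrt (\<integral>x. (cmod (L2_rep u x))\<^sup>2 \<partial>M)"

definition Linf :: "'a measure \<Rightarrow> ('a \<Rightarrow> complex) set" where
  "Linf M = {f \<in> borel_measurable M. \<exists>C. AE x in M. cmod (f x) \<le> C}"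

type_synonym ('a, 'b) op = "('a \<Rightarrow> complex) set \<Rightarrow> ('b \<Rightarrow> complex) set"

context
  fixes M :: "'a measure" and N :: "'b measure"
begin

subsection \<open>Bounded operators and masa-bimodules\<close>

text \<open>\<open>\<B>(L2 M, L2 N)\<close>; operators are extensional functions on \<open>L2 M\<close>, so that equality of
  operators is equality in HOL.  Multiplication by a scalar is multiplication by the constant
  function.\<close>

definition bounded_ops :: "('a, 'b) op set" where
  "bounded_ops = {T \<in> L2 M \<rightarrow>\<^sub>E L2 N.
     (\<forall>u\<in>L2 M. \<forall>v\<in>L2 M. T (L2_add M u v) = L2_add N (T u) (T v)) \<and>
     (\<forall>c. \<forall>u\<in>L2 M. T (L2_mult M (\<lambda>_. c) u) = L2_mult N (\<lambda>_. c) (T u)) \<and>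
     (\<exists>C. \<forall>u\<in>L2 M. L2_norm N (T u) \<le> C * L2_norm M u)}"

definition op_norm :: "('a, 'b) op \<Rightarrow> real" where
  "op_norm T = (SUP u\<in>{u \<in> L2 M. L2_norm M u \<le> 1}. L2_norm N (T u))"

definition op_zero :: "('a, 'b) op" where
  "op_zero = (\<lambda>u\<in>L2 M. L2_zero N)"

definition op_add :: "('a, 'b) op \<Rightarrow> ('a, 'b) op \<Rightarrow> ('a, 'b) op" where
  "op_add S T = (\<lambda>u\<in>L2 M. L2_add N (S u) (T u))"

definition op_scale :: "complex \<Rightarrow> ('a, 'b) op \<Rightarrow> ('a, 'b) op" where
  "op_scale c T = (\<lambda>u\<in>L2 M. L2_mult N (\<lambda>_. c) (T u))"

text \<open>The operator \<open>M\<^sub>b T M\<^sub>a\<close>.\<close>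

definition op_mult :: "('b \<Rightarrow> complex) \<Rightarrow> ('a, 'b) op \<Rightarrow> ('a \<Rightarrow> complex) \<Rightarrow> ('a, 'b) op" where
  "op_mult b T a = (\<lambda>u\<in>L2 M. L2_mult N b (T (L2_mult M a u)))"

definition op_subspace :: "('a, 'b) op set \<Rightarrow> bool" where
  "op_subspace U \<longleftrightarrow> U \<subseteq> bounded_ops \<and> op_zero \<in> U \<and>
     (\<forall>S\<in>U. \<forall>T\<in>U. op_add S T \<in> U) \<and> (\<forall>c. \<forall>T\<in>U. op_scale c T \<in> U)"

definition masa_bimodule :: "('a, 'b) op set \<Rightarrow> bool" where
  "masa_bimodule U \<longleftrightarrow> op_subspace U \<and>
     (\<forall>b\<in>Linf N. \<forall>T\<in>U. \<forall>a\<in>Linf M. op_mult b T a \<in> U)"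

definition Ref :: "('a, 'b) op set \<Rightarrow> ('a, 'b) op set" where
  "Ref U = {T \<in> bounded_ops.
     \<forall>u\<in>L2 M. \<forall>\<epsilon>>0. \<exists>S\<in>U. L2_norm N (L2_diff N (T u) (S u)) < \<epsilon>}"


subsection \<open>Marginal equivalence and the \<open>\<omega>\<close>-topology\<close>

definition marginally_null :: "('a \<times> 'b) set \<Rightarrow> bool" where
  "marginally_null E \<longleftrightarrow> (\<exists>X\<^sub>0\<in>null_sets M. \<exists>Y\<^sub>0\<in>null_sets N.
     E \<subseteq> (X\<^sub>0 \<times> space N) \<union> (space M \<times> Y\<^sub>0))"

definition marginally_equivalent :: "('a \<times> 'b) set \<Rightarrow> ('a \<times> 'b) set \<Rightarrow> bool" where
  "marginally_equivalent E F \<longleftrightarrow> marginally_null ((E - F) \<union> (F - E))"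

definition omega_open :: "('a \<times> 'b) set \<Rightarrow> bool" where
  "omega_open E \<longleftrightarrow> E \<subseteq> space M \<times> space N \<and>
     (\<exists>\<alpha> \<beta>. (\<forall>i::nat. \<alpha> i \<in> sets M \<and> \<beta> i \<in> sets N) \<and>
        marginally_equivalent E (\<Union>i. \<alpha> i \<times> \<beta> i))"

definition omega_closed :: "('a \<times> 'b) set \<Rightarrow> bool" where
  "omega_closed E \<longleftrightarrow> E \<subseteq> space M \<times> space N \<and> omega_open (space M \<times> space N - E)"


subsection \<open>The predual \<open>\<Gamma>(X,Y)\<close> and the weak* topology\<close>

text \<open>\<open>Gamma_series u v h\<close>: the function \<open>h\<close> is, up to a marginally null set, the sum of the
  series \<open>\<Sum>\<^sub>i u\<^sub>i(x) v\<^sub>i(y)\<close> given by square-summable sequences of \<open>L2\<close> elements.  Changing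
  the representatives of the countably many classes only affects a marginally null set.\<close>

definition Gamma_series ::
  "(nat \<Rightarrow> ('a \<Rightarrow> complex) set) \<Rightarrow> (nat \<Rightarrow> ('b \<Rightarrow> complex) set) \<Rightarrow> ('a \<times> 'b \<Rightarrow> complex) \<Rightarrow> bool" where
  "Gamma_series u v h \<longleftrightarrow> (\<forall>i. u i \<in> L2 M \<and> v i \<in> L2 N) \<and>
     summable (\<lambda>i. (L2_norm M (u i))\<^sup>2) \<and> summable (\<lambda>i. (L2_norm N (v i))\<^sup>2) \<and>
     marginally_null {(x, y) \<in> space M \<times> space N.
       \<not> (\<lambda>i. L2_rep (u i) x * L2_rep (v i) y) sums h (x, y)}"

text \<open>\<open>\<Gamma>(X,Y)\<close> is the projective tensor product of \<open>L2 M\<close> and \<open>L2 N\<close>, realised as a space of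
  functions; two functions in it stand for the same tensor iff they are equal marginally almost
  everywhere.\<close>

definition Gamma :: "('a \<times> 'b \<Rightarrow> complex) set" where
  "Gamma = {h. \<exists>u v. Gamma_series u v h}"

definition Gamma_norm :: "('a \<times> 'b \<Rightarrow> complex) \<Rightarrow> real" where
  "Gamma_norm h = Inf {(\<Sum>i. L2_norm M (u i) * L2_norm N (v i)) | u v. Gamma_series u v h}"

text \<open>The duality \<open>\<langle>T, h\<rangle>\<close>, determined by \<open>\<langle>T, f \<otimes> g\<rangle> = (T f, cnj g)\<close>; its value does not
  depend on the series representing \<open>h\<close>.\<close>

definition pairing :: "('a, 'b) op \<Rightarrow> ('a \<times> 'b \<Rightarrow> complex) \<Rightarrow> complex" where
  "pairing T h = (THE c. \<exists>u v. Gamma_series u v h \<and>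
     c = (\<Sum>i. L2_inner N (T (u i)) (L2_cnj N (v i))))"

definition weak_star :: "('a, 'b) op topology" where
  "weak_star = pullback_topology bounded_ops (\<lambda>T. \<lambda>h\<in>Gamma. pairing T h)
     (product_topology (\<lambda>_. euclidean) Gamma)"

definition preannihilator :: "('a, 'b) op set \<Rightarrow> ('a \<times> 'b \<Rightarrow> complex) set" where
  "preannihilator U = {h \<in> Gamma. \<forall>T\<in>U. pairing T h = 0}"

definition weak_star_limsup :: "(nat \<Rightarrow> ('a, 'b) op set) \<Rightarrow> ('a, 'b) op set" where
  "weak_star_limsup \<M> = {T \<in> bounded_ops. \<exists>S. (\<forall>n. S n \<in> \<M> n) \<and>
     (\<forall>W. openin weak_star W \<and> T \<in> W \<longrightarrow> (\<exists>\<^sub>F n in sequentially. S n \<in> W))}"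


subsection \<open>Schur multipliers and Schur maps\<close>

definition schur_multiplier :: "('a \<times> 'b \<Rightarrow> complex) \<Rightarrow> bool" where
  "schur_multiplier \<phi> \<longleftrightarrow> \<phi> \<in> Linf (M \<Otimes>\<^sub>M N) \<and>
     (\<forall>h\<in>Gamma. \<exists>k\<in>Gamma. AE z in M \<Otimes>\<^sub>M N. k z = \<phi> z * h z)"

text \<open>The product \<open>\<phi> h\<close> as an element of \<open>\<Gamma>(X,Y)\<close>.  Elements of \<open>\<Gamma>(X,Y)\<close> which agree almost
  everywhere agree marginally almost everywhere, so it is determined up to a marginally null set.\<close>

definition Gamma_mult :: "('a \<times> 'b \<Rightarrow> complex) \<Rightarrow> ('a \<times> 'b \<Rightarrow> complex) \<Rightarrow> 'a \<times> 'b \<Rightarrow> complex" where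
  "Gamma_mult \<phi> h = (SOME k. k \<in> Gamma \<and> (AE z in M \<Otimes>\<^sub>M N. k z = \<phi> z * h z))"

text \<open>\<open>\<Phi>\<close> is the Schur map \<open>S\<^sub>\<phi>\<close>, i.e. the dual of \<open>h \<mapsto> \<phi> h\<close>.\<close>

definition is_schur_map ::
  "('a \<times> 'b \<Rightarrow> complex) \<Rightarrow> (('a, 'b) op \<Rightarrow> ('a, 'b) op) \<Rightarrow> bool" where
  "is_schur_map \<phi> \<Phi> \<longleftrightarrow> \<Phi> \<in> bounded_ops \<rightarrow>\<^sub>E bounded_ops \<and>
     (\<forall>T\<in>bounded_ops. \<forall>h\<in>Gamma. pairing (\<Phi> T) h = pairing T (Gamma_mult \<phi> h))"

definition idempotent_schur_maps :: "(('a, 'b) op \<Rightarrow> ('a, 'b) op) set" where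
  "idempotent_schur_maps = {\<Phi>. (\<exists>\<phi>. schur_multiplier \<phi> \<and> is_schur_map \<phi> \<Phi>) \<and>
     (\<forall>T\<in>bounded_ops. \<Phi> (\<Phi> T) = \<Phi> T)}"

definition schur_map_norm :: "(('a, 'b) op \<Rightarrow> ('a, 'b) op) \<Rightarrow> ennreal" where
  "schur_map_norm \<Phi> = (SUP T\<in>{T \<in> bounded_ops. op_norm T \<le> 1}. ennreal (op_norm (\<Phi> T)))"

definition Ran :: "(('a, 'b) op \<Rightarrow> ('a, 'b) op) \<Rightarrow> ('a, 'b) op set" where
  "Ran \<Phi> = \<Phi> ` bounded_ops"

definition I_injective :: "('a, 'b) op set \<Rightarrow> bool" where
  "I_injective W \<longleftrightarrow> (\<exists>\<Phi>\<in>idempotent_schur_maps. W = Ran \<Phi>)"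

definition I_decomposable :: "('a, 'b) op set \<Rightarrow> bool" where
  "I_decomposable V \<longleftrightarrow> op_subspace V \<and> closedin weak_star V \<and>
     (\<exists>\<Phi> W. (\<forall>n::nat. \<Phi> n \<in> idempotent_schur_maps) \<and> (\<forall>n. I_injective (W n)) \<and>
        (SUP n. schur_map_norm (\<Phi> n)) < \<infinity> \<and>
        (\<forall>n. V \<subseteq> {op_add S T | S T. S \<in> Ran (\<Phi> n) \<and> T \<in> W n}) \<and>
        (\<forall>n. W n \<subseteq> V) \<and>
        weak_star_limsup (\<lambda>n. Ran (\<Phi> n)) \<subseteq> V)"


subsection \<open>Supports, operator synthesis and Ditkin sets\<close>

definition M_max :: "('a \<times> 'b) set \<Rightarrow> ('a, 'b) op set" where
  "M_max \<kappa> = {T \<in> bounded_ops. \<forall>\<alpha>\<in>sets M. \<forall>\<beta>\<in>sets N.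
     marginally_null ((\<alpha> \<times> \<beta>) \<inter> \<kappa>) \<longrightarrow> op_mult (indicator \<beta>) T (indicator \<alpha>) = op_zero}"

definition is_support :: "('a \<times> 'b) set \<Rightarrow> ('a, 'b) op set \<Rightarrow> bool" where
  "is_support \<kappa> U \<longleftrightarrow> omega_closed \<kappa> \<and> Ref U = M_max \<kappa>"

text \<open>For \<open>\<omega>\<close>-closed \<open>\<kappa>\<close> there is a smallest weak* closed masa-bimodule with support \<open>\<kappa>\<close>;
  as such it is the intersection of all of them.\<close>

definition M_min :: "('a \<times> 'b) set \<Rightarrow> ('a, 'b) op set" where
  "M_min \<kappa> = \<Inter>{U. masa_bimodule U \<and> closedin weak_star U \<and> is_support \<kappa> U}"

definition operator_synthetic :: "('a \<times> 'b) set \<Rightarrow> bool" where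
  "operator_synthetic \<kappa> \<longleftrightarrow> M_min \<kappa> = M_max \<kappa>"

definition Psi_min :: "('a \<times> 'b) set \<Rightarrow> ('a \<times> 'b \<Rightarrow> complex) set" where
  "Psi_min \<kappa> = preannihilator (M_min \<kappa>)"

text \<open>A Schur multiplier is an element of \<open>L\<^sup>\<infinity>\<close> of the product measure, so its vanishing on a
  set is understood almost everywhere.\<close>

definition strong_operator_Ditkin :: "('a \<times> 'b) set \<Rightarrow> bool" where
  "strong_operator_Ditkin \<kappa> \<longleftrightarrow> (\<exists>w :: nat \<Rightarrow> 'a \<times> 'b \<Rightarrow> complex.
     (\<forall>n. schur_multiplier (w n)) \<and>
     (\<forall>n. \<exists>E. omega_open E \<and> \<kappa> \<subseteq> E \<and> (AE z in M \<Otimes>\<^sub>M N. z \<in> E \<longrightarrow> w n z = 0)) \<and>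
     (\<forall>h\<in>Psi_min \<kappa>. (\<lambda>n. Gamma_norm (\<lambda>z. h z - Gamma_mult (w n) h z)) \<longlonglongrightarrow> 0))"

end

end

theory Submission
  imports Defs
begin

text \<open>Let \<open>V\<close> be the given bimodule with its maps \<open>\<phi>\<^sub>n\<close> and spaces \<open>W\<^sub>n = Ran \<psi>\<^sub>n\<close>.  The idempotent
  multipliers are (almost everywhere) characteristic functions, and \<open>w\<^sub>n = (1 - \<phi>\<^sub>n) (1 - \<psi>\<^sub>n)\<close> annihilates
  \<open>V\<close>.  If \<open>\<kappa>\<close> is synthetic, then \<open>V = \<M>\<^sub>m\<^sub>a\<^sub>x(\<kappa>)\<close>, so by Arveson's null set theorem \<open>\<kappa>\<close> is marginally contained
  in the \<open>\<omega>\<close>-open set where \<open>w\<^sub>n = 0\<close>.  For \<open>h\<close> in the preannihilator, \<open>h - w\<^sub>n h\<close> and \<open>\<phi>\<^sub>n h\<close> define the same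
  element, and its norm is \<open>Re \<langle>\<phi>\<^sub>n(T\<^sub>n), h\<rangle>\<close> for contractions \<open>T\<^sub>n\<close>; this tends to \<open>0\<close> because the
  bounded sequence \<open>\<phi>\<^sub>n(T\<^sub>n)\<close> has its weak* cluster points in \<open>V\<close>.  Conversely, an operator supported on
  \<open>\<kappa>\<close> annihilates each \<open>w\<^sub>n h\<close>, hence the limit \<open>h\<close>, and the bipolar theorem applies.

  Both the norming property of the duality and the null set theorem come from the Hahn--Banach theorem
  for the quotient of \<open>\<Gamma>(X,Y)\<close> by the functions vanishing on a set.\<close>

subsection \<open>Square-integrable functions\<close>

text \<open>Multipliers live modulo null sets of the product measure, whereas containment of
  \<open>\<kappa>\<close> in a set makes sense only modulo marginally null sets, and
  \<open>\<kappa>\<close> may itself be a product null set. So the zero set of \<open>w n\<close>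
  cannot be taken literally. Instead a nowhere vanishing \<open>h0\<close> of the predual is
  multiplied by \<open>w n\<close>. The product lies in the predual and so is defined up to a
  marginally null set; the nonvanishing sets of \<open>w n * h0\<close> and of
  \<open>h0 - w n * h0\<close> are both \<omega>-open and stand for \<open>w n \<noteq> 0\<close>
  and \<open>w n = 0\<close>. Since \<open>pairing\<close> is a description, its independence of the
  series has to come first, and it is needed even for functions that agree merely almost everywhere.
  A tensor is measured by half the sum of the squared norms of its factors. This cost is exactly
  additive when two series are merged, and it bounds the two factor series separately. The separate
  bounds give estimates off a null set in each variable, so a vanishing quotient cost has a marginal
  conclusion and not only an almost everywhere one.\<close>

definition sq :: "'a measure \<Rightarrow> ('a \<Rightarrow> complex) set" where
  "sq M = {f \<in> borel_measurable M. integrable M (\<lambda>x. (cmod (f x))\<^sup>2)}"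

definition nrm :: "'a measure \<Rightarrow> ('a \<Rightarrow> complex) \<Rightarrow> real" where
  "nrm M f = sqrt (\<integral>x. (cmod (f x))\<^sup>2 \<partial>M)"

lemma sq_measurable [measurable_dest]: "f \<in> sq M \<Longrightarrow> f \<in> borel_measurable M"
  by (simp add: sq_def)

lemma sq_integrable: "f \<in> sq M \<Longrightarrow> integrable M (\<lambda>x. (cmod (f x))\<^sup>2)"
  by (simp add: sq_def)

lemma sq_bound:
  assumes "f \<in> borel_measurable M" "integrable M F" "\<And>x. x \<in> space M \<Longrightarrow> (cmod (f x))\<^sup>2 \<le> F x"
  shows "f \<in> sq M"
  unfolding sq_def
proof safe
  show "integrable M (\<lambda>x. (cmod (f x))\<^sup>2)"
    using assms(1) by (intro Bochner_Integration.integrable_bound[OF assms(2)] AE_I2)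
      (auto intro: order_trans[OF assms(3)])
qed (fact assms(1))

lemma sq_zero [simp, intro]: "(\<lambda>x. 0) \<in> sq M"
  by (simp add: sq_def)

lemma sq_scale [intro]: "f \<in> sq M \<Longrightarrow> (\<lambda>x. c * f x) \<in> sq M"
  by (auto simp: sq_def norm_mult power_mult_distrib)

lemma cmod_add_square_le: "(cmod (a + b))\<^sup>2 \<le> 2 * (cmod a)\<^sup>2 + 2 * (cmod b)\<^sup>2"
proof -
  have "(cmod (a + b))\<^sup>2 \<le> (cmod a + cmod b)\<^sup>2"
    by (intro power_mono norm_triangle_ineq) auto
  also have "\<dots> \<le> 2 * (cmod a)\<^sup>2 + 2 * (cmod b)\<^sup>2"
    using sum_squares_bound[of "cmod a" "cmod b"] by (simp add: power2_sum)
  finally show ?thesis .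
qed

lemma sq_add [intro]:
  assumes "f \<in> sq M" "g \<in> sq M" shows "(\<lambda>x. f x + g x) \<in> sq M"
proof (rule sq_bound)
  show "integrable M (\<lambda>x. 2 * (cmod (f x))\<^sup>2 + 2 * (cmod (g x))\<^sup>2)"
    using assms by (auto simp: sq_def)
qed (use assms cmod_add_square_le in \<open>auto simp: sq_def\<close>)

lemma sq_uminus [intro]: "f \<in> sq M \<Longrightarrow> (\<lambda>x. - f x) \<in> sq M"
  by (auto simp: sq_def)

lemma sq_diff [intro]: "f \<in> sq M \<Longrightarrow> g \<in> sq M \<Longrightarrow> (\<lambda>x. f x - g x) \<in> sq M"
  using sq_add[of f M "\<lambda>x. - g x"] by (auto intro: sq_uminus)

lemma sq_cnj [intro]:
  assumes "f \<in> sq M" shows "(\<lambda>x. cnj (f x)) \<in> sq M"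
proof -
  have "cnj \<in> borel_measurable borel"
    by (intro borel_measurable_continuous_onI continuous_intros)
  then have "(\<lambda>x. cnj (f x)) \<in> borel_measurable M"
    using assms by (auto simp: sq_def intro: measurable_compose)
  then show ?thesis using assms by (auto simp: sq_def)
qed

lemma sq_sum [intro]: "finite I \<Longrightarrow> (\<And>i. i \<in> I \<Longrightarrow> f i \<in> sq M) \<Longrightarrow> (\<lambda>x. \<Sum>i\<in>I. f i x) \<in> sq M"
  by (induction I rule: finite_induct) auto

lemma sq_indicator [intro]:
  assumes "A \<in> sets M" "f \<in> sq M" shows "(\<lambda>x. indicator A x * f x) \<in> sq M"
proof (rule sq_bound[OF _ sq_integrable[OF assms(2)]])
  show "(cmod (indicator A x * f x))\<^sup>2 \<le> (cmod (f x))\<^sup>2" for x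
    by (auto simp: indicator_def)
qed (use assms in \<open>auto simp: sq_def\<close>)

lemma nrm_nonneg [simp]: "0 \<le> nrm M f"
  by (simp add: nrm_def)

lemma nrm_square: "(nrm M f)\<^sup>2 = (\<integral>x. (cmod (f x))\<^sup>2 \<partial>M)"
  by (simp add: nrm_def)

lemma nrm_cong_AE:
  assumes "f \<in> sq M" "g \<in> sq M" "AE x in M. f x = g x" shows "nrm M f = nrm M g"
  unfolding nrm_def using assms by (intro arg_cong[of _ _ sqrt] integral_cong_AE) (auto simp: sq_def)

lemma nrm_scale: "nrm M (\<lambda>x. c * f x) = cmod c * nrm M f"
  by (simp add: nrm_def norm_mult power_mult_distrib real_sqrt_mult)

lemma nrm_zero [simp]: "nrm M (\<lambda>x. 0) = 0"
  by (simp add: nrm_def)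

lemma nrm_cnj [simp]: "nrm M (\<lambda>x. cnj (f x)) = nrm M f"
  by (simp add: nrm_def)

lemma nrm_minus_commute: "nrm M (\<lambda>x. f x - g x) = nrm M (\<lambda>x. g x - f x)"
  by (simp add: nrm_def norm_minus_commute)

lemma nrm_mono:
  assumes "f \<in> sq M" "g \<in> sq M" "\<And>x. x \<in> space M \<Longrightarrow> cmod (f x) \<le> cmod (g x)"
  shows "nrm M f \<le> nrm M g"
  unfolding nrm_def using assms
  by (intro real_sqrt_le_mono integral_mono sq_integrable) (auto intro: power_mono)

lemma nrm_eq_0_AE:
  assumes "f \<in> sq M" "nrm M f = 0" shows "AE x in M. f x = 0"
proof -
  have "(\<integral>x. (cmod (f x))\<^sup>2 \<partial>M) = 0"
    using assms(2) by (simp add: nrm_def)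
  then have "AE x in M. (cmod (f x))\<^sup>2 = 0"
    using integral_nonneg_eq_0_iff_AE[OF sq_integrable[OF assms(1)]] by simp
  then show ?thesis by simp
qed

lemma sq_mult_integrable:
  assumes "f \<in> sq M" "g \<in> sq M" shows "integrable M (\<lambda>x. f x * g x)"
proof (rule Bochner_Integration.integrable_bound)
  show "integrable M (\<lambda>x. (cmod (f x))\<^sup>2 + (cmod (g x))\<^sup>2)"
    using assms by (auto simp: sq_def)
  show "AE x in M. norm (f x * g x) \<le> norm ((cmod (f x))\<^sup>2 + (cmod (g x))\<^sup>2)"
  proof (rule AE_I2)
    fix x
    show "norm (f x * g x) \<le> norm ((cmod (f x))\<^sup>2 + (cmod (g x))\<^sup>2)"
      using sum_squares_bound[of "cmod (f x)" "cmod (g x)"] mult_nonneg_nonneg[of "cmod (f x)" "cmod (g x)"]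
      by (simp add: norm_mult del: mult_nonneg_nonneg)
  qed
qed (use assms in \<open>auto simp: sq_def\<close>)

lemma sq_norm_mult_integrable:
  assumes "f \<in> sq M" "g \<in> sq M" shows "integrable M (\<lambda>x. cmod (f x) * cmod (g x))"
  using integrable_norm[OF sq_mult_integrable[OF assms]] by (simp add: norm_mult)

text \<open>With \<open>a\<close>, \<open>b\<close> the two norms, integrate
  \<open>2 a b |f| |g| \<le> b^2 |f|^2 + a^2 |g|^2\<close> and cancel \<open>2 a b\<close>. The
  cancellation is why zero norms are treated separately.\<close>

lemma Cauchy_Schwarz_sq:
  assumes f: "f \<in> sq M" and g: "g \<in> sq M"
  shows "(\<integral>x. cmod (f x) * cmod (g x) \<partial>M) \<le> nrm M f * nrm M g"
proof -
  let ?I = "\<integral>x. cmod (f x) * cmod (g x) \<partial>M"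
  consider "nrm M f = 0" | "nrm M g = 0" | "nrm M f > 0" "nrm M g > 0"
    using nrm_nonneg[of M f] nrm_nonneg[of M g] by linarith
  then show ?thesis
  proof cases
    case 1
    then have "AE x in M. cmod (f x) * cmod (g x) = 0"
      using nrm_eq_0_AE[OF f] by auto
    then have "?I = 0" by (rule integral_eq_zero_AE)
    then show ?thesis by simp
  next
    case 2
    then have "AE x in M. cmod (f x) * cmod (g x) = 0"
      using nrm_eq_0_AE[OF g] by auto
    then have "?I = 0" by (rule integral_eq_zero_AE)
    then show ?thesis by simp
  next
    case 3
    let ?a = "nrm M f" and ?b = "nrm M g"
    have int: "integrable M (\<lambda>x. cmod (f x) * cmod (g x))"
      by (rule sq_norm_mult_integrable[OF f g])
    have "2 * (?a * ?b) * ?I = (\<integral>x. 2 * (?a * ?b) * (cmod (f x) * cmod (g x)) \<partial>M)"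
      by simp
    also have "\<dots> \<le> (\<integral>x. ?b\<^sup>2 * (cmod (f x))\<^sup>2 + ?a\<^sup>2 * (cmod (g x))\<^sup>2 \<partial>M)"
    proof (rule integral_mono)
      show "2 * (?a * ?b) * (cmod (f x) * cmod (g x)) \<le> ?b\<^sup>2 * (cmod (f x))\<^sup>2 + ?a\<^sup>2 * (cmod (g x))\<^sup>2" for x
        using sum_squares_bound[of "?b * cmod (f x)" "?a * cmod (g x)"]
        by (simp add: power_mult_distrib mult.assoc mult.left_commute mult.commute)
    qed (intro Bochner_Integration.integrable_add integrable_mult_right sq_integrable int f g)+
    also have "\<dots> = ?b\<^sup>2 * ?a\<^sup>2 + ?a\<^sup>2 * ?b\<^sup>2"
      using f g by (simp add: sq_integrable nrm_square)
    also have "\<dots> = 2 * (?a * ?b) * (?a * ?b)"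
      by (simp add: power2_eq_square algebra_simps)
    finally show ?thesis
      using 3 by simp
  qed
qed

lemma norm_integral_mult_le:
  assumes "f \<in> sq M" "g \<in> sq M"
  shows "cmod (\<integral>x. f x * g x \<partial>M) \<le> nrm M f * nrm M g"
  using Cauchy_Schwarz_sq[OF assms] integral_norm_bound[of M "\<lambda>x. f x * g x"]
  by (simp add: norm_mult)

lemma nrm_triangle:
  assumes f: "f \<in> sq M" and g: "g \<in> sq M"
  shows "nrm M (\<lambda>x. f x + g x) \<le> nrm M f + nrm M g"
proof (rule power2_le_imp_le)
  have "(nrm M (\<lambda>x. f x + g x))\<^sup>2 \<le> (\<integral>x. (cmod (f x))\<^sup>2 + 2 * (cmod (f x) * cmod (g x)) + (cmod (g x))\<^sup>2 \<partial>M)"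
    unfolding nrm_square
  proof (rule integral_mono)
    show "(cmod (f x + g x))\<^sup>2 \<le> (cmod (f x))\<^sup>2 + 2 * (cmod (f x) * cmod (g x)) + (cmod (g x))\<^sup>2" for x
      using power_mono[OF norm_triangle_ineq[of "f x" "g x"], of 2] by (simp add: power2_sum)
    show "integrable M (\<lambda>x. (cmod (f x + g x))\<^sup>2)"
      by (rule sq_integrable) (use f g in auto)
    show "integrable M (\<lambda>x. (cmod (f x))\<^sup>2 + 2 * (cmod (f x) * cmod (g x)) + (cmod (g x))\<^sup>2)"
      by (intro Bochner_Integration.integrable_add integrable_mult_right sq_integrable
        sq_norm_mult_integrable f g)
  qed
  also have "\<dots> = (nrm M f)\<^sup>2 + 2 * (\<integral>x. cmod (f x) * cmod (g x) \<partial>M) + (nrm M g)\<^sup>2"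
    using f g sq_norm_mult_integrable[OF f g] by (simp add: sq_integrable nrm_square)
  also have "\<dots> \<le> (nrm M f + nrm M g)\<^sup>2"
    using Cauchy_Schwarz_sq[OF f g] by (simp add: power2_sum)
  finally show "(nrm M (\<lambda>x. f x + g x))\<^sup>2 \<le> (nrm M f + nrm M g)\<^sup>2" .
qed auto

lemma nrm_add_square:
  assumes f: "f \<in> sq M" and g: "g \<in> sq M"
  shows "(nrm M (\<lambda>x. f x + g x))\<^sup>2
    = (nrm M f)\<^sup>2 + 2 * Re (\<integral>x. cnj (f x) * g x \<partial>M) + (nrm M g)\<^sup>2"
proof -
  have i: "integrable M (\<lambda>x. cnj (f x) * g x)"
    using sq_mult_integrable[OF sq_cnj[OF f] g] .
  have "(cmod (a + b))\<^sup>2 = (cmod a)\<^sup>2 + 2 * Re (cnj a * b) + (cmod b)\<^sup>2" for a b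
    unfolding cmod_power2 by (simp add: power2_eq_square algebra_simps)
  then have "(nrm M (\<lambda>x. f x + g x))\<^sup>2
      = (\<integral>x. (cmod (f x))\<^sup>2 + 2 * Re (cnj (f x) * g x) + (cmod (g x))\<^sup>2 \<partial>M)"
    by (simp add: nrm_square)
  also have "\<dots> = (nrm M f)\<^sup>2 + 2 * (\<integral>x. Re (cnj (f x) * g x) \<partial>M) + (nrm M g)\<^sup>2"
    using f g integrable_Re[OF i]
    by (simp add: sq_integrable nrm_square del: complex_mod_cnj times_complex.sel)
  also have "(\<integral>x. Re (cnj (f x) * g x) \<partial>M) = Re (\<integral>x. cnj (f x) * g x \<partial>M)"
    by (rule integral_Re[OF i])
  finally show ?thesis .
qed

subsection \<open>Classes and representatives\<close>

lemma L2_iff: "L2 M = L2_class M ` sq M"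
  by (simp add: L2_def sq_def)

lemma L2_class_sq: "L2_class M f = {g \<in> sq M. AE x in M. g x = f x}"
  by (auto simp: L2_class_def sq_def)

lemma L2_class_in [intro]: "f \<in> sq M \<Longrightarrow> L2_class M f \<in> L2 M"
  by (auto simp: L2_iff)

lemma L2_class_cong: "AE x in M. f x = g x \<Longrightarrow> L2_class M f = L2_class M g"
  unfolding L2_class_sq by (auto elim!: AE_mp)

lemma L2_rep_class:
  assumes "f \<in> sq M"
  shows "L2_rep (L2_class M f) \<in> sq M" "AE x in M. L2_rep (L2_class M f) x = f x"
proof -
  have "L2_rep (L2_class M f) \<in> L2_class M f"
    unfolding L2_rep_def by (rule someI[of _ f]) (use assms in \<open>auto simp: L2_class_sq\<close>)
  then show "L2_rep (L2_class M f) \<in> sq M" "AE x in M. L2_rep (L2_class M f) x = f x"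
    by (auto simp: L2_class_sq)
qed

lemma L2_rep_sq [intro]: "u \<in> L2 M \<Longrightarrow> L2_rep u \<in> sq M"
  by (auto simp: L2_iff intro: L2_rep_class)

lemma L2_class_rep [simp]: "u \<in> L2 M \<Longrightarrow> L2_class M (L2_rep u) = u"
  by (auto simp only: L2_iff intro!: L2_class_cong L2_rep_class)

lemma L2_eqI:
  "u \<in> L2 M \<Longrightarrow> v \<in> L2 M \<Longrightarrow> AE x in M. L2_rep u x = L2_rep v x \<Longrightarrow> u = v"
  by (metis L2_class_cong L2_class_rep)

lemma L2_add_class:
  assumes "f \<in> sq M" "g \<in> sq M"
  shows "L2_add M (L2_class M f) (L2_class M g) = L2_class M (\<lambda>x. f x + g x)"
  unfolding L2_add_def using L2_rep_class(2)[OF assms(1)] L2_rep_class(2)[OF assms(2)]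
  by (intro L2_class_cong) auto

lemma L2_mult_class:
  assumes "f \<in> sq M"
  shows "L2_mult M a (L2_class M f) = L2_class M (\<lambda>x. a x * f x)"
  unfolding L2_mult_def using L2_rep_class(2)[OF assms(1)]
  by (intro L2_class_cong) auto

lemma L2_norm_class: "f \<in> sq M \<Longrightarrow> L2_norm M (L2_class M f) = nrm M f"
  unfolding L2_norm_def nrm_def[symmetric] by (intro nrm_cong_AE L2_rep_class)

lemma L2_norm_rep: "L2_norm M u = nrm M (L2_rep u)"
  by (simp add: L2_norm_def nrm_def)

subsection \<open>Completeness and the Riesz representation\<close>

text \<open>Completeness for sequences with a geometric rate. The rate gives a single integrable
  function that dominates all increments, so the telescoping series converges pointwise and the
  convergence in norm comes from the same domination.\<close>

lemma sq_rapidly_Cauchy_convergent: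
  assumes f: "\<And>n::nat. f n \<in> sq M"
    and c: "\<And>n. (nrm M (\<lambda>x. f (Suc n) x - f n x))\<^sup>2 \<le> c / 8 ^ n"
  shows "\<exists>F\<in>sq M. (\<lambda>n. nrm M (\<lambda>x. F x - f n x)) \<longlonglongrightarrow> 0"
proof -
  define d where "d n x = cmod (f (Suc n) x - f n x)" for n x
  have fm [measurable]: "f n \<in> borel_measurable M" for n
    using f by (rule sq_measurable)
  have dm [measurable]: "d n \<in> borel_measurable M" for n
    unfolding d_def by measurable
  have fd: "(\<lambda>x. f (Suc n) x - f n x) \<in> sq M" for n
    using f by auto
  have d2: "integrable M (\<lambda>x. 4 ^ n * (d n x)\<^sup>2)" for n
    unfolding d_def using sq_integrable[OF fd[of n]] by auto
  \<comment> \<open>The weight \<open>4^n\<close> turns the rate \<open>8^-n\<close> of the squared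
    increments into the summable \<open>2^-n\<close>, and its square root leaves the pointwise bound
    \<open>d n x \<le> sqrt (H x) * 2^-n\<close>.\<close>
  define H where "H x = (\<Sum>n. 4 ^ n * (d n x)\<^sup>2)" for x
  have i_le: "(\<integral>x. 4 ^ n * (d n x)\<^sup>2 \<partial>M) \<le> c * (1/2) ^ n" for n
  proof -
    have "(\<integral>x. 4 ^ n * (d n x)\<^sup>2 \<partial>M) = 4 ^ n * (nrm M (\<lambda>x. f (Suc n) x - f n x))\<^sup>2"
      by (simp add: nrm_square d_def)
    also have "\<dots> \<le> 4 ^ n * (c / 8 ^ n)"
      by (intro mult_left_mono c) auto
    also have "\<dots> = c * (1/2) ^ n"
    proof -
      have "(8::real) ^ n = 4 ^ n * 2 ^ n" by (simp flip: power_mult_distrib)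
      then show ?thesis by (simp add: power_divide)
    qed
    finally show ?thesis .
  qed
  have sumI: "summable (\<lambda>n. \<integral>x. 4 ^ n * (d n x)\<^sup>2 \<partial>M)"
  proof (rule summable_comparison_test')
    show "summable (\<lambda>n. c * (1/2::real) ^ n)" by (intro summable_mult summable_geometric) auto
    show "norm (\<integral>x. 4 ^ n * (d n x)\<^sup>2 \<partial>M) \<le> c * (1/2) ^ n" for n
      using i_le[of n] by (simp add: integral_nonneg)
  qed
  have AE1: "AE x in M. summable (\<lambda>n. 4 ^ n * (d n x)\<^sup>2)"
  proof -
    have "(\<Sum>n. ennreal (\<integral>x. 4 ^ n * (d n x)\<^sup>2 \<partial>M)) < \<infinity>"
      using sumI by (subst suminf_ennreal2) (auto intro: integral_nonneg)
    then have "(\<integral>\<^sup>+x. (\<Sum>n. ennreal (4 ^ n * (d n x)\<^sup>2)) \<partial>M) < \<infinity>"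
      using d2 by (simp add: nn_integral_suminf nn_integral_eq_integral)
    then have "AE x in M. (\<Sum>n. ennreal (4 ^ n * (d n x)\<^sup>2)) \<noteq> \<infinity>"
      by (intro nn_integral_PInf_AE) auto
    then show ?thesis
      by eventually_elim (auto intro: summable_suminf_not_top)
  qed
  have Hint: "integrable M H"
    unfolding H_def using d2 AE1 sumI by (intro integrable_suminf) auto
  have H0: "0 \<le> H x" if "summable (\<lambda>n. 4 ^ n * (d n x)\<^sup>2)" for x
    unfolding H_def using that by (intro suminf_nonneg) auto
  have dH: "d n x \<le> sqrt (H x) * (1/2) ^ n" if "summable (\<lambda>n. 4 ^ n * (d n x)\<^sup>2)" for x n
  proof -
    have "4 ^ n * (d n x)\<^sup>2 \<le> H x"
      unfolding H_def using sum_le_suminf[OF that, of "{n}"] by auto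
    then have "sqrt (4 ^ n * (d n x)\<^sup>2) \<le> sqrt (H x)" by simp
    moreover have "sqrt (4 ^ n * (d n x)\<^sup>2) = 2 ^ n * d n x"
    proof -
      have "(4::real) ^ n = (2 ^ n)\<^sup>2" by (simp add: power2_eq_square flip: power_mult_distrib)
      then show ?thesis by (simp add: real_sqrt_mult d_def)
    qed
    ultimately show ?thesis by (simp add: field_simps power_divide)
  qed
  \<comment> \<open>Where the series diverges the value is unspecified; this happens only on a null
    set, and measurability holds regardless.\<close>
  define F where "F x = f 0 x + (\<Sum>n. f (Suc n) x - f n x)" for x
  have Fm [measurable]: "F \<in> borel_measurable M"
    unfolding F_def by measurable
  have Fd: "(cmod (F x - f n x))\<^sup>2 \<le> 4 * H x * (1/4) ^ n"
    if "summable (\<lambda>n. 4 ^ n * (d n x)\<^sup>2)" for x n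
  proof -
    have sg: "summable (\<lambda>k. sqrt (H x) * (1/2::real) ^ k)"
      by (intro summable_mult summable_geometric) auto
    have s: "summable (\<lambda>n. cmod (f (Suc n) x - f n x))"
      by (rule summable_comparison_test'[OF sg]) (use dH[OF that] in \<open>auto simp: d_def\<close>)
    note s' = summable_norm_cancel[OF s]
    have "F x - f n x = (\<Sum>k. f (Suc (k + n)) x - f (k + n) x)"
    proof -
      have "(\<Sum>k<n. f (Suc k) x - f k x) = f n x - f 0 x"
        by (rule sum_lessThan_telescope)
      then show ?thesis
        unfolding F_def using suminf_split_initial_segment[OF s', of n] by simp
    qed
    then have "cmod (F x - f n x) \<le> (\<Sum>k. d (k + n) x)"
      unfolding d_def using s summable_norm[of "\<lambda>k. f (Suc (k + n)) x - f (k + n) x"]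
        summable_iff_shift[of "\<lambda>n. cmod (f (Suc n) x - f n x)" n] by simp
    also have "\<dots> \<le> (\<Sum>k. sqrt (H x) * (1/2) ^ n * (1/2) ^ k)"
    proof (rule suminf_le)
      show "d (k + n) x \<le> sqrt (H x) * (1/2) ^ n * (1/2) ^ k" for k
        using dH[OF that, of "k + n"] by (simp add: power_add mult_ac)
      show "summable (\<lambda>k. d (k + n) x)"
        using s summable_iff_shift[of "\<lambda>n. cmod (f (Suc n) x - f n x)" n] by (simp add: d_def)
      show "summable (\<lambda>k. sqrt (H x) * (1/2) ^ n * (1/2) ^ k)"
        by (intro summable_mult summable_geometric) auto
    qed
    also have "\<dots> = sqrt (H x) * (1/2) ^ n * 2"
      by (subst suminf_mult) (auto simp: suminf_geometric)
    finally have "(cmod (F x - f n x))\<^sup>2 \<le> (sqrt (H x) * (1/2) ^ n * 2)\<^sup>2"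
      by (intro power_mono) auto
    also have "\<dots> = 4 * H x * (1/4) ^ n"
    proof -
      have "((1/2::real) ^ n)\<^sup>2 = (1/4) ^ n"
        by (simp add: power2_eq_square flip: power_mult_distrib)
      then show ?thesis
        using H0[OF that] by (simp add: power_mult_distrib)
    qed
    finally show ?thesis .
  qed
  have FdAE: "AE x in M. (cmod (F x - f n x))\<^sup>2 \<le> 4 * H x * (1/4) ^ n" for n
    using AE1 by eventually_elim (rule Fd)
  have int: "integrable M (\<lambda>x. (cmod (F x - f n x))\<^sup>2)" for n
  proof (rule Bochner_Integration.integrable_bound)
    show "integrable M (\<lambda>x. 4 * H x * (1/4) ^ n)" using Hint by auto
    show "AE x in M. norm ((cmod (F x - f n x))\<^sup>2) \<le> norm (4 * H x * (1/4) ^ n)"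
      using FdAE[of n] by eventually_elim auto
  qed auto
  have FnS: "(\<lambda>x. F x - f n x) \<in> sq M" for n
    unfolding sq_def using int by auto
  have "F \<in> sq M"
    using sq_add[OF FnS[of 0] f[of 0]] by simp
  moreover have "(\<lambda>n. nrm M (\<lambda>x. F x - f n x)) \<longlonglongrightarrow> 0"
  proof -
    have le: "(\<integral>x. (cmod (F x - f n x))\<^sup>2 \<partial>M) \<le> 4 * (\<integral>x. H x \<partial>M) * (1/4) ^ n" for n
    proof -
      have "(\<integral>x. (cmod (F x - f n x))\<^sup>2 \<partial>M) \<le> (\<integral>x. 4 * H x * (1/4) ^ n \<partial>M)"
        using int Hint FdAE[of n] by (intro integral_mono_AE) auto
      then show ?thesis by simp
    qed
    have "(\<lambda>n. (1/4::real) ^ n) \<longlonglongrightarrow> 0"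
      by (rule LIMSEQ_power_zero) simp
    then have "(\<lambda>n. 4 * (\<integral>x. H x \<partial>M) * (1/4::real) ^ n) \<longlonglongrightarrow> 0"
      by (rule tendsto_mult_right_zero)
    then have "(\<lambda>n. \<integral>x. (cmod (F x - f n x))\<^sup>2 \<partial>M) \<longlonglongrightarrow> 0"
    proof (rule Lim_null_comparison[rotated])
      show "\<forall>\<^sub>F n in sequentially. norm (\<integral>x. (cmod (F x - f n x))\<^sup>2 \<partial>M)
          \<le> 4 * (\<integral>x. H x \<partial>M) * (1/4) ^ n"
      proof (rule always_eventually, rule allI)
        fix n
        show "norm (\<integral>x. (cmod (F x - f n x))\<^sup>2 \<partial>M) \<le> 4 * (\<integral>x. H x \<partial>M) * (1/4) ^ n"
          using le[of n] Bochner_Integration.integral_nonneg[of M "\<lambda>x. (cmod (F x - f n x))\<^sup>2"]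
          by (simp only: real_norm_def abs_of_nonneg zero_le_power2)
      qed
    qed
    from tendsto_real_sqrt[OF this] show ?thesis
      by (simp add: nrm_def)
  qed
  ultimately show ?thesis by blast
qed

lemma nrm_square_Re: "(nrm M f)\<^sup>2 = Re (\<integral>x. f x * cnj (f x) \<partial>M)"
  by (simp only: complex_norm_square[symmetric] integral_complex_of_real Re_complex_of_real nrm_square)

text \<open>Testing against the conjugate of the difference makes the norm of the difference
  zero.\<close>

lemma sq_eq_AE_I:
  assumes f: "f \<in> sq M" and g: "g \<in> sq M"
    and eq: "\<And>h. h \<in> sq M \<Longrightarrow> (\<integral>x. f x * h x \<partial>M) = (\<integral>x. g x * h x \<partial>M)"
  shows "AE x in M. f x = g x"
proof -
  have d: "(\<lambda>x. f x - g x) \<in> sq M" using f g by auto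
  let ?h = "\<lambda>x. cnj (f x - g x)"
  have h: "?h \<in> sq M" by (rule sq_cnj[OF d])
  have "(nrm M (\<lambda>x. f x - g x))\<^sup>2 = Re (\<integral>x. (f x - g x) * ?h x \<partial>M)"
    by (rule nrm_square_Re)
  also have "(\<integral>x. (f x - g x) * ?h x \<partial>M) = (\<integral>x. f x * ?h x - g x * ?h x \<partial>M)"
    by (simp only: left_diff_distrib)
  also have "\<dots> = (\<integral>x. f x * ?h x \<partial>M) - (\<integral>x. g x * ?h x \<partial>M)"
    by (rule Bochner_Integration.integral_diff) (rule sq_mult_integrable f g h)+
  also have "\<dots> = 0"
    using eq[OF h] by simp
  finally have "nrm M (\<lambda>x. f x - g x) = 0" by simp
  from nrm_eq_0_AE[OF d this] show ?thesis by simp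
qed

lemma nonneg_quadratic_zero:
  fixes a G :: real
  assumes q: "\<And>t. 0 \<le> t\<^sup>2 * G + 2 * t * a" and G: "0 \<le> G"
  shows "a = 0"
proof -
  \<comment> \<open>The minimiser would be \<open>- a / G\<close>; dividing by \<open>G + 1\<close>
    instead also covers \<open>G = 0\<close>.\<close>
  define b where "b = a / (G + 1)"
  have a: "a = b * (G + 1)" using G by (simp add: b_def)
  have "0 \<le> b\<^sup>2 * G - 2 * b * a" using q[of "- b"] by simp
  also have "\<dots> = - (b\<^sup>2 * (G + 2))"
    unfolding a by (simp add: power2_eq_square algebra_simps)
  finally have "b\<^sup>2 * (G + 2) \<le> 0" by simp
  then have "b = 0" using G by (auto simp: mult_le_0_iff)
  then show ?thesis by (simp add: a)
qed

text \<open>Variational proof: minimise \<open>||f||^2 - 2 Re (L f)\<close>. The parallelogram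
  identity makes a minimising sequence Cauchy, and the first variation at the minimiser
  \<open>F\<close> vanishes, which says that \<open>L\<close> is integration against
  \<open>cnj F\<close>.\<close>

lemma sq_Riesz_representation:
  assumes add: "\<And>f g. f \<in> sq M \<Longrightarrow> g \<in> sq M \<Longrightarrow> L (\<lambda>x. f x + g x) = L f + L g"
    and scale: "\<And>c f. f \<in> sq M \<Longrightarrow> L (\<lambda>x. c * f x) = c * L f"
    and bound: "\<And>f. f \<in> sq M \<Longrightarrow> cmod (L f) \<le> C * nrm M f"
  shows "\<exists>r\<in>sq M. \<forall>f\<in>sq M. L f = (\<integral>x. r x * f x \<partial>M)"
proof -
  define J where "J f = (nrm M f)\<^sup>2 - 2 * Re (L f)" for f
  define \<mu> where "\<mu> = (INF f\<in>sq M. J f)"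
  \<comment> \<open>Completing the square in \<open>nrm M f - C\<close>.\<close>
  have Jlow: "- C\<^sup>2 \<le> J f" if "f \<in> sq M" for f
  proof -
    have "Re (L f) \<le> C * nrm M f"
      using bound[OF that] complex_Re_le_cmod[of "L f"] by linarith
    moreover have "0 \<le> (nrm M f - C)\<^sup>2" by simp
    ultimately show ?thesis
      by (simp add: J_def power2_diff mult.assoc mult.commute[of C])
  qed
  have bdd: "bdd_below (J ` sq M)"
    using Jlow by (auto intro!: bdd_belowI)
  have J\<mu>: "\<mu> \<le> J f" if "f \<in> sq M" for f
    unfolding \<mu>_def using that by (intro cINF_lower bdd)
  have par: "(nrm M (\<lambda>x. f x - g x))\<^sup>2 \<le> 2 * (J f - \<mu>) + 2 * (J g - \<mu>)"
    if f: "f \<in> sq M" and g: "g \<in> sq M" for f g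
  proof -
    have g': "(\<lambda>x. - g x) \<in> sq M" using g by auto
    have n': "nrm M (\<lambda>x. - g x) = nrm M g" by (simp add: nrm_def)
    have "Re (\<integral>x. cnj (f x) * - g x \<partial>M) = - Re (\<integral>x. cnj (f x) * g x \<partial>M)"
      by simp
    then have d: "(nrm M (\<lambda>x. f x - g x))\<^sup>2
        = (nrm M f)\<^sup>2 - 2 * Re (\<integral>x. cnj (f x) * g x \<partial>M) + (nrm M g)\<^sup>2"
      using nrm_add_square[OF f g'] unfolding n' by simp
    have s: "(\<lambda>x. f x + g x) \<in> sq M" using f g by auto
    have h: "(\<lambda>x. (1/2) * (f x + g x)) \<in> sq M" by (rule sq_scale[OF s])
    have "J (\<lambda>x. (1/2) * (f x + g x)) = (nrm M (\<lambda>x. f x + g x))\<^sup>2 / 4 - (Re (L f) + Re (L g))"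
      unfolding J_def scale[OF s] nrm_scale add[OF f g] by (simp add: power_divide field_simps)
    then have "4 * \<mu> \<le> (nrm M (\<lambda>x. f x + g x))\<^sup>2 - 4 * (Re (L f) + Re (L g))"
      using J\<mu>[OF h] by simp
    then show ?thesis
      unfolding d nrm_add_square[OF f g] J_def by simp
  qed
  \<comment> \<open>The rate \<open>8^-n\<close> is chosen so that \<open>par\<close> yields
    increments as fast as \<open>sq_rapidly_Cauchy_convergent\<close> demands.\<close>
  have "\<exists>f\<in>sq M. J f < \<mu> + 1 / 8 ^ n" for n :: nat
  proof -
    have "(INF f\<in>sq M. J f) < \<mu> + 1 / 8 ^ n" by (simp add: \<mu>_def)
    then show ?thesis
      using sq_zero by (subst (asm) cINF_less_iff[OF _ bdd]) auto
  qed
  then obtain f where f: "\<And>n. f n \<in> sq M" and fJ: "\<And>n. J (f n) < \<mu> + 1 / 8 ^ n"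
    by metis
  have "(nrm M (\<lambda>x. f (Suc n) x - f n x))\<^sup>2 \<le> 4 / 8 ^ n" for n
  proof -
    define a b where "a = (1::real) / 8 ^ n" and "b = (1::real) / 8 ^ Suc n"
    have "b \<le> a" by (simp add: a_def b_def field_simps)
    moreover have "J (f n) < \<mu> + a" "J (f (Suc n)) < \<mu> + b"
      unfolding a_def b_def by (rule fJ)+
    ultimately have "2 * (J (f (Suc n)) - \<mu>) + 2 * (J (f n) - \<mu>) \<le> 4 * a" by argo
    with par[OF f f] have "(nrm M (\<lambda>x. f (Suc n) x - f n x))\<^sup>2 \<le> 4 * a" by (rule order_trans)
    then show ?thesis by (simp add: a_def)
  qed
  from sq_rapidly_Cauchy_convergent[OF f this]
  obtain F where F: "F \<in> sq M" and lim: "(\<lambda>n. nrm M (\<lambda>x. F x - f n x)) \<longlonglongrightarrow> 0"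
    by blast
  have JF: "J F \<le> \<mu>"
  proof -
    define e where "e n = nrm M (\<lambda>x. F x - f n x)" for n
    have up: "J F \<le> \<mu> + 1 / 8 ^ n + ((e n)\<^sup>2 + 2 * ((nrm M F + e n) * e n) + 2 * (C * e n))" for n
    proof -
      let ?d = "\<lambda>x. F x - f n x"
      have d: "?d \<in> sq M" using F f by auto
      have "nrm M (f n) \<le> nrm M F + e n"
        using nrm_triangle[OF F sq_diff[OF f[of n] F]] nrm_minus_commute[of M F "f n"] by (simp add: e_def)
      then have "nrm M (f n) * e n \<le> (nrm M F + e n) * e n"
        by (intro mult_right_mono) (auto simp: e_def)
      moreover have "Re (\<integral>x. cnj (f n x) * ?d x \<partial>M) \<le> nrm M (f n) * e n"
        using norm_integral_mult_le[OF sq_cnj[OF f[of n]] d] complex_Re_le_cmod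
          order_trans unfolding e_def nrm_cnj by blast
      moreover have "(nrm M F)\<^sup>2 = (nrm M (f n))\<^sup>2 + 2 * Re (\<integral>x. cnj (f n x) * ?d x \<partial>M) + (e n)\<^sup>2"
        using nrm_add_square[OF f[of n] d] by (simp add: e_def)
      moreover have "Re (L F) = Re (L (f n)) + Re (L ?d)"
        using add[OF f[of n] d] by simp
      moreover have "- Re (L ?d) \<le> C * e n"
        using bound[OF d] abs_Re_le_cmod[of "L ?d"] by (simp add: e_def)
      ultimately show ?thesis
        using fJ[of n] unfolding J_def by linarith
    qed
    have "e \<longlonglongrightarrow> 0" using lim unfolding e_def .
    moreover have "(\<lambda>n. (1::real) / 8 ^ n) \<longlonglongrightarrow> 0"
      using LIMSEQ_power_zero[of "1/8::real"] by (simp add: power_one_over)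
    ultimately have "(\<lambda>n. \<mu> + 1 / 8 ^ n + ((e n)\<^sup>2 + 2 * ((nrm M F + e n) * e n) + 2 * (C * e n)))
        \<longlonglongrightarrow> \<mu> + 0 + (0\<^sup>2 + 2 * ((nrm M F + 0) * 0) + 2 * (C * 0))"
      by (intro tendsto_add tendsto_mult tendsto_power tendsto_const)
    from LIMSEQ_le_const[OF this] up show ?thesis by auto
  qed
  \<comment> \<open>Perturbing the minimiser by a real multiple \<open>t\<close> of \<open>g\<close>
    gives a quadratic in \<open>t\<close> that is never negative, so its linear coefficient is
    zero.\<close>
  have Re0: "Re (\<integral>x. cnj (F x) * g x \<partial>M) - Re (L g) = 0" (is "?a = 0") if g: "g \<in> sq M" for g
  proof -
    define G where "G = (nrm M g)\<^sup>2"
    have q: "0 \<le> t\<^sup>2 * G + 2 * t * ?a" for t :: real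
    proof -
      let ?tg = "\<lambda>x. complex_of_real t * g x"
      have tg: "?tg \<in> sq M" using g by (rule sq_scale)
      have "(\<integral>x. cnj (F x) * ?tg x \<partial>M) = of_real t * (\<integral>x. cnj (F x) * g x \<partial>M)"
        by (simp add: mult.left_commute)
      then have "J (\<lambda>x. F x + ?tg x) = J F + (t\<^sup>2 * G + 2 * t * ?a)"
        unfolding J_def nrm_add_square[OF F tg] add[OF F tg] scale[OF g] nrm_scale G_def
        by (simp add: power_mult_distrib algebra_simps)
      then show ?thesis
        using J\<mu>[OF sq_add[OF F tg]] JF by simp
    qed
    have G: "0 \<le> G" by (simp add: G_def)
    show ?thesis by (rule nonneg_quadratic_zero[OF q G])
  qed
  show ?thesis
  proof (intro bexI[of _ "\<lambda>x. cnj (F x)"] ballI complex_eqI sq_cnj F)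
    fix g assume g: "g \<in> sq M"
    show "Re (L g) = Re (\<integral>x. cnj (F x) * g x \<partial>M)"
      using Re0[OF g] by simp
    \<comment> \<open>The real part identity applied to \<open>\<i> * g\<close> supplies the
      imaginary part.\<close>
    have ig: "(\<lambda>x. \<i> * g x) \<in> sq M" using g by auto
    have "(\<integral>x. cnj (F x) * (\<i> * g x) \<partial>M) = \<i> * (\<integral>x. cnj (F x) * g x \<partial>M)"
      by (simp add: mult.left_commute)
    then show "Im (L g) = Im (\<integral>x. cnj (F x) * g x \<partial>M)"
      using Re0[OF ig] scale[OF g, of \<i>] by simp
  qed
qed

subsection \<open>Bounded operators as bounded bilinear forms\<close>

text \<open>Bilinear and not sesquilinear: the duality pairs \<open>T f\<close> with
  \<open>cnj g\<close>, so the two conjugations cancel. All later work with operators goes through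
  such forms on functions, away from classes.\<close>

definition bounded_form :: "'a measure \<Rightarrow> 'b measure \<Rightarrow> real
    \<Rightarrow> (('a \<Rightarrow> complex) \<Rightarrow> ('b \<Rightarrow> complex) \<Rightarrow> complex) \<Rightarrow> bool" where
  "bounded_form M N C B \<longleftrightarrow>
     (\<forall>f\<in>sq M. \<forall>f'\<in>sq M. \<forall>g\<in>sq N. B (\<lambda>x. f x + f' x) g = B f g + B f' g) \<and>
     (\<forall>c. \<forall>f\<in>sq M. \<forall>g\<in>sq N. B (\<lambda>x. c * f x) g = c * B f g) \<and>
     (\<forall>f\<in>sq M. \<forall>g\<in>sq N. \<forall>g'\<in>sq N. B f (\<lambda>y. g y + g' y) = B f g + B f g') \<and>
     (\<forall>c. \<forall>f\<in>sq M. \<forall>g\<in>sq N. B f (\<lambda>y. c * g y) = c * B f g) \<and>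
     (\<forall>f\<in>sq M. \<forall>g\<in>sq N. cmod (B f g) \<le> C * (nrm M f * nrm N g))"

lemma
  assumes "bounded_form M N C B" "f \<in> sq M" "g \<in> sq N"
  shows bounded_form_add_left: "f' \<in> sq M \<Longrightarrow> B (\<lambda>x. f x + f' x) g = B f g + B f' g"
    and bounded_form_scale_left: "B (\<lambda>x. c * f x) g = c * B f g"
    and bounded_form_add_right: "g' \<in> sq N \<Longrightarrow> B f (\<lambda>y. g y + g' y) = B f g + B f g'"
    and bounded_form_scale_right: "B f (\<lambda>y. c * g y) = c * B f g"
    and bounded_form_bound: "cmod (B f g) \<le> C * (nrm M f * nrm N g)"
  using assms by (simp_all add: bounded_form_def)

lemma bounded_form_uminus_left:
  "bounded_form M N C B \<Longrightarrow> f \<in> sq M \<Longrightarrow> g \<in> sq N \<Longrightarrow> B (\<lambda>x. - f x) g = - B f g"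
  using bounded_form_scale_left[of M N C B f g "-1"] by simp

lemma bounded_form_diff_left:
  assumes "bounded_form M N C B" "f \<in> sq M" "f' \<in> sq M" "g \<in> sq N"
  shows "B (\<lambda>x. f x - f' x) g = B f g - B f' g"
  using bounded_form_add_left[OF assms(1,2,4) sq_uminus[OF assms(3)]]
    bounded_form_uminus_left[OF assms(1,3,4)] by simp

lemma bounded_form_diff_right:
  assumes "bounded_form M N C B" "f \<in> sq M" "g \<in> sq N" "g' \<in> sq N"
  shows "B f (\<lambda>x. g x - g' x) = B f g - B f g'"
  using bounded_form_add_right[OF assms(1,2,3) sq_uminus[OF assms(4)]]
    bounded_form_scale_right[OF assms(1,2,4), of "-1"] by simp

lemma bounded_form_zero_left:
  assumes "bounded_form M N C B" "g \<in> sq N" shows "B (\<lambda>x. 0) g = 0"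
  using bounded_form_scale_left[OF assms(1) sq_zero assms(2), of 0] by simp

lemma bounded_form_sum_left:
  assumes "bounded_form M N C B" "finite I" "\<And>i. i \<in> I \<Longrightarrow> f i \<in> sq M" "g \<in> sq N"
  shows "B (\<lambda>x. \<Sum>i\<in>I. f i x) g = (\<Sum>i\<in>I. B (f i) g)"
  using assms(2,3)
proof (induction I rule: finite_induct)
  case empty
  then show ?case using bounded_form_zero_left[OF assms(1,4)] by simp
next
  case (insert i I)
  then show ?case
    using bounded_form_add_left[OF assms(1) _ assms(4), of "f i" "\<lambda>x. \<Sum>i\<in>I. f i x"] by (auto simp: sq_sum)
qed

lemma bounded_form_cong_AE_left:
  assumes B: "bounded_form M N C B" and f: "f \<in> sq M" "f' \<in> sq M" and g: "g \<in> sq N"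
    and eq: "AE x in M. f x = f' x"
  shows "B f g = B f' g"
proof -
  have "nrm M (\<lambda>x. f x - f' x) = nrm M (\<lambda>x. 0)"
    using f eq by (intro nrm_cong_AE) auto
  then have "cmod (B (\<lambda>x. f x - f' x) g) \<le> 0"
    using bounded_form_bound[OF B sq_diff[OF f] g] by simp
  then show ?thesis
    using bounded_form_diff_left[OF B f g] by simp
qed

definition form :: "'a measure \<Rightarrow> 'b measure \<Rightarrow> ('a, 'b) op
    \<Rightarrow> ('a \<Rightarrow> complex) \<Rightarrow> ('b \<Rightarrow> complex) \<Rightarrow> complex" where
  "form M N T f g = (\<integral>y. L2_rep (T (L2_class M f)) y * g y \<partial>N)"

lemma form_class:
  assumes "h \<in> sq N" "g \<in> sq N" "T (L2_class M f) = L2_class N h"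
  shows "form M N T f g = (\<integral>y. h y * g y \<partial>N)"
  unfolding form_def assms(3)
  using assms(1,2) L2_rep_class[OF assms(1)] sq_measurable
  by (intro integral_cong_AE) (auto intro!: borel_measurable_times sq_measurable)

lemma
  assumes "T \<in> bounded_ops M N"
  shows bounded_ops_L2: "u \<in> L2 M \<Longrightarrow> T u \<in> L2 N"
    and bounded_ops_add: "u \<in> L2 M \<Longrightarrow> v \<in> L2 M \<Longrightarrow> T (L2_add M u v) = L2_add N (T u) (T v)"
    and bounded_ops_scale: "u \<in> L2 M \<Longrightarrow> T (L2_mult M (\<lambda>_. c) u) = L2_mult N (\<lambda>_. c) (T u)"
    and bounded_ops_bounded: "\<exists>C. \<forall>u\<in>L2 M. L2_norm N (T u) \<le> C * L2_norm M u"
  using assms by (auto simp: bounded_ops_def)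

lemma bounded_form_form:
  assumes T: "T \<in> bounded_ops M N" and C: "\<And>u. u \<in> L2 M \<Longrightarrow> L2_norm N (T u) \<le> C * L2_norm M u"
  shows "bounded_form M N C (form M N T)"
proof -
  define r where "r f = L2_rep (T (L2_class M f))" for f
  have r: "r f \<in> sq N" "T (L2_class M f) = L2_class N (r f)" if "f \<in> sq M" for f
    using bounded_ops_L2[OF T L2_class_in[OF that]] by (auto simp: r_def)
  have form: "form M N T f g = (\<integral>y. r f y * g y \<partial>N)" for f g
    by (simp add: form_def r_def)
  show ?thesis
    unfolding bounded_form_def
  proof (intro conjI ballI allI)
    fix f f' g assume f: "f \<in> sq M" "f' \<in> sq M" and g: "g \<in> sq N"
    have "T (L2_class M (\<lambda>x. f x + f' x)) = L2_class N (\<lambda>y. r f y + r f' y)"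
      using bounded_ops_add[OF T L2_class_in[OF f(1)] L2_class_in[OF f(2)]]
      by (simp add: L2_add_class f r)
    then have "form M N T (\<lambda>x. f x + f' x) g = (\<integral>y. (r f y + r f' y) * g y \<partial>N)"
      by (intro form_class sq_add r f g)
    also have "\<dots> = (\<integral>y. r f y * g y + r f' y * g y \<partial>N)"
      by (simp add: distrib_right)
    also have "\<dots> = form M N T f g + form M N T f' g"
      unfolding form by (intro Bochner_Integration.integral_add sq_mult_integrable r f g)
    finally show "form M N T (\<lambda>x. f x + f' x) g = form M N T f g + form M N T f' g" .
  next
    fix c f g assume f: "f \<in> sq M" and g: "g \<in> sq N"
    have "T (L2_class M (\<lambda>x. c * f x)) = L2_class N (\<lambda>y. c * r f y)"
      using bounded_ops_scale[OF T L2_class_in[OF f], of c]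
      by (simp add: L2_mult_class f r)
    then have "form M N T (\<lambda>x. c * f x) g = (\<integral>y. (c * r f y) * g y \<partial>N)"
      by (intro form_class sq_scale r f g)
    then show "form M N T (\<lambda>x. c * f x) g = c * form M N T f g"
      unfolding form by (simp add: mult.assoc)
  next
    fix f g g' assume f: "f \<in> sq M" and g: "g \<in> sq N" "g' \<in> sq N"
    have "(\<integral>y. r f y * g y + r f y * g' y \<partial>N) = form M N T f g + form M N T f g'"
      unfolding form by (intro Bochner_Integration.integral_add sq_mult_integrable r f g)
    then show "form M N T f (\<lambda>y. g y + g' y) = form M N T f g + form M N T f g'"
      unfolding form by (simp add: distrib_left)
  next
    fix c f g assume "f \<in> sq M" "g \<in> sq N"
    show "form M N T f (\<lambda>y. c * g y) = c * form M N T f g"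
      unfolding form by (simp add: mult.left_commute)
  next
    fix f g assume f: "f \<in> sq M" and g: "g \<in> sq N"
    have "nrm N (r f) \<le> C * nrm M f"
      using C[OF L2_class_in[OF f]] by (simp add: L2_norm_class f r)
    then have "nrm N (r f) * nrm N g \<le> C * nrm M f * nrm N g"
      by (intro mult_right_mono) auto
    then show "cmod (form M N T f g) \<le> C * (nrm M f * nrm N g)"
      using norm_integral_mult_le[OF r(1)[OF f] g] unfolding form by (simp add: mult.assoc)
  qed
qed

lemma bounded_form_ex:
  assumes T: "T \<in> bounded_ops M N"
  obtains C where "0 \<le> C" "bounded_form M N C (form M N T)"
    "\<And>u. u \<in> L2 M \<Longrightarrow> L2_norm N (T u) \<le> C * L2_norm M u"
proof -
  obtain C where C: "\<And>u. u \<in> L2 M \<Longrightarrow> L2_norm N (T u) \<le> C * L2_norm M u"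
    using bounded_ops_bounded[OF T] by blast
  have C': "L2_norm N (T u) \<le> max C 0 * L2_norm M u" if "u \<in> L2 M" for u
    using C[OF that] mult_right_mono[of C "max C 0" "L2_norm M u"]
    by (simp add: L2_norm_rep)
  show thesis
    by (rule that[of "max C 0"]) (use bounded_form_form[OF T C'] C' in auto)
qed

lemma op_eqI:
  assumes S: "S \<in> L2 M \<rightarrow>\<^sub>E L2 N" and T: "T \<in> L2 M \<rightarrow>\<^sub>E L2 N"
    and eq: "\<And>f g. f \<in> sq M \<Longrightarrow> g \<in> sq N \<Longrightarrow> form M N S f g = form M N T f g"
  shows "S = T"
proof (rule PiE_ext[OF S T])
  fix u assume u: "u \<in> L2 M"
  have "S u \<in> L2 N" "T u \<in> L2 N" using S T u by auto
  then show "S u = T u"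
    using eq[OF L2_rep_sq[OF u]] u by (intro L2_eqI sq_eq_AE_I) (auto simp: form_def)
qed

text \<open>Riesz representation for each fixed \<open>f\<close>. The representing functions are
  unique only up to null sets, hence the chosen ones are linear in \<open>f\<close> only as classes,
  and this is enough for an operator between spaces of classes.\<close>

lemma bounded_form_op:
  assumes B: "bounded_form M N C B" and C: "0 \<le> C"
  shows "\<exists>T\<in>bounded_ops M N. (\<forall>u\<in>L2 M. L2_norm N (T u) \<le> C * L2_norm M u) \<and>
    (\<forall>f\<in>sq M. \<forall>g\<in>sq N. form M N T f g = B f g)"
proof -
  have "\<exists>r\<in>sq N. \<forall>g\<in>sq N. B f g = (\<integral>y. r y * g y \<partial>N)" if f: "f \<in> sq M" for f
    by (rule sq_Riesz_representation[where C = "C * nrm M f"])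
      (use bounded_form_add_right[OF B f] bounded_form_scale_right[OF B f]
        bounded_form_bound[OF B f] in \<open>auto simp: mult.assoc\<close>)
  then obtain r where r: "\<And>f. f \<in> sq M \<Longrightarrow> r f \<in> sq N"
    and rB: "\<And>f g. f \<in> sq M \<Longrightarrow> g \<in> sq N \<Longrightarrow> B f g = (\<integral>y. r f y * g y \<partial>N)"
    by metis
  \<comment> \<open>The definition uses one representative per class; \<open>Tc\<close> shows that
    any other one gives the same class.\<close>
  define T :: "('a, 'b) op" where "T = (\<lambda>u\<in>L2 M. L2_class N (r (L2_rep u)))"
  have Tc: "T (L2_class M f) = L2_class N (r f)" if f: "f \<in> sq M" for f
  proof -
    let ?f = "L2_rep (L2_class M f)"
    have "AE y in N. r ?f y = r f y"
    proof (rule sq_eq_AE_I)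
      fix g assume "g \<in> sq N"
      then show "(\<integral>y. r ?f y * g y \<partial>N) = (\<integral>y. r f y * g y \<partial>N)"
        using bounded_form_cong_AE_left[OF B _ f, of ?f g] L2_rep_class[OF f] rB[of _ g] f by auto
    qed (use f L2_rep_class[OF f] r in auto)
    then show ?thesis
      using f L2_class_cong[of "r ?f" "r f" N] by (simp add: T_def L2_class_in)
  qed
  have nr: "nrm N (r f) \<le> C * nrm M f" if f: "f \<in> sq M" for f
  proof -
    \<comment> \<open>Testing the form on \<open>f\<close> and the conjugate of \<open>r f\<close>
      bounds the square of \<open>nrm N (r f)\<close> by \<open>C * nrm M f * nrm N (r f)\<close>;
      one factor is then cancelled.\<close>
    let ?g = "\<lambda>y. cnj (r f y)"
    have g: "?g \<in> sq N" using r[OF f] by auto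
    have "(nrm N (r f))\<^sup>2 = Re (\<integral>y. r f y * ?g y \<partial>N)"
      by (rule nrm_square_Re)
    also have "\<dots> \<le> C * (nrm M f * nrm N (r f))"
      using bounded_form_bound[OF B f g] complex_Re_le_cmod[of "B f ?g"] rB[OF f g] by simp
    finally have le: "nrm N (r f) * nrm N (r f) \<le> (C * nrm M f) * nrm N (r f)"
      by (simp add: power2_eq_square mult.assoc)
    show ?thesis
    proof (cases "nrm N (r f) = 0")
      case True
      then show ?thesis using C by simp
    next
      case False
      then have "0 < nrm N (r f)" using nrm_nonneg[of N "r f"] by linarith
      then show ?thesis using le by (rule mult_right_le_imp_le[rotated])
    qed
  qed
  have Tf: "form M N T f g = B f g" if "f \<in> sq M" "g \<in> sq N" for f g
    using form_class[OF r[OF that(1)] that(2), of T M f] Tc[OF that(1)] rB[OF that] by simp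
  have ext: "T \<in> L2 M \<rightarrow>\<^sub>E L2 N"
    unfolding T_def using r by (auto intro!: L2_class_in)
  have "T \<in> bounded_ops M N"
    unfolding bounded_ops_def
  proof (intro CollectI conjI ballI allI ext)
    fix u v assume u: "u \<in> L2 M" and v: "v \<in> L2 M"
    obtain f g where fg: "f \<in> sq M" "u = L2_class M f" "g \<in> sq M" "v = L2_class M g"
      using u v by (auto simp: L2_iff)
    have s: "(\<lambda>x. f x + g x) \<in> sq M" using fg by auto
    have "AE y in N. r (\<lambda>x. f x + g x) y = r f y + r g y"
    proof (rule sq_eq_AE_I)
      fix h assume h: "h \<in> sq N"
      have "(\<integral>y. (r f y + r g y) * h y \<partial>N) = (\<integral>y. r f y * h y \<partial>N) + (\<integral>y. r g y * h y \<partial>N)"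
        unfolding distrib_right by (intro Bochner_Integration.integral_add sq_mult_integrable r fg h)
      then show "(\<integral>y. r (\<lambda>x. f x + g x) y * h y \<partial>N) = (\<integral>y. (r f y + r g y) * h y \<partial>N)"
        using bounded_form_add_left[OF B fg(1) h fg(3)] rB[OF _ h] fg s by simp
    qed (use fg r s in auto)
    then show "T (L2_add M u v) = L2_add N (T u) (T v)"
      using fg r by (simp add: L2_add_class Tc s L2_class_cong)
  next
    fix c u assume u: "u \<in> L2 M"
    obtain f where fg: "f \<in> sq M" "u = L2_class M f"
      using u by (auto simp: L2_iff)
    have s: "(\<lambda>x. c * f x) \<in> sq M" using fg by auto
    have "AE y in N. r (\<lambda>x. c * f x) y = c * r f y"
    proof (rule sq_eq_AE_I)
      fix h assume h: "h \<in> sq N"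
      show "(\<integral>y. r (\<lambda>x. c * f x) y * h y \<partial>N) = (\<integral>y. (c * r f y) * h y \<partial>N)"
        using bounded_form_scale_left[OF B fg(1) h, of c] rB[OF _ h] fg s by (simp add: mult.assoc)
    qed (use fg r s in auto)
    then show "T (L2_mult M (\<lambda>_. c) u) = L2_mult N (\<lambda>_. c) (T u)"
      using fg r by (simp add: L2_mult_class Tc s L2_class_cong)
  next
    show "\<exists>C. \<forall>u\<in>L2 M. L2_norm N (T u) \<le> C * L2_norm M u"
      using nr r by (intro exI[of _ C]) (auto simp: L2_iff Tc L2_norm_class)
  qed
  moreover have "\<forall>u\<in>L2 M. L2_norm N (T u) \<le> C * L2_norm M u"
    using nr r by (auto simp: L2_iff Tc L2_norm_class)
  ultimately show ?thesis using Tf by blast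
qed

lemma op_zero_ext: "op_zero M N \<in> L2 M \<rightarrow>\<^sub>E L2 N"
  by (auto simp: op_zero_def L2_zero_def)

lemma form_op_zero:
  assumes "f \<in> sq M" "g \<in> sq N" shows "form M N (op_zero M N) f g = 0"
  using assms form_class[of "\<lambda>_. 0" N g "op_zero M N" M f] by (simp add: op_zero_def L2_zero_def L2_class_in)

lemma form_op_add:
  assumes S: "S \<in> bounded_ops M N" and T: "T \<in> bounded_ops M N" and f: "f \<in> sq M" and g: "g \<in> sq N"
  shows "form M N (op_add M N S T) f g = form M N S f g + form M N T f g"
proof -
  let ?s = "L2_rep (S (L2_class M f))" and ?t = "L2_rep (T (L2_class M f))"
  have s: "?s \<in> sq N" and t: "?t \<in> sq N"
    using bounded_ops_L2[OF S] bounded_ops_L2[OF T] f by auto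
  have "form M N (op_add M N S T) f g = (\<integral>y. (?s y + ?t y) * g y \<partial>N)"
    using f by (intro form_class sq_add s t g) (auto simp: op_add_def L2_add_def)
  also have "\<dots> = form M N S f g + form M N T f g"
    unfolding form_def distrib_right by (intro Bochner_Integration.integral_add sq_mult_integrable s t g)
  finally show ?thesis .
qed

lemma form_op_scale:
  assumes T: "T \<in> bounded_ops M N" and f: "f \<in> sq M" and g: "g \<in> sq N"
  shows "form M N (op_scale M N c T) f g = c * form M N T f g"
proof -
  let ?t = "L2_rep (T (L2_class M f))"
  have t: "?t \<in> sq N"
    using bounded_ops_L2[OF T] f by auto
  have "form M N (op_scale M N c T) f g = (\<integral>y. (c * ?t y) * g y \<partial>N)"
    using f by (intro form_class sq_scale t g) (auto simp: op_scale_def L2_mult_def)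
  then show ?thesis
    by (simp add: form_def mult.assoc)
qed

lemma
  assumes T: "T \<in> bounded_ops M N" and A: "A \<in> sets M" and B: "B \<in> sets N"
  shows op_mult_indicator_ext: "op_mult M N (indicator B) T (indicator A) \<in> L2 M \<rightarrow>\<^sub>E L2 N"
    and form_op_mult_indicator: "\<And>f g. f \<in> sq M \<Longrightarrow> g \<in> sq N \<Longrightarrow>
      form M N (op_mult M N (indicator B) T (indicator A)) f g
        = form M N T (\<lambda>x. indicator A x * f x) (\<lambda>y. indicator B y * g y)"
proof -
  let ?S = "op_mult M N (indicator B) T (indicator A)"
  have S: "?S (L2_class M f) = L2_class N (\<lambda>y. indicator B y * L2_rep (T (L2_class M (\<lambda>x. indicator A x * f x))) y)"
    if "f \<in> sq M" for f
    using that L2_class_in[OF that] by (simp add: op_mult_def L2_mult_class) (simp add: L2_mult_def)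
  have sq: "L2_rep (T (L2_class M (\<lambda>x. indicator A x * f x))) \<in> sq N" if "f \<in> sq M" for f
    using bounded_ops_L2[OF T L2_class_in[OF sq_indicator[OF A that]]] by auto
  show "?S \<in> L2 M \<rightarrow>\<^sub>E L2 N"
  proof (rule PiE_I)
    fix u assume "u \<in> L2 M"
    then show "?S u \<in> L2 N"
      using S sq B by (auto simp: L2_iff[of M] intro!: L2_class_in sq_indicator)
  qed (simp add: op_mult_def)
  show "form M N ?S f g = form M N T (\<lambda>x. indicator A x * f x) (\<lambda>y. indicator B y * g y)"
    if f: "f \<in> sq M" and g: "g \<in> sq N" for f g
    using form_class[where T = ?S, OF sq_indicator[OF B sq[OF f]] g S[OF f]]
    by (simp add: form_def mult.assoc mult.left_commute)
qed

subsection \<open>The Hahn--Banach theorem for sublinear functionals\<close>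

text \<open>Real scalars are enough here: \<open>duality_attained\<close> recovers a complex
  functional from its real part.\<close>

definition sublinear_on :: "('c \<Rightarrow> complex) set \<Rightarrow> (('c \<Rightarrow> complex) \<Rightarrow> real) \<Rightarrow> bool" where
  "sublinear_on S p \<longleftrightarrow> (\<forall>f\<in>S. \<forall>g\<in>S. p (\<lambda>z. f z + g z) \<le> p f + p g) \<and>
     (\<forall>t\<ge>0. \<forall>f\<in>S. p (\<lambda>z. of_real t * f z) = t * p f)"

definition real_subspace :: "('c \<Rightarrow> complex) set \<Rightarrow> bool" where
  "real_subspace S \<longleftrightarrow> (\<lambda>z. 0) \<in> S \<and> (\<forall>f\<in>S. \<forall>g\<in>S. (\<lambda>z. f z + g z) \<in> S) \<and>
     (\<forall>t. \<forall>f\<in>S. (\<lambda>z. of_real t * f z) \<in> S)"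

lemma sublinear_on_zero:
  assumes "sublinear_on S p" "real_subspace S" shows "p (\<lambda>z. 0) = 0"
proof -
  have "(\<lambda>z. 0) \<in> S" using assms(2) unfolding real_subspace_def by blast
  with assms(1)[unfolded sublinear_on_def, THEN conjunct2, rule_format, of 0 "\<lambda>z. 0"]
  show ?thesis by simp
qed

lemma sublinear_on_uminus:
  assumes "sublinear_on S p" "real_subspace S" "f \<in> S" shows "- p (\<lambda>z. - f z) \<le> p f"
proof -
  have "(\<lambda>z. of_real (-1) * f z) \<in> S"
    using assms(2,3) unfolding real_subspace_def by blast
  then have "(\<lambda>z. - f z) \<in> S" by simp
  from assms(1)[unfolded sublinear_on_def, THEN conjunct1, rule_format, OF assms(3) this]
  have "p (\<lambda>z. f z + - f z) \<le> p f + p (\<lambda>z. - f z)" .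
  then show ?thesis
    using sublinear_on_zero[OF assms(1,2)] by simp
qed

text \<open>The infimum of \<open>q (x + t y) - t q y\<close> over \<open>t \<ge> 0\<close> is the
  usual way to lower \<open>q\<close> until it becomes linear along \<open>y\<close>:
  \<open>t = 0\<close> keeps it below \<open>q\<close>, and \<open>t = 1\<close> evaluated at
  \<open>- y\<close> gives the last claim.\<close>

lemma sublinear_on_lower:
  assumes q: "sublinear_on S q" and S: "real_subspace S" and y: "y \<in> S"
  defines "r \<equiv> \<lambda>x. INF t\<in>{0..}. q (\<lambda>z. x z + of_real t * y z) - t * q y"
  shows "sublinear_on S r" "\<And>x. x \<in> S \<Longrightarrow> r x \<le> q x" "r (\<lambda>z. - y z) \<le> - q y"
proof -
  have Sadd: "(\<lambda>z. f z + g z) \<in> S" if "f \<in> S" "g \<in> S" for f g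
    using S that unfolding real_subspace_def by blast
  have Ssc: "(\<lambda>z. of_real t * f z) \<in> S" if "f \<in> S" for f t
    using S that unfolding real_subspace_def by blast
  have Sum: "(\<lambda>z. - f z) \<in> S" if "f \<in> S" for f
    using Ssc[OF that, of "-1"] by simp
  have qadd: "q (\<lambda>z. f z + g z) \<le> q f + q g" if "f \<in> S" "g \<in> S" for f g
    using q that unfolding sublinear_on_def by blast
  have qsc: "q (\<lambda>z. of_real t * f z) = t * q f" if "f \<in> S" "0 \<le> t" for f t
    using q that unfolding sublinear_on_def by blast
  define e where "e x t = q (\<lambda>z. x z + of_real t * y z) - t * q y" for x t
  have r: "r x = (INF t\<in>{0..}. e x t)" for x by (simp add: r_def e_def)
  \<comment> \<open>Subadditivity for \<open>t y = (x + t y) + (- x)\<close> bounds the infimum from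
    below, uniformly in \<open>t\<close>.\<close>
  have low: "- q (\<lambda>z. - x z) \<le> e x t" if x: "x \<in> S" and t: "0 \<le> t" for x t
  proof -
    have "q (\<lambda>z. (x z + of_real t * y z) + - x z) \<le> q (\<lambda>z. x z + of_real t * y z) + q (\<lambda>z. - x z)"
      by (intro qadd Sadd Ssc Sum x y)
    then show ?thesis using qsc[OF y t] by (simp add: e_def)
  qed
  have bdd: "bdd_below (e x ` {0..})" if x: "x \<in> S" for x
    using low[OF x] by (auto intro!: bdd_belowI)
  have rle: "r x \<le> e x t" if "x \<in> S" "0 \<le> t" for x t
    unfolding r using that by (intro cINF_lower bdd) auto
  have rge: "c \<le> r x" if "\<And>t. 0 \<le> t \<Longrightarrow> c \<le> e x t" for c x
    unfolding r using that by (intro cINF_greatest) auto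
  show "r x \<le> q x" if "x \<in> S" for x
    using rle[OF that, of 0] by (simp add: e_def)
  show "r (\<lambda>z. - y z) \<le> - q y"
    using rle[OF Sum[OF y], of 1] sublinear_on_zero[OF q S] by (simp add: e_def)
  \<comment> \<open>One inequality suffices; applying it again with factor \<open>1 / s\<close>
    gives the reverse one.\<close>
  have pos: "r (\<lambda>z. of_real s * x z) \<le> s * r x" if x: "x \<in> S" and s: "0 < s" for s x
  proof -
    have "r (\<lambda>z. of_real s * x z) / s \<le> e x t" if t: "0 \<le> t" for t
    proof -
      have "r (\<lambda>z. of_real s * x z) \<le> e (\<lambda>z. of_real s * x z) (s * t)"
        using s t by (intro rle Ssc x) auto
      also have "\<dots> = q (\<lambda>z. of_real s * (x z + of_real t * y z)) - s * t * q y"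
        by (simp add: e_def algebra_simps)
      also have "\<dots> = s * e x t"
        using s by (subst qsc) (auto intro!: Sadd Ssc x y simp: e_def algebra_simps)
      finally show ?thesis using s by (simp add: field_simps)
    qed
    then have "r (\<lambda>z. of_real s * x z) / s \<le> r x" by (rule rge)
    then show ?thesis using s by (simp add: field_simps)
  qed
  show "sublinear_on S r"
    unfolding sublinear_on_def
  proof (intro conjI ballI allI impI)
    fix f g assume f: "f \<in> S" and g: "g \<in> S"
    have "r (\<lambda>z. f z + g z) \<le> e f s + e g t" if s: "0 \<le> s" and t: "0 \<le> t" for s t
    proof -
      have "r (\<lambda>z. f z + g z) \<le> e (\<lambda>z. f z + g z) (s + t)"
        using s t by (intro rle Sadd f g) auto
      also have "\<dots> = q (\<lambda>z. (f z + of_real s * y z) + (g z + of_real t * y z)) - (s + t) * q y"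
        by (simp add: e_def algebra_simps)
      also have "\<dots> \<le> e f s + e g t"
        using qadd[of "\<lambda>z. f z + of_real s * y z" "\<lambda>z. g z + of_real t * y z"]
        by (simp add: e_def Sadd Ssc f g y algebra_simps)
      finally show ?thesis .
    qed
    then have "r (\<lambda>z. f z + g z) - e f s \<le> r g" if "0 \<le> s" for s
      using that by (intro rge) (smt (verit))
    then have "r (\<lambda>z. f z + g z) - r g \<le> r f"
      by (intro rge) (smt (verit))
    then show "r (\<lambda>z. f z + g z) \<le> r f + r g" by simp
  next
    fix s :: real and x assume s: "0 \<le> s" and x: "x \<in> S"
    show "r (\<lambda>z. of_real s * x z) = s * r x"
    proof (cases "s = 0")
      case True
      have "e (\<lambda>z. 0) t = 0" if "0 \<le> t" for t
        using qsc[OF y that] by (simp add: e_def)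
      then have "r (\<lambda>z. 0) = 0"
        unfolding r by (simp add: cINF_const)
      then show ?thesis using True by simp
    next
      case False
      then have s: "0 < s" using s by simp
      have "r (\<lambda>z. of_real (1/s) * (of_real s * x z)) \<le> (1/s) * r (\<lambda>z. of_real s * x z)"
        using s by (intro pos Ssc x) auto
      moreover have "(\<lambda>z. of_real (1/s) * (of_real s * x z)) = x"
        using s by (auto simp: fun_eq_iff)
      ultimately have "s * r x \<le> r (\<lambda>z. of_real s * x z)"
        using s by (simp add: field_simps)
      then show ?thesis using pos[OF x s] by simp
    qed
  qed
qed

text \<open>In a chain any two members have a smaller one among them, so the sum of two separately
  chosen values dominates the value of a single member on the sum of the arguments.\<close>

lemma sublinear_on_chain_Inf:
  assumes ne: "C \<noteq> {}" and S: "real_subspace S"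
    and sub: "\<And>q. q \<in> C \<Longrightarrow> sublinear_on S q"
    and chain: "\<And>q q'. q \<in> C \<Longrightarrow> q' \<in> C \<Longrightarrow> (\<forall>f\<in>S. q f \<le> q' f) \<or> (\<forall>f\<in>S. q' f \<le> q f)"
    and bdd: "\<And>f. f \<in> S \<Longrightarrow> bdd_below ((\<lambda>q. q f) ` C)"
  shows "sublinear_on S (\<lambda>f. INF q\<in>C. q f)"
  unfolding sublinear_on_def
proof (intro conjI ballI allI impI)
  have Sadd: "(\<lambda>z. f z + g z) \<in> S" if "f \<in> S" "g \<in> S" for f g
    using S that unfolding real_subspace_def by blast
  have Ssc: "(\<lambda>z. of_real t * f z) \<in> S" if "f \<in> S" for f t
    using S that unfolding real_subspace_def by blast
  fix f g assume f: "f \<in> S" and g: "g \<in> S"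
  have "(INF q\<in>C. q (\<lambda>z. f z + g z)) \<le> q f + q' g" if q: "q \<in> C" and q': "q' \<in> C" for q q'
  proof -
    obtain m where m: "m \<in> C" "m f \<le> q f" "m g \<le> q' g"
      using chain[OF q q'] q q' f g by auto
    have "(INF q\<in>C. q (\<lambda>z. f z + g z)) \<le> m (\<lambda>z. f z + g z)"
      by (intro cINF_lower bdd Sadd f g m)
    also have "\<dots> \<le> m f + m g"
      using sub[OF m(1)] f g unfolding sublinear_on_def by blast
    finally show ?thesis using m by simp
  qed
  then have "(INF q\<in>C. q (\<lambda>z. f z + g z)) - q f \<le> (INF q\<in>C. q g)" if "q \<in> C" for q
    using that by (intro cINF_greatest ne) (smt (verit))
  then have "(INF q\<in>C. q (\<lambda>z. f z + g z)) - (INF q\<in>C. q g) \<le> (INF q\<in>C. q f)"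
    by (intro cINF_greatest ne) (smt (verit))
  then show "(INF q\<in>C. q (\<lambda>z. f z + g z)) \<le> (INF q\<in>C. q f) + (INF q\<in>C. q g)" by simp
next
  have Ssc: "(\<lambda>z. of_real t * f z) \<in> S" if "f \<in> S" for f t
    using S that unfolding real_subspace_def by blast
  fix s :: real and f assume s: "0 \<le> s" and f: "f \<in> S"
  have eq: "q (\<lambda>z. of_real s * f z) = s * q f" if "q \<in> C" for q
    using sub[OF that] s f unfolding sublinear_on_def by blast
  then have "(INF q\<in>C. q (\<lambda>z. of_real s * f z)) = (INF q\<in>C. s * q f)"
    by (intro INF_cong) auto
  also have "\<dots> = s * (INF q\<in>C. q f)"
  proof (cases "s = 0")
    case False
    then have s: "0 < s" using s by simp
    show ?thesis
    proof (rule antisym)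
      have "(INF q\<in>C. s * q f) / s \<le> (INF q\<in>C. q f)"
      proof (rule cINF_greatest[OF ne])
        fix q assume q: "q \<in> C"
        have "(INF q\<in>C. s * q f) \<le> s * q f"
          using bdd[OF Ssc[OF f, of s]] eq q
          by (intro cINF_lower) (auto simp: image_def cong: image_cong_simp)
        then show "(INF q\<in>C. s * q f) / s \<le> q f" using s by (simp add: field_simps)
      qed
      then show "(INF q\<in>C. s * q f) \<le> s * (INF q\<in>C. q f)" using s by (simp add: field_simps)
      show "s * (INF q\<in>C. q f) \<le> (INF q\<in>C. s * q f)"
        using s by (intro cINF_greatest ne mult_left_mono cINF_lower bdd f) auto
    qed
  qed (use ne in simp)
  finally show "(INF q\<in>C. q (\<lambda>z. of_real s * f z)) = s * (INF q\<in>C. q f)" .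
qed

text \<open>A minimal sublinear functional below \<open>p\<close> is linear, since by the lemma \<open>sublinear_on_lower\<close> it
  satisfies \<open>q (- y) \<le> - q y\<close>.\<close>

theorem Hahn_Banach_sublinear:
  assumes p: "sublinear_on S p" and S: "real_subspace S" and h: "h \<in> S"
  shows "\<exists>L. (\<forall>f\<in>S. \<forall>g\<in>S. L (\<lambda>z. f z + g z) = L f + L g) \<and>
    (\<forall>t. \<forall>f\<in>S. L (\<lambda>z. of_real t * f z) = t * L f) \<and> (\<forall>f\<in>S. L f \<le> p f) \<and> L h = p h"
proof -
  have Sadd: "(\<lambda>z. f z + g z) \<in> S" if "f \<in> S" "g \<in> S" for f g
    using S that unfolding real_subspace_def by blast
  have Ssc: "(\<lambda>z. of_real t * f z) \<in> S" if "f \<in> S" for f t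
    using S that unfolding real_subspace_def by blast
  have Sum: "(\<lambda>z. - f z) \<in> S" if "f \<in> S" for f
    using Ssc[OF that, of "-1"] by simp
  \<comment> \<open>Lowering \<open>p\<close> along \<open>h\<close> beforehand forces
    \<open>L (- h) \<le> - p h\<close> for every functional below \<open>p0\<close>, so the linear
    one obtained at the end attains \<open>p h\<close>.\<close>
  obtain p0 where p0: "sublinear_on S p0" and p0p: "\<And>f. f \<in> S \<Longrightarrow> p0 f \<le> p f"
    and p0h: "p0 (\<lambda>z. - h z) \<le> - p h"
    using sublinear_on_lower[OF p S h] by blast
  \<comment> \<open>The value \<open>0\<close> outside \<open>S\<close> turns the order on
    \<open>S\<close> into a partial order in the strict sense: functionals equal on \<open>S\<close>
    are equal.\<close>
  define A where "A = {q. sublinear_on S q \<and> (\<forall>f\<in>S. q f \<le> p0 f) \<and> (\<forall>f. f \<notin> S \<longrightarrow> q f = 0)}"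
  \<comment> \<open>The order is reversed, because Zorn's lemma yields maximal elements and a
    minimal functional is wanted.\<close>
  define P where "P q q' \<longleftrightarrow> (\<forall>f\<in>S. q' f \<le> q f)" for q q' :: "('a \<Rightarrow> complex) \<Rightarrow> real"
  have cut: "sublinear_on S (\<lambda>f. if f \<in> S then q f else 0)" if "sublinear_on S q" for q
    using that Sadd Ssc unfolding sublinear_on_def by simp
  have lowA: "- p0 (\<lambda>z. - f z) \<le> q f" if "q \<in> A" "f \<in> S" for q f
    using sublinear_on_uminus[OF _ S that(2), of q] that Sum[OF that(2)] unfolding A_def by force
  have "\<exists>m\<in>A. \<forall>a\<in>A. P m a \<longrightarrow> a = m"
  proof (rule predicate_Zorn)
    have "x = y" if "x \<in> A" "y \<in> A" "P x y" "P y x" for x y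
    proof
      fix f
      show "x f = y f"
        using that unfolding A_def P_def by (cases "f \<in> S") (auto intro: antisym)
    qed
    moreover have "P x x" for x by (simp add: P_def)
    moreover have "P x z" if "P x y" "P y z" for x y z
      using that unfolding P_def by (meson order_trans)
    ultimately show "partial_order_on A (relation_of P A)"
      by (intro partial_order_on_relation_ofI) blast+
    fix C assume C: "C \<in> Chains (relation_of P A)"
    have CA: "C \<subseteq> A" and chain: "\<And>q q'. q \<in> C \<Longrightarrow> q' \<in> C \<Longrightarrow> P q q' \<or> P q' q"
      using C unfolding Chains_def relation_of_def by auto
    show "\<exists>u\<in>A. \<forall>a\<in>C. P a u"
    proof (cases "C = {}")
      case True
      then show ?thesis
        using cut[OF p0] by (intro bexI[of _ "\<lambda>f. if f \<in> S then p0 f else 0"]) (auto simp: A_def)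
    next
      case False
      define u where "u f = (INF q\<in>C. q f)" for f
      have bdd: "bdd_below ((\<lambda>q. q f) ` C)" if "f \<in> S" for f
        using lowA[OF _ that] CA by (intro bdd_belowI2[of _ "- p0 (\<lambda>z. - f z)"]) auto
      have u: "sublinear_on S u"
        unfolding u_def
        by (rule sublinear_on_chain_Inf[OF False S])
          (use CA chain bdd in \<open>auto simp: A_def P_def\<close>)
      have uq: "u f \<le> q f" if "q \<in> C" "f \<in> S" for q f
        unfolding u_def by (intro cINF_lower bdd that)
      obtain q where q: "q \<in> C" using False by blast
      have "u f \<le> p0 f" if "f \<in> S" for f
        using uq[OF q that] CA q that unfolding A_def by force
      then show ?thesis
        using cut[OF u] uq by (intro bexI[of _ "\<lambda>f. if f \<in> S then u f else 0"]) (auto simp: A_def P_def)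
    qed
  qed
  then obtain L where LA: "L \<in> A" and min: "\<And>a. a \<in> A \<Longrightarrow> P L a \<Longrightarrow> a = L" by blast
  have L: "sublinear_on S L" and Lp0: "\<And>f. f \<in> S \<Longrightarrow> L f \<le> p0 f"
    using LA by (auto simp: A_def)
  have Lneg: "L (\<lambda>z. - y z) = - L y" if y: "y \<in> S" for y
  proof (rule antisym)
    obtain r where r: "sublinear_on S r" and rL: "\<And>f. f \<in> S \<Longrightarrow> r f \<le> L f"
      and ry: "r (\<lambda>z. - y z) \<le> - L y"
      using sublinear_on_lower[OF L S y] by blast
    have "(\<lambda>f. if f \<in> S then r f else 0) = L"
    proof (rule min)
      show "(\<lambda>f. if f \<in> S then r f else 0) \<in> A"
        using cut[OF r] rL Lp0 unfolding A_def by (auto intro: order_trans)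
    qed (use rL in \<open>auto simp: P_def\<close>)
    from fun_cong[OF this, of "\<lambda>z. - y z"] show "L (\<lambda>z. - y z) \<le> - L y"
      using ry Sum[OF y] by simp
    show "- L y \<le> L (\<lambda>z. - y z)"
      using sublinear_on_uminus[OF L S y] by simp
  qed
  have Lsub: "L (\<lambda>z. f z + g z) \<le> L f + L g" if "f \<in> S" "g \<in> S" for f g
    using L that unfolding sublinear_on_def by blast
  show ?thesis
  proof (intro exI[of _ L] conjI ballI allI)
    fix f g assume f: "f \<in> S" and g: "g \<in> S"
    have "L (\<lambda>z. (f z + g z) + - g z) \<le> L (\<lambda>z. f z + g z) + L (\<lambda>z. - g z)"
      by (intro Lsub Sadd Sum f g)
    then show "L (\<lambda>z. f z + g z) = L f + L g"
      using Lsub[OF f g] Lneg[OF g] by simp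
  next
    fix t f assume f: "f \<in> S"
    have pos: "L (\<lambda>z. of_real s * f z) = s * L f" if "0 \<le> s" for s
      using L f that unfolding sublinear_on_def by blast
    show "L (\<lambda>z. of_real t * f z) = t * L f"
    proof (cases "0 \<le> t")
      case False
      then show ?thesis
        using pos[of "- t"] Lneg[OF Ssc[OF f, of "- t"]] by simp
    qed (rule pos)
  next
    fix f assume "f \<in> S" then show "L f \<le> p f" using Lp0 p0p by (meson order_trans)
  next
    have "- L h \<le> - p h"
      using Lneg[OF h] Lp0[OF Sum[OF h]] p0h by simp
    moreover have "L h \<le> p h" using Lp0[OF h] p0p[OF h] by simp
    ultimately show "L h = p h" by simp
  qed
qed

subsection \<open>Marginally null sets\<close>

text \<open>The working form of the notion: one almost everywhere condition per coordinate, which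
  together exclude the set. Countable unions then reduce to countable conjunctions of such
  conditions.\<close>

lemma marginally_nullI:
  assumes "E \<subseteq> space M \<times> space N" and P: "AE x in M. P x" and Q: "AE y in N. Q y"
    and E: "\<And>x y. (x, y) \<in> E \<Longrightarrow> P x \<Longrightarrow> Q y \<Longrightarrow> False"
  shows "marginally_null M N E"
proof -
  obtain A where A: "A \<in> null_sets M" "{x \<in> space M. \<not> P x} \<subseteq> A"
    using P unfolding eventually_ae_filter by auto
  obtain B where B: "B \<in> null_sets N" "{x \<in> space N. \<not> Q x} \<subseteq> B"
    using Q unfolding eventually_ae_filter by auto
  have "E \<subseteq> (A \<times> space N) \<union> (space M \<times> B)"
  proof
    fix z assume "z \<in> E"
    then obtain x y where z: "z = (x, y)" "(x, y) \<in> E" by (cases z) auto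
    then have "x \<in> space M" "y \<in> space N" "\<not> (P x \<and> Q y)" using assms(1) E by auto
    then show "z \<in> (A \<times> space N) \<union> (space M \<times> B)" using A B z by auto
  qed
  then show ?thesis using A B unfolding marginally_null_def by blast
qed

lemma marginally_nullD:
  assumes "marginally_null M N E"
  shows "\<exists>P Q. (AE x in M. P x) \<and> (AE y in N. Q y) \<and> (\<forall>x y. (x, y) \<in> E \<longrightarrow> P x \<longrightarrow> \<not> Q y)"
proof -
  obtain A B where "A \<in> null_sets M" "B \<in> null_sets N"
    "E \<subseteq> (A \<times> space N) \<union> (space M \<times> B)"
    using assms unfolding marginally_null_def by blast
  then show ?thesis
    by (intro exI[of _ "\<lambda>x. x \<notin> A"] exI[of _ "\<lambda>y. y \<notin> B"] conjI AE_not_in) auto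
qed

lemma marginally_null_space:
  assumes "marginally_null M N E" shows "E \<subseteq> space M \<times> space N"
proof -
  obtain A B where "A \<in> null_sets M" "B \<in> null_sets N"
    "E \<subseteq> (A \<times> space N) \<union> (space M \<times> B)"
    using assms unfolding marginally_null_def by blast
  then show ?thesis using sets.sets_into_space[of A M] sets.sets_into_space[of B N] by blast
qed

lemma marginally_null_subset: "marginally_null M N E \<Longrightarrow> F \<subseteq> E \<Longrightarrow> marginally_null M N F"
  unfolding marginally_null_def by (meson order_trans)

lemma marginally_null_empty [simp]: "marginally_null M N {}"
  unfolding marginally_null_def by blast

lemma marginally_null_UN:
  assumes "\<And>i::nat. marginally_null M N (E i)"
  shows "marginally_null M N (\<Union>i. E i)"
proof -
  have "\<forall>i. \<exists>P Q. (AE x in M. P x) \<and> (AE y in N. Q y) \<and> (\<forall>x y. (x, y) \<in> E i \<longrightarrow> P x \<longrightarrow> \<not> Q y)"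
    using marginally_nullD[OF assms] by blast
  then obtain P Q where "\<And>i. AE x in M. P i x" "\<And>i. AE y in N. Q i y"
    "\<And>i x y. (x, y) \<in> E i \<Longrightarrow> P i x \<Longrightarrow> Q i y \<Longrightarrow> False"
    by metis
  then show ?thesis
    using marginally_null_space[OF assms]
    by (intro marginally_nullI[of _ M N "\<lambda>x. \<forall>i. P i x" "\<lambda>x. \<forall>i. Q i x"])
      (auto simp: AE_all_countable, blast+)
qed

lemma marginally_null_Un:
  assumes "marginally_null M N E" "marginally_null M N F"
  shows "marginally_null M N (E \<union> F)"
proof -
  have "marginally_null M N (\<Union>i::nat. if i = 0 then E else F)"
    using assms by (intro marginally_null_UN) auto
  moreover have "(\<Union>i::nat. if i = 0 then E else F) = E \<union> F"
    by (auto split: if_splits)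
  ultimately show ?thesis by simp
qed

lemma marginally_null_AE:
  assumes "sigma_finite_measure M" "sigma_finite_measure N" and E: "marginally_null M N E"
  shows "AE z in M \<Otimes>\<^sub>M N. z \<notin> E"
proof -
  interpret M: sigma_finite_measure M by fact
  interpret N: sigma_finite_measure N by fact
  obtain A B where A: "A \<in> null_sets M" and B: "B \<in> null_sets N"
    and "E \<subseteq> (A \<times> space N) \<union> (space M \<times> B)"
    using assms unfolding marginally_null_def by blast
  moreover have "A \<times> space N \<in> null_sets (M \<Otimes>\<^sub>M N)"
    using A by (intro null_setsI) (auto simp: N.emeasure_pair_measure_Times null_sets_def)
  moreover have "space M \<times> B \<in> null_sets (M \<Otimes>\<^sub>M N)"
    using B by (intro null_setsI) (auto simp: N.emeasure_pair_measure_Times null_sets_def)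
  ultimately show ?thesis
    by (intro AE_I'[of "A \<times> space N \<union> space M \<times> B"]) auto
qed

subsection \<open>Series of elementary tensors\<close>

text \<open>The series \<open>\<Sum>\<^sub>i f\<^sub>i(x) g\<^sub>i(y)\<close> is only required to represent \<open>h\<close> on \<open>K\<close>: taking the
  infimum of its cost yields the quotient of \<open>\<Gamma>(X,Y)\<close> by the functions vanishing on \<open>K\<close>.\<close>

definition tensor_series :: "'a measure \<Rightarrow> 'b measure \<Rightarrow> ('a \<times> 'b) set
    \<Rightarrow> (nat \<Rightarrow> 'a \<Rightarrow> complex) \<Rightarrow> (nat \<Rightarrow> 'b \<Rightarrow> complex) \<Rightarrow> ('a \<times> 'b \<Rightarrow> complex) \<Rightarrow> bool" where
  "tensor_series M N K f g h \<longleftrightarrow> (\<forall>i. f i \<in> sq M) \<and> (\<forall>i. g i \<in> sq N) \<and>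
     summable (\<lambda>i. (nrm M (f i))\<^sup>2) \<and> summable (\<lambda>i. (nrm N (g i))\<^sup>2) \<and>
     marginally_null M N {z \<in> K. \<not> (\<lambda>i. f i (fst z) * g i (snd z)) sums h z}"

text \<open>Half the sum of squares dominates the sum of \<open>nrm M (f i) * nrm N (g i)\<close>.
  Unlike that sum of products, it also controls the two square sums individually; the product bound
  is regained by rescaling the factors.\<close>

definition series_cost :: "'a measure \<Rightarrow> 'b measure \<Rightarrow> (nat \<Rightarrow> 'a \<Rightarrow> complex) \<Rightarrow> (nat \<Rightarrow> 'b \<Rightarrow> complex) \<Rightarrow> real" where
  "series_cost M N f g = (\<Sum>i. ((nrm M (f i))\<^sup>2 + (nrm N (g i))\<^sup>2) / 2)"

lemma tensor_series_sums:
  "tensor_series M N K f g h \<Longrightarrow> marginally_null M N {z \<in> K. \<not> (\<lambda>i. f i (fst z) * g i (snd z)) sums h z}"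
  by (simp add: tensor_series_def)

lemma marginally_null_Collect_mono:
  assumes "marginally_null M N {z \<in> K. \<not> P z}" "\<And>z. z \<in> K \<Longrightarrow> P z \<Longrightarrow> Q z"
  shows "marginally_null M N {z \<in> K. \<not> Q z}"
  using assms(1) by (rule marginally_null_subset) (use assms(2) in blast)

lemma tensor_series_summable:
  assumes "tensor_series M N K f g h"
  shows "summable (\<lambda>i. ((nrm M (f i))\<^sup>2 + (nrm N (g i))\<^sup>2) / 2)"
  using assms unfolding tensor_series_def by (intro summable_divide summable_add) auto

lemma nrm_mult_le: "nrm M f * nrm N g \<le> ((nrm M f)\<^sup>2 + (nrm N g)\<^sup>2) / 2"
  using sum_squares_bound[of "nrm M f" "nrm N g"] by simp

lemma tensor_series_summable_mult:
  assumes "tensor_series M N K f g h"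
  shows "summable (\<lambda>i. nrm M (f i) * nrm N (g i))"
proof (rule summable_comparison_test'[OF tensor_series_summable[OF assms]])
  show "norm (nrm M (f n) * nrm N (g n)) \<le> ((nrm M (f n))\<^sup>2 + (nrm N (g n))\<^sup>2) / 2" for n
    using nrm_mult_le[of M "f n" N "g n"] by simp
qed

lemma suminf_nrm_mult_le_cost:
  assumes "tensor_series M N K f g h"
  shows "(\<Sum>i. nrm M (f i) * nrm N (g i)) \<le> series_cost M N f g"
  unfolding series_cost_def
  by (intro suminf_le nrm_mult_le tensor_series_summable[OF assms] tensor_series_summable_mult[OF assms])

lemma series_cost_nonneg:
  assumes "tensor_series M N K f g h" shows "0 \<le> series_cost M N f g"
  unfolding series_cost_def by (intro suminf_nonneg tensor_series_summable[OF assms]) auto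

lemma
  assumes f: "\<And>i::nat. f i \<in> sq M" and s: "summable (\<lambda>i. (nrm M (f i))\<^sup>2)"
  shows AE_summable_sq: "AE x in M. summable (\<lambda>i. (cmod (f i x))\<^sup>2)"
    and integrable_suminf_sq: "integrable M (\<lambda>x. \<Sum>i. (cmod (f i x))\<^sup>2)"
    and integral_suminf_sq: "(\<integral>x. (\<Sum>i. (cmod (f i x))\<^sup>2) \<partial>M) = (\<Sum>i. (nrm M (f i))\<^sup>2)"
proof -
  have fm [measurable]: "f n \<in> borel_measurable M" for n
    using f by (rule sq_measurable)
  have fi: "integrable M (\<lambda>x. (cmod (f i x))\<^sup>2)" for i
    by (rule sq_integrable[OF f])
  show AE1: "AE x in M. summable (\<lambda>n. (cmod (f n x))\<^sup>2)"
  proof -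
    have "(\<Sum>n. ennreal (\<integral>x. (cmod (f n x))\<^sup>2 \<partial>M)) < \<infinity>"
      using s by (subst suminf_ennreal2) (auto intro: integral_nonneg simp: nrm_square)
    then have "(\<integral>\<^sup>+x. (\<Sum>n. ennreal ((cmod (f n x))\<^sup>2)) \<partial>M) < \<infinity>"
      using fi by (simp add: nn_integral_suminf nn_integral_eq_integral)
    then have "AE x in M. (\<Sum>n. ennreal ((cmod (f n x))\<^sup>2)) \<noteq> \<infinity>"
      by (intro nn_integral_PInf_AE) auto
    then show ?thesis
      by eventually_elim (auto intro: summable_suminf_not_top)
  qed
  show "integrable M (\<lambda>x. \<Sum>i. (cmod (f i x))\<^sup>2)"
    using fi AE1 s by (intro integrable_suminf) (auto simp: nrm_square)
  show "(\<integral>x. (\<Sum>i. (cmod (f i x))\<^sup>2) \<partial>M) = (\<Sum>i. (nrm M (f i))\<^sup>2)"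
    using fi AE1 s by (subst integral_suminf) (auto simp: nrm_square)
qed

lemma norm_mult_le_half_squares: "cmod (a * b) \<le> ((cmod a)\<^sup>2 + (cmod b)\<^sup>2) / 2"
  using sum_squares_bound[of "cmod a" "cmod b"] by (simp add: norm_mult)

lemma summable_tensor:
  assumes "summable (\<lambda>i. (cmod (a i))\<^sup>2)" "summable (\<lambda>i. (cmod (b i))\<^sup>2)"
  shows "summable (\<lambda>i. cmod (a i * b i))"
  by (rule summable_comparison_test'[where g = "\<lambda>i. ((cmod (a i))\<^sup>2 + (cmod (b i))\<^sup>2) / 2"])
    (use assms norm_mult_le_half_squares in \<open>auto intro!: summable_divide summable_add\<close>)

lemma tensor_series_mono: "tensor_series M N K f g h \<Longrightarrow> L \<subseteq> K \<Longrightarrow> tensor_series M N L f g h"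
  unfolding tensor_series_def by (auto elim!: marginally_null_subset)

lemma tensor_series_cong:
  assumes "tensor_series M N K f g h" "marginally_null M N {z \<in> K. h z \<noteq> h' z}"
  shows "tensor_series M N K f g h'"
proof -
  have "marginally_null M N {z \<in> K. \<not> (\<lambda>i. f i (fst z) * g i (snd z)) sums h' z}"
    by (rule marginally_null_subset[OF marginally_null_Un[OF _ assms(2)]])
      (use assms(1) in \<open>auto simp: tensor_series_def\<close>)
  then show ?thesis using assms(1) by (simp add: tensor_series_def)
qed

definition interleave :: "(nat \<Rightarrow> 'c) \<Rightarrow> (nat \<Rightarrow> 'c) \<Rightarrow> nat \<Rightarrow> 'c" where
  "interleave a b i = (if even i then a (i div 2) else b ((i - 1) div 2))"

text \<open>The first \<open>n\<close> merged terms are the first \<open>(n + 1) div 2\<close> of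
  \<open>a\<close> and the first \<open>n div 2\<close> of \<open>b\<close>. Thus the partial sums
  split, and conditional convergence is enough.\<close>

lemma sums_interleave:
  fixes a b :: "nat \<Rightarrow> 'c :: real_normed_vector"
  assumes a: "a sums s" and b: "b sums t" shows "interleave a b sums (s + t)"
proof -
  have eq: "sum (interleave a b) {..<n} = sum a {..<Suc n div 2} + sum b {..<n div 2}" for n
  proof (induction n)
    case (Suc n)
    then show ?case
    proof (cases "even n")
      case True
      then have "Suc (Suc n) div 2 = Suc (Suc n div 2)" "Suc n div 2 = n div 2"
        by (auto elim!: evenE)
      then show ?thesis using Suc True by (simp add: interleave_def)
    next
      case False
      then have "Suc n div 2 = Suc (n div 2)" "Suc (Suc n) div 2 = Suc n div 2" "(n - 1) div 2 = n div 2"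
        by (auto elim!: oddE)
      then show ?thesis using Suc False by (simp add: interleave_def)
    qed
  qed simp
  have l1: "filterlim (\<lambda>n::nat. Suc n div 2) sequentially sequentially"
    unfolding filterlim_at_top
  proof
    fix Z show "\<forall>\<^sub>F n::nat in sequentially. Z \<le> Suc n div 2"
      by (rule eventually_sequentiallyI[of "2 * Z"]) linarith
  qed
  have l2: "filterlim (\<lambda>n::nat. n div 2) sequentially sequentially"
    unfolding filterlim_at_top
  proof
    fix Z show "\<forall>\<^sub>F n::nat in sequentially. Z \<le> n div 2"
      by (rule eventually_sequentiallyI[of "2 * Z"]) linarith
  qed
  show ?thesis
    unfolding sums_def eq
    using filterlim_compose[OF a[unfolded sums_def] l1] filterlim_compose[OF b[unfolded sums_def] l2]
    by (rule tendsto_add)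
qed

lemma interleave_app: "F (interleave a b i) (interleave c d i) = interleave (\<lambda>i. F (a i) (c i)) (\<lambda>i. F (b i) (d i)) i"
  by (simp add: interleave_def)

lemma sums_interleave_app:
  fixes F :: "'c \<Rightarrow> 'd \<Rightarrow> 'e :: real_normed_vector"
  assumes "(\<lambda>i. F (a i) (c i)) sums s" "(\<lambda>i. F (b i) (d i)) sums t"
  shows "(\<lambda>i. F (interleave a b i) (interleave c d i)) sums (s + t)"
  unfolding interleave_app using sums_interleave[OF assms] by simp

lemma tensor_series_add:
  assumes 1: "tensor_series M N K f g h" and 2: "tensor_series M N K f' g' h'"
  shows "tensor_series M N K (interleave f f') (interleave g g') (\<lambda>z. h z + h' z)"
  unfolding tensor_series_def
proof (intro conjI allI)
  show "interleave f f' i \<in> sq M" "interleave g g' i \<in> sq N" for i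
    using assms unfolding tensor_series_def interleave_def by auto
  show "summable (\<lambda>i. (nrm M (interleave f f' i))\<^sup>2)"
    using sums_interleave_app[of "\<lambda>f _. (nrm M f)\<^sup>2" f f _ f' f'] assms
    unfolding tensor_series_def summable_def by blast
  show "summable (\<lambda>i. (nrm N (interleave g g' i))\<^sup>2)"
    using sums_interleave_app[of "\<lambda>f _. (nrm N f)\<^sup>2" g g _ g' g'] assms
    unfolding tensor_series_def summable_def by blast
  have "(\<lambda>i. interleave f f' i x * interleave g g' i y) sums (s + t)"
    if "(\<lambda>i. f i x * g i y) sums s" "(\<lambda>i. f' i x * g' i y) sums t" for x y s t
    using sums_interleave_app[where F = "\<lambda>f g. f x * g y" and a = f and b = f' and c = g and d = g', OF that] .
  then show "marginally_null M N
     {z \<in> K. \<not> (\<lambda>i. interleave f f' i (fst z) * interleave g g' i (snd z)) sums (h z + h' z)}"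
    by (intro marginally_null_subset[OF marginally_null_Un[OF
      assms(1)[unfolded tensor_series_def, THEN conjunct2, THEN conjunct2, THEN conjunct2, THEN conjunct2]
      assms(2)[unfolded tensor_series_def, THEN conjunct2, THEN conjunct2, THEN conjunct2, THEN conjunct2]]]) blast
qed

lemma series_cost_add:
  assumes 1: "tensor_series M N K f g h" and 2: "tensor_series M N K f' g' h'"
  shows "series_cost M N (interleave f f') (interleave g g') = series_cost M N f g + series_cost M N f' g'"
  using sums_interleave_app[where F = "\<lambda>f g. ((nrm M f)\<^sup>2 + (nrm N g)\<^sup>2) / 2",
      OF summable_sums[OF tensor_series_summable[OF 1]] summable_sums[OF tensor_series_summable[OF 2]]]
  unfolding series_cost_def by (simp add: sums_iff)

lemma tensor_series_scale:
  assumes "tensor_series M N K f g h"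
  shows "tensor_series M N K (\<lambda>i x. a * f i x) (\<lambda>i y. b * g i y) (\<lambda>z. a * b * h z)"
  unfolding tensor_series_def
proof (intro conjI allI)
  show "(\<lambda>x. a * f i x) \<in> sq M" "(\<lambda>x. b * g i x) \<in> sq N" for i
    using assms unfolding tensor_series_def by auto
  show "summable (\<lambda>i. (nrm M (\<lambda>x. a * f i x))\<^sup>2)" "summable (\<lambda>i. (nrm N (\<lambda>x. b * g i x))\<^sup>2)"
    using assms unfolding tensor_series_def nrm_scale power_mult_distrib by (auto intro: summable_mult)
  have "(\<lambda>i. a * f i (fst z) * (b * g i (snd z))) sums (a * b * h z)"
    if "(\<lambda>i. f i (fst z) * g i (snd z)) sums h z" for z
    using sums_mult[OF that, of "a * b"] by (simp add: mult_ac)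
  then show "marginally_null M N
     {z \<in> K. \<not> (\<lambda>i. a * f i (fst z) * (b * g i (snd z))) sums (a * b * h z)}"
    using assms(1) by (intro marginally_null_Collect_mono[OF tensor_series_sums]) blast
qed

text \<open>The same factor on both sides multiplies the represented function by
  \<open>a * a\<close>, so \<open>a = sqrt t\<close> is what scales function and cost alike by
  \<open>t\<close>.\<close>

lemma series_cost_scale:
  assumes "tensor_series M N K f g h"
  shows "series_cost M N (\<lambda>i x. a * f i x) (\<lambda>i y. a * g i y) = (cmod a)\<^sup>2 * series_cost M N f g"
  using tensor_series_summable[OF assms]
  by (subst (2) series_cost_def, subst suminf_mult[symmetric])
    (auto simp: series_cost_def nrm_scale power_mult_distrib algebra_simps)

lemma tensor_series_indicator:
  assumes "tensor_series M N K f g h" and A: "A \<in> sets M" and B: "B \<in> sets N"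
  shows "tensor_series M N K (\<lambda>i x. indicator A x * f i x) (\<lambda>i y. indicator B y * g i y)
    (\<lambda>z. indicator (A \<times> B) z * h z)"
  unfolding tensor_series_def
proof (intro conjI allI)
  have f: "f i \<in> sq M" and g: "g i \<in> sq N" for i using assms unfolding tensor_series_def by auto
  show fi: "(\<lambda>x. indicator A x * f i x) \<in> sq M" and gi: "(\<lambda>x. indicator B x * g i x) \<in> sq N" for i
    using f g A B by auto
  have nf: "nrm M (\<lambda>x. indicator A x * f i x) \<le> nrm M (f i)" for i
    by (rule nrm_mono[OF fi f]) (auto simp: indicator_def)
  have ng: "nrm N (\<lambda>x. indicator B x * g i x) \<le> nrm N (g i)" for i
    by (rule nrm_mono[OF gi g]) (auto simp: indicator_def)
  show "summable (\<lambda>i. (nrm M (\<lambda>x. indicator A x * f i x))\<^sup>2)"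
    by (rule summable_comparison_test'[of "\<lambda>i. (nrm M (f i))\<^sup>2"])
      (use assms nf in \<open>auto simp: tensor_series_def intro!: power_mono\<close>)
  show "summable (\<lambda>i. (nrm N (\<lambda>x. indicator B x * g i x))\<^sup>2)"
    by (rule summable_comparison_test'[of "\<lambda>i. (nrm N (g i))\<^sup>2"])
      (use assms ng in \<open>auto simp: tensor_series_def intro!: power_mono\<close>)
  have "(\<lambda>i. indicator A (fst z) * f i (fst z) * (indicator B (snd z) * g i (snd z))) sums (indicator (A \<times> B) z * h z)"
    if "(\<lambda>i. f i (fst z) * g i (snd z)) sums h z" for z
    using sums_mult[OF that, of "indicator A (fst z) * indicator B (snd z)"]
    by (simp add: mult_ac indicator_times)
  then show "marginally_null M N
     {z \<in> K. \<not> (\<lambda>i. indicator A (fst z) * f i (fst z) * (indicator B (snd z) * g i (snd z))) sums (indicator (A \<times> B) z * h z)}"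
    using assms(1) by (intro marginally_null_Collect_mono[OF tensor_series_sums]) blast
qed

lemma tensor_series_shift:
  assumes "tensor_series M N K f g h"
  shows "tensor_series M N K (\<lambda>i. f (i + n)) (\<lambda>i. g (i + n)) (\<lambda>z. h z - (\<Sum>i<n. f i (fst z) * g i (snd z)))"
  unfolding tensor_series_def
proof (intro conjI allI)
  show "f (i + n) \<in> sq M" "g (i + n) \<in> sq N" for i
    using assms unfolding tensor_series_def by auto
  show "summable (\<lambda>i. (nrm M (f (i + n)))\<^sup>2)" "summable (\<lambda>i. (nrm N (g (i + n)))\<^sup>2)"
    using assms unfolding tensor_series_def by (auto intro: summable_ignore_initial_segment)
  show "marginally_null M N {z \<in> K. \<not> (\<lambda>i. f (i + n) (fst z) * g (i + n) (snd z)) sums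
      (h z - (\<Sum>i<n. f i (fst z) * g i (snd z)))}"
    by (rule marginally_null_Collect_mono[OF tensor_series_sums[OF assms]])
      (rule sums_split_initial_segment)
qed

lemma tensor_series_single:
  assumes u: "u \<in> sq M" and v: "v \<in> sq N"
  shows "tensor_series M N K (\<lambda>i. if i = 0 then u else (\<lambda>x. 0)) (\<lambda>i. if i = 0 then v else (\<lambda>y. 0))
    (\<lambda>z. u (fst z) * v (snd z))"
  unfolding tensor_series_def
proof (intro conjI allI)
  have s: "(\<lambda>i::nat. if i = 0 then c else 0) sums c" for c :: "'c :: real_normed_vector"
    by (rule sums_single)
  show "summable (\<lambda>i::nat. (nrm M (if i = 0 then u else (\<lambda>x. 0)))\<^sup>2)"
    using sums_summable[OF s, of "(nrm M u)\<^sup>2"] by (rule back_subst[of summable]) auto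
  show "summable (\<lambda>i::nat. (nrm N (if i = 0 then v else (\<lambda>x. 0)))\<^sup>2)"
    using sums_summable[OF s, of "(nrm N v)\<^sup>2"] by (rule back_subst[of summable]) auto
  have "(\<lambda>i::nat. (if i = 0 then u else (\<lambda>x. 0)) x * (if i = 0 then v else (\<lambda>y. 0)) y) sums (u x * v y)" for x y
    using s[of "u x * v y"] by (rule back_subst[of "\<lambda>a. a sums _"]) auto
  then show "marginally_null M N {z \<in> K. \<not> (\<lambda>i::nat. (if i = 0 then u else (\<lambda>x. 0)) (fst z)
      * (if i = 0 then v else (\<lambda>y. 0)) (snd z)) sums (u (fst z) * v (snd z))}"
    by simp
qed (use u v in auto)

lemma series_cost_single:
  "series_cost M N (\<lambda>i. if i = 0 then u else (\<lambda>x. 0)) (\<lambda>i. if i = 0 then v else (\<lambda>y. 0))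
    = ((nrm M u)\<^sup>2 + (nrm N v)\<^sup>2) / 2"
proof -
  have "(\<lambda>i::nat. if i = 0 then ((nrm M u)\<^sup>2 + (nrm N v)\<^sup>2) / 2 else 0) sums (((nrm M u)\<^sup>2 + (nrm N v)\<^sup>2) / 2)"
    by (rule sums_single)
  then have "(\<lambda>i::nat. ((nrm M (if i = 0 then u else (\<lambda>x. 0)))\<^sup>2 + (nrm N (if i = 0 then v else (\<lambda>y. 0)))\<^sup>2) / 2)
      sums (((nrm M u)\<^sup>2 + (nrm N v)\<^sup>2) / 2)"
    by (rule back_subst[of "\<lambda>a. a sums _"]) auto
  then show ?thesis unfolding series_cost_def by (simp add: sums_iff)
qed

lemma tensor_series_zero: "tensor_series M N K (\<lambda>i x. 0) (\<lambda>i y. 0) (\<lambda>z. 0)"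
  by (simp add: tensor_series_def)

lemma Gamma_series_iff:
  "Gamma_series M N u v h \<longleftrightarrow> (\<forall>i. u i \<in> L2 M \<and> v i \<in> L2 N) \<and>
     tensor_series M N (space M \<times> space N) (\<lambda>i. L2_rep (u i)) (\<lambda>i. L2_rep (v i)) h"
proof -
  have "{(x, y) \<in> space M \<times> space N. \<not> (\<lambda>i. L2_rep (u i) x * L2_rep (v i) y) sums h (x, y)}
    = {z \<in> space M \<times> space N. \<not> (\<lambda>i. L2_rep (u i) (fst z) * L2_rep (v i) (snd z)) sums h z}"
    by auto
  then show ?thesis
    unfolding Gamma_series_def tensor_series_def L2_norm_rep by auto
qed

lemma Gamma_series_class:
  assumes h: "tensor_series M N (space M \<times> space N) f g h"
  shows "Gamma_series M N (\<lambda>i. L2_class M (f i)) (\<lambda>i. L2_class N (g i)) h"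
proof -
  have f: "f i \<in> sq M" and g: "g i \<in> sq N" for i using h by (auto simp: tensor_series_def)
  let ?f = "\<lambda>i. L2_rep (L2_class M (f i))" and ?g = "\<lambda>i. L2_rep (L2_class N (g i))"
  have f': "?f i \<in> sq M" "nrm M (?f i) = nrm M (f i)" for i
    using L2_rep_class[OF f] by (auto intro: nrm_cong_AE f)
  have g': "?g i \<in> sq N" "nrm N (?g i) = nrm N (g i)" for i
    using L2_rep_class[OF g] by (auto intro: nrm_cong_AE g)
  have "marginally_null M N {z \<in> space M \<times> space N. \<exists>i. \<not> (?f i (fst z) = f i (fst z) \<and> ?g i (snd z) = g i (snd z))}"
    by (rule marginally_nullI[of _ _ _ "\<lambda>x. \<forall>i. ?f i x = f i x" "\<lambda>y. \<forall>i. ?g i y = g i y"])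
      (use L2_rep_class[OF f] L2_rep_class[OF g] in \<open>auto simp: AE_all_countable\<close>)
  then have "marginally_null M N {z \<in> space M \<times> space N. \<not> (\<lambda>i. ?f i (fst z) * ?g i (snd z)) sums h z}"
    by (rule marginally_null_subset[OF marginally_null_Un])
      (use h in \<open>auto simp: tensor_series_def\<close>)
  then show ?thesis
    using h f f' g g' by (auto simp: Gamma_series_iff tensor_series_def)
qed

lemma Gamma_iff: "h \<in> Gamma M N \<longleftrightarrow> (\<exists>f g. tensor_series M N (space M \<times> space N) f g h)"
  unfolding Gamma_def using Gamma_series_iff Gamma_series_class by blast

subsection \<open>The pairing is well defined\<close>

definition ip :: "'a measure \<Rightarrow> ('a \<Rightarrow> complex) \<Rightarrow> ('a \<Rightarrow> complex) \<Rightarrow> complex" where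
  "ip M f g = (\<integral>x. f x * cnj (g x) \<partial>M)"

lemma ip_add_left:
  assumes "f \<in> sq M" "f' \<in> sq M" "g \<in> sq M"
  shows "ip M (\<lambda>x. f x + f' x) g = ip M f g + ip M f' g"
  unfolding ip_def distrib_right
  by (intro Bochner_Integration.integral_add sq_mult_integrable sq_cnj assms)

lemma ip_diff_left:
  assumes "f \<in> sq M" "f' \<in> sq M" "g \<in> sq M"
  shows "ip M (\<lambda>x. f x - f' x) g = ip M f g - ip M f' g"
  unfolding ip_def left_diff_distrib
  by (intro Bochner_Integration.integral_diff sq_mult_integrable sq_cnj assms)

lemma ip_scale_left: "ip M (\<lambda>x. c * f x) g = c * ip M f g"
  by (simp add: ip_def mult.assoc)

lemma ip_cnj: "ip M g f = cnj (ip M f g)"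
  using Bochner_Integration.integral_cnj[of M "\<lambda>x. f x * cnj (g x)"] by (simp add: ip_def mult.commute del: Bochner_Integration.integral_cnj)

lemma ip_scale_right: "ip M f (\<lambda>x. c * g x) = cnj c * ip M f g"
proof -
  have "ip M f (\<lambda>x. c * g x) = cnj (ip M (\<lambda>x. c * g x) f)" by (rule ip_cnj)
  then show ?thesis using ip_cnj[of M f g] by (simp add: ip_scale_left)
qed

lemma ip_sum_left:
  assumes "finite I" "\<And>i. i \<in> I \<Longrightarrow> f i \<in> sq M" "g \<in> sq M"
  shows "ip M (\<lambda>x. \<Sum>i\<in>I. f i x) g = (\<Sum>i\<in>I. ip M (f i) g)"
  unfolding ip_def sum_distrib_right
  by (intro Bochner_Integration.integral_sum sq_mult_integrable sq_cnj assms)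

lemma ip_cong_AE_left:
  assumes "f \<in> sq M" "f' \<in> sq M" "g \<in> sq M" "AE x in M. f x = f' x"
  shows "ip M f g = ip M f' g"
  unfolding ip_def using assms sq_cnj[OF assms(3)]
  by (intro integral_cong_AE borel_measurable_times sq_measurable) auto

lemma ip_self: "ip M f f = complex_of_real ((nrm M f)\<^sup>2)"
  by (simp only: ip_def nrm_square complex_norm_square[symmetric] integral_complex_of_real)

section \<open>Finite orthonormal systems and their projections\<close>

definition orthonormal :: "'a measure \<Rightarrow> nat \<Rightarrow> (nat \<Rightarrow> 'a \<Rightarrow> complex) \<Rightarrow> bool" where
  "orthonormal M d e \<longleftrightarrow> (\<forall>j<d. e j \<in> sq M) \<and>
     (\<forall>j<d. \<forall>k<d. ip M (e j) (e k) = (if j = k then 1 else 0))"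

definition proj :: "'a measure \<Rightarrow> nat \<Rightarrow> (nat \<Rightarrow> 'a \<Rightarrow> complex) \<Rightarrow> ('a \<Rightarrow> complex) \<Rightarrow> 'a \<Rightarrow> complex" where
  "proj M d e f x = (\<Sum>j<d. ip M f (e j) * e j x)"

lemma proj_sq: "orthonormal M d e \<Longrightarrow> proj M d e f \<in> sq M"
  unfolding proj_def[abs_def] by (intro sq_sum sq_scale) (auto simp: orthonormal_def)

lemma ip_proj_basis:
  assumes e: "orthonormal M d e" and k: "k < d"
  shows "ip M (proj M d e f) (e k) = ip M f (e k)"
proof -
  have "ip M (proj M d e f) (e k) = (\<Sum>j<d. ip M (\<lambda>x. ip M f (e j) * e j x) (e k))"
    unfolding proj_def using e k by (intro ip_sum_left) (auto simp: orthonormal_def)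
  also have "\<dots> = (\<Sum>j<d. if j = k then ip M f (e k) else 0)"
    using e k by (intro sum.cong) (auto simp: orthonormal_def ip_scale_left)
  also have "\<dots> = ip M f (e k)" using k by (simp add: sum.delta)
  finally show ?thesis .
qed

lemma ip_residual_basis:
  assumes e: "orthonormal M d e" and k: "k < d" and f: "f \<in> sq M"
  shows "ip M (\<lambda>x. f x - proj M d e f x) (e k) = 0"
  using e k ip_proj_basis[OF e k, of f]
  by (simp add: ip_diff_left[OF f proj_sq[OF e]] orthonormal_def)

lemma ip_proj_residual:
  assumes e: "orthonormal M d e" and f: "f \<in> sq M"
  shows "ip M (proj M d e g) (\<lambda>x. f x - proj M d e f x) = 0"
proof -
  have r: "(\<lambda>x. f x - proj M d e f x) \<in> sq M" using f proj_sq[OF e] by auto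
  have "ip M (proj M d e g) (\<lambda>x. f x - proj M d e f x)
      = (\<Sum>j<d. ip M (\<lambda>x. ip M g (e j) * e j x) (\<lambda>x. f x - proj M d e f x))"
    unfolding proj_def[of M d e g] using e r by (intro ip_sum_left) (auto simp: orthonormal_def)
  also have "\<dots> = 0"
  proof (rule sum.neutral, rule ballI)
    fix j assume "j \<in> {..<d}"
    then show "ip M (\<lambda>x. ip M g (e j) * e j x) (\<lambda>x. f x - proj M d e f x) = 0"
      using ip_residual_basis[OF e _ f, of j] ip_cnj[of M "e j" "\<lambda>x. f x - proj M d e f x"]
      by (simp add: ip_scale_left)
  qed
  finally show ?thesis .
qed

lemma nrm_residual_le:
  assumes e: "orthonormal M d e" and f: "f \<in> sq M"
  shows "nrm M (\<lambda>x. f x - proj M d e f x) \<le> nrm M f"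
proof -
  have r: "(\<lambda>x. f x - proj M d e f x) \<in> sq M" using f proj_sq[OF e] by auto
  have "(\<integral>x. cnj (f x - proj M d e f x) * proj M d e f x \<partial>M) = 0"
    using ip_proj_residual[OF e f, of f] by (simp add: ip_def mult.commute)
  then have "(nrm M f)\<^sup>2 = (nrm M (\<lambda>x. f x - proj M d e f x))\<^sup>2 + (nrm M (proj M d e f))\<^sup>2"
    using nrm_add_square[OF r proj_sq[OF e, of f]] by simp
  then have "(nrm M (\<lambda>x. f x - proj M d e f x))\<^sup>2 \<le> (nrm M f)\<^sup>2" by simp
  then show ?thesis by (rule power2_le_imp_le) simp
qed

text \<open>Gram-Schmidt. A function whose residual has norm zero contributes no new vector, so
  \<open>d\<close> may be smaller than \<open>n\<close>.\<close>

lemma finite_orthonormal_span: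
  assumes f: "\<And>i::nat. f i \<in> sq M"
  shows "\<exists>d e. orthonormal M d e \<and> (\<forall>i<n. AE x in M. f i x = proj M d e (f i) x)"
proof (induction n)
  case 0
  then show ?case by (intro exI[of _ 0]) (auto simp: orthonormal_def)
next
  case (Suc n)
  then obtain d e where e: "orthonormal M d e"
    and fe: "\<And>i. i < n \<Longrightarrow> AE x in M. f i x = proj M d e (f i) x" by blast
  define r where "r x = f n x - proj M d e (f n) x" for x
  have r: "r \<in> sq M" unfolding r_def using f proj_sq[OF e] by auto
  show ?case
  proof (cases "nrm M r = 0")
    case True
    then have "AE x in M. f n x = proj M d e (f n) x"
      using nrm_eq_0_AE[OF r] by (simp add: r_def)
    then show ?thesis using e fe by (intro exI[of _ d] exI[of _ e]) (auto simp: less_Suc_eq)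
  next
    case False
    define u where "u x = complex_of_real (1 / nrm M r) * r x" for x
    define e' where "e' = e(d := u)"
    have u: "u \<in> sq M" unfolding u_def by (rule sq_scale[OF r])
    have uu: "ip M u u = 1"
      using False unfolding u_def ip_self nrm_scale by (simp add: power_mult_distrib norm_divide)
    have eu: "ip M (e k) u = 0" if "k < d" for k
      using ip_residual_basis[OF e that f[of n]] ip_cnj[of M "e k" r]
      unfolding u_def ip_scale_right by (simp add: r_def[abs_def])
    have ue: "ip M u (e k) = 0" if "k < d" for k
      using eu[OF that] ip_cnj[of M u "e k"] by simp
    have e': "orthonormal M (Suc d) e'"
      using e u uu eu ue unfolding orthonormal_def e'_def by (auto simp: less_Suc_eq)
    have proj': "proj M (Suc d) e' g x = proj M d e g x + ip M g u * u x" for g x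
      by (simp add: proj_def e'_def)
    have Pu: "ip M (proj M d e g) u = 0" for g
      using ip_proj_residual[OF e f[of n], of g] unfolding u_def ip_scale_right by (simp add: r_def[abs_def])
    have "AE x in M. f i x = proj M (Suc d) e' (f i) x" if i: "i < Suc n" for i
    proof (cases "i = n")
      case True
      have "ip M (f n) u = ip M (\<lambda>x. r x + proj M d e (f n) x) u"
        by (simp add: r_def)
      also have "\<dots> = ip M r u"
        using Pu by (simp add: ip_add_left[OF r proj_sq[OF e] u])
      also have "\<dots> = complex_of_real (nrm M r)"
        using False unfolding u_def ip_scale_right by (simp add: ip_self power2_eq_square)
      finally have "ip M (f n) u * u x = r x" for x
        using False by (simp add: u_def)
      then show ?thesis using True by (simp add: proj' r_def)
    next
      case False
      then have "i < n" using i by simp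
      note fi = fe[OF this]
      have "ip M (f i) u = 0"
        using ip_cong_AE_left[OF f[of i] proj_sq[OF e] u fi] Pu by simp
      then show ?thesis using fi by (simp add: proj')
    qed
    then show ?thesis using e' by blast
  qed
qed

section \<open>Independence of the pairing from the series\<close>

locale L2_pair = pair_sigma_finite M N for M :: "'a measure" and N :: "'b measure"
begin

abbreviation XY :: "('a \<times> 'b) set" where "XY \<equiv> space M \<times> space N"

lemma mn_AE: "marginally_null M N E \<Longrightarrow> AE z in M \<Otimes>\<^sub>M N. z \<notin> E"
  by (rule marginally_null_AE) unfold_locales

lemma
  fixes a :: "'a \<Rightarrow> complex" and b :: "'b \<Rightarrow> complex"
  assumes a: "integrable M a" and b: "integrable N b"
  shows integrable_tensor: "integrable (M \<Otimes>\<^sub>M N) (\<lambda>z. a (fst z) * b (snd z))"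
    and integral_tensor: "(\<integral>z. a (fst z) * b (snd z) \<partial>(M \<Otimes>\<^sub>M N)) = (\<integral>x. a x \<partial>M) * (\<integral>y. b y \<partial>N)"
    and integral_norm_tensor: "(\<integral>z. norm (a (fst z) * b (snd z)) \<partial>(M \<Otimes>\<^sub>M N))
        = (\<integral>x. norm (a x) \<partial>M) * (\<integral>y. norm (b y) \<partial>N)"
proof -
  have [measurable]: "a \<in> borel_measurable M" "b \<in> borel_measurable N" using a b by auto
  show i: "integrable (M \<Otimes>\<^sub>M N) (\<lambda>z. a (fst z) * b (snd z))"
  proof (rule Fubini_integrable)
    show "integrable M (\<lambda>x. \<integral>y. norm (a (fst (x, y)) * b (snd (x, y))) \<partial>N)"
      using a b by (simp add: norm_mult)
    show "AE x in M. integrable N (\<lambda>y. a (fst (x, y)) * b (snd (x, y)))"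
      using b by simp
  qed measurable
  show "(\<integral>z. a (fst z) * b (snd z) \<partial>(M \<Otimes>\<^sub>M N)) = (\<integral>x. a x \<partial>M) * (\<integral>y. b y \<partial>N)"
    using integral_fst'[OF i] by simp
  show "(\<integral>z. norm (a (fst z) * b (snd z)) \<partial>(M \<Otimes>\<^sub>M N))
        = (\<integral>x. norm (a x) \<partial>M) * (\<integral>y. norm (b y) \<partial>N)"
    using integral_fst'[OF integrable_norm[OF i]] by (simp add: norm_mult)
qed

text \<open>For a rank one operator the pairing is an integral over the product space, hence sees
  \<open>h\<close> only up to almost everywhere equality. Cauchy-Schwarz in each variable bounds the
  terms in \<open>L^1\<close> and justifies the exchange of sum and integral. The integrand is the
  sum of the series and not \<open>h\<close>, because \<open>h\<close> agrees with it only
  marginally almost everywhere and need not be measurable.\<close>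

lemma tensor_series_rank1_sums:
  assumes h: "tensor_series M N XY f g h" and p: "p \<in> sq M" and q: "q \<in> sq N"
  shows "(\<lambda>i. (\<integral>x. f i x * p x \<partial>M) * (\<integral>y. g i y * q y \<partial>N))
      sums (\<integral>z. (\<Sum>i. f i (fst z) * g i (snd z)) * (p (fst z) * q (snd z)) \<partial>(M \<Otimes>\<^sub>M N))"
    and "integrable (M \<Otimes>\<^sub>M N) (\<lambda>z. (\<Sum>i. f i (fst z) * g i (snd z)) * (p (fst z) * q (snd z)))"
    and "(\<integral>z. norm ((\<Sum>i. f i (fst z) * g i (snd z)) * (p (fst z) * q (snd z))) \<partial>(M \<Otimes>\<^sub>M N))
      \<le> nrm M p * nrm N q * (\<Sum>i. nrm M (f i) * nrm N (g i))"
proof -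
  have f: "f i \<in> sq M" and g: "g i \<in> sq N" for i using h by (auto simp: tensor_series_def)
  define t where "t i z = (f i (fst z) * p (fst z)) * (g i (snd z) * q (snd z))" for i and z :: "'a \<times> 'b"
  have ti: "integrable (M \<Otimes>\<^sub>M N) (t i)" for i
    unfolding t_def by (intro integrable_tensor sq_mult_integrable f g p q)
  have t_int: "(\<integral>z. t i z \<partial>(M \<Otimes>\<^sub>M N)) = (\<integral>x. f i x * p x \<partial>M) * (\<integral>y. g i y * q y \<partial>N)" for i
    unfolding t_def by (intro integral_tensor sq_mult_integrable f g p q)
  have t_le: "(\<integral>z. norm (t i z) \<partial>(M \<Otimes>\<^sub>M N)) \<le> nrm M p * nrm N q * (nrm M (f i) * nrm N (g i))" for i
  proof -
    have "(\<integral>z. norm (t i z) \<partial>(M \<Otimes>\<^sub>M N)) = (\<integral>x. norm (f i x * p x) \<partial>M) * (\<integral>y. norm (g i y * q y) \<partial>N)"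
      unfolding t_def by (intro integral_norm_tensor sq_mult_integrable f g p q)
    also have "\<dots> \<le> (nrm M (f i) * nrm M p) * (nrm N (g i) * nrm N q)"
      using Cauchy_Schwarz_sq[OF f p] Cauchy_Schwarz_sq[OF g q]
      by (intro mult_mono) (auto simp: norm_mult intro!: integral_nonneg)
    finally show ?thesis by (simp add: mult_ac)
  qed
  have s1: "summable (\<lambda>i. nrm M p * nrm N q * (nrm M (f i) * nrm N (g i)))"
    by (rule summable_mult[OF tensor_series_summable_mult[OF h]])
  have s: "summable (\<lambda>i. \<integral>z. norm (t i z) \<partial>(M \<Otimes>\<^sub>M N))"
  proof (rule summable_comparison_test'[OF s1])
    fix n
    show "norm (\<integral>z. norm (t n z) \<partial>(M \<Otimes>\<^sub>M N)) \<le> nrm M p * nrm N q * (nrm M (f n) * nrm N (g n))"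
      using t_le[of n] by (subst real_norm_def, subst abs_of_nonneg) (auto intro!: integral_nonneg)
  qed
  have mn: "marginally_null M N {z \<in> XY. \<not> (summable (\<lambda>i. (cmod (f i (fst z)))\<^sup>2) \<and> summable (\<lambda>i. (cmod (g i (snd z)))\<^sup>2))}"
    by (rule marginally_nullI[OF _ AE_summable_sq[of f] AE_summable_sq[of g]])
      (use h in \<open>auto simp: tensor_series_def\<close>)
  have AEs: "AE z in M \<Otimes>\<^sub>M N. summable (\<lambda>i. (cmod (f i (fst z)))\<^sup>2) \<and> summable (\<lambda>i. (cmod (g i (snd z)))\<^sup>2)"
    using mn_AE[OF mn] AE_space by eventually_elim (auto simp: space_pair_measure)
  have AEt: "AE z in M \<Otimes>\<^sub>M N. summable (\<lambda>i. norm (t i z))"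
    using AEs
  proof eventually_elim
    case (elim z)
    then have "summable (\<lambda>i. cmod (f i (fst z) * g i (snd z)))" by (intro summable_tensor) auto
    from summable_mult[OF this, of "cmod (p (fst z) * q (snd z))"] show ?case
      by (simp add: t_def norm_mult mult_ac)
  qed
  have eq: "AE z in M \<Otimes>\<^sub>M N. (\<Sum>i. t i z) = (\<Sum>i. f i (fst z) * g i (snd z)) * (p (fst z) * q (snd z))"
    using AEs
  proof eventually_elim
    case (elim z)
    then have "summable (\<lambda>i. f i (fst z) * g i (snd z))"
      using summable_norm_cancel[OF summable_tensor] by auto
    from suminf_mult2[OF this, of "p (fst z) * q (snd z)"] show ?case
      by (simp add: t_def mult_ac)
  qed
  have [measurable]: "f i \<in> borel_measurable M" "g i \<in> borel_measurable N" "p \<in> borel_measurable M"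
    "q \<in> borel_measurable N" for i using f g p q by (auto intro: sq_measurable)
  let ?F = "\<lambda>z. (\<Sum>i. f i (fst z) * g i (snd z)) * (p (fst z) * q (snd z))"
  have Fm: "?F \<in> borel_measurable (M \<Otimes>\<^sub>M N)" by measurable
  have tm: "(\<lambda>z. \<Sum>i. t i z) \<in> borel_measurable (M \<Otimes>\<^sub>M N)" unfolding t_def by measurable
  show Fi: "integrable (M \<Otimes>\<^sub>M N) ?F"
    using integrable_suminf[OF ti AEt s] integrable_cong_AE[OF tm Fm eq] by blast
  have "(\<lambda>i. \<integral>z. t i z \<partial>(M \<Otimes>\<^sub>M N)) sums (\<integral>z. (\<Sum>i. t i z) \<partial>(M \<Otimes>\<^sub>M N))"
    using summable_sums[OF summable_integral[OF ti AEt s]] integral_suminf[OF ti AEt s] by simp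
  then show "(\<lambda>i. (\<integral>x. f i x * p x \<partial>M) * (\<integral>y. g i y * q y \<partial>N)) sums (\<integral>z. ?F z \<partial>(M \<Otimes>\<^sub>M N))"
    using integral_cong_AE[OF tm Fm eq] unfolding t_int by simp
  have "(\<integral>z. norm (?F z) \<partial>(M \<Otimes>\<^sub>M N)) \<le> (\<integral>z. (\<Sum>i. norm (t i z)) \<partial>(M \<Otimes>\<^sub>M N))"
  proof (rule integral_mono_AE[OF integrable_norm[OF Fi]])
    show "integrable (M \<Otimes>\<^sub>M N) (\<lambda>z. \<Sum>i. norm (t i z))"
      by (rule integrable_suminf[OF integrable_norm[OF ti]]) (use AEt s in auto)
    show "AE z in M \<Otimes>\<^sub>M N. norm (?F z) \<le> (\<Sum>i. norm (t i z))"
      using AEt eq by eventually_elim (metis summable_norm)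
  qed
  also have "\<dots> = (\<Sum>i. \<integral>z. norm (t i z) \<partial>(M \<Otimes>\<^sub>M N))"
    by (rule integral_suminf[OF integrable_norm[OF ti]]) (use AEt s in auto)
  also have "\<dots> \<le> (\<Sum>i. nrm M p * nrm N q * (nrm M (f i) * nrm N (g i)))"
    by (rule suminf_le[OF t_le s s1])
  also have "\<dots> = nrm M p * nrm N q * (\<Sum>i. nrm M (f i) * nrm N (g i))"
    by (rule suminf_mult[OF tensor_series_summable_mult[OF h]])
  finally show "(\<integral>z. norm (?F z) \<partial>(M \<Otimes>\<^sub>M N)) \<le> nrm M p * nrm N q * (\<Sum>i. nrm M (f i) * nrm N (g i))" .
qed

lemma tensor_series_AE:
  assumes "tensor_series M N XY f g h"
  shows "AE z in M \<Otimes>\<^sub>M N. (\<Sum>i. f i (fst z) * g i (snd z)) = h z"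
  using mn_AE[OF tensor_series_sums[OF assms]] AE_space
  by eventually_elim (auto simp: space_pair_measure sums_iff)

lemma summable_form:
  assumes B: "bounded_form M N C B" and h: "tensor_series M N K f g h"
  shows "summable (\<lambda>i. cmod (B (f i) (g i)))"
proof (rule summable_comparison_test'[OF summable_mult[OF tensor_series_summable_mult[OF h], of C]])
  fix n show "norm (cmod (B (f n) (g n))) \<le> C * (nrm M (f n) * nrm N (g n))"
    using bounded_form_bound[OF B, of "f n" "g n"] h by (simp add: tensor_series_def)
qed

text \<open>Finite rank approximation: composing \<open>T\<close> with the projection onto the span of the first
  \<open>n\<close> functions \<open>f\<^sub>i\<close> turns the series into a finite sum of integrals of \<open>h\<close>.\<close>

lemma form_series_zero:
  assumes T: "T \<in> bounded_ops M N" and h: "tensor_series M N XY f g h"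
    and zero: "AE z in M \<Otimes>\<^sub>M N. h z = 0"
  shows "(\<Sum>i. form M N T (f i) (g i)) = 0"
proof -
  have f: "f i \<in> sq M" and g: "g i \<in> sq N" for i using h by (auto simp: tensor_series_def)
  obtain C where C: "0 \<le> C" and B: "bounded_form M N C (form M N T)"
    using bounded_form_ex[OF T] by metis
  let ?B = "form M N T"
  have le: "cmod (\<Sum>i. ?B (f i) (g i)) \<le> (\<Sum>i. C * (nrm M (f (i + n)) * nrm N (g (i + n))))" for n
  proof -
    obtain d e where e: "orthonormal M d e"
      and fe: "\<And>i. i < n \<Longrightarrow> AE x in M. f i x = proj M d e (f i) x"
      using finite_orthonormal_span[of f M n, OF f] by blast
    have ej: "e j \<in> sq M" if "j < d" for j using e that by (simp add: orthonormal_def)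
    define q where "q j = L2_rep (T (L2_class M (e j)))" for j
    have q: "q j \<in> sq N" if "j < d" for j
      unfolding q_def using bounded_ops_L2[OF T L2_class_in[OF ej[OF that]]] by auto
    have "(\<lambda>i. ?B (proj M d e (f i)) (g i)) sums (\<Sum>j<d. 0)"
    proof -
      have "?B (proj M d e (f i)) (g i) = (\<Sum>j<d. (\<integral>x. f i x * cnj (e j x) \<partial>M) * (\<integral>y. g i y * q j y \<partial>N))" for i
      proof -
        have "?B (proj M d e (f i)) (g i) = ?B (\<lambda>x. \<Sum>j<d. ip M (f i) (e j) * e j x) (g i)"
          by (simp add: proj_def[abs_def])
        also have "\<dots> = (\<Sum>j<d. ?B (\<lambda>x. ip M (f i) (e j) * e j x) (g i))"
          using ej by (intro bounded_form_sum_left[OF B] g) auto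
        also have "\<dots> = (\<Sum>j<d. ip M (f i) (e j) * ?B (e j) (g i))"
          using ej g by (intro sum.cong refl bounded_form_scale_left[OF B]) auto
        finally show ?thesis by (simp add: ip_def form_def q_def mult.commute)
      qed
      moreover have "(\<lambda>i. \<Sum>j<d. (\<integral>x. f i x * cnj (e j x) \<partial>M) * (\<integral>y. g i y * q j y \<partial>N)) sums (\<Sum>j<d. 0)"
      proof (rule sums_sum)
        fix j assume "j \<in> {..<d}"
        then have j: "j < d" by simp
        have "(\<integral>z. (\<Sum>i. f i (fst z) * g i (snd z)) * (cnj (e j (fst z)) * q j (snd z)) \<partial>(M \<Otimes>\<^sub>M N)) = 0"
          using zero tensor_series_AE[OF h] by (intro integral_eq_zero_AE) auto
        then show "(\<lambda>i. (\<integral>x. f i x * cnj (e j x) \<partial>M) * (\<integral>y. g i y * q j y \<partial>N)) sums 0"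
          using tensor_series_rank1_sums(1)[OF h sq_cnj[OF ej[OF j]] q[OF j]] by simp
      qed
      ultimately show ?thesis by simp
    qed
    then have P0: "(\<lambda>i. ?B (proj M d e (f i)) (g i)) sums 0" by simp
    \<comment> \<open>The projected series sums to zero, so subtracting it changes nothing. What
      remains vanishes for \<open>i < n\<close> and obeys the original bound for
      \<open>i \<ge> n\<close>; hence the whole sum is bounded by a tail.\<close>
    define r where "r i = ?B (\<lambda>x. f i x - proj M d e (f i) x) (g i)" for i
    have r: "r i = ?B (f i) (g i) - ?B (proj M d e (f i)) (g i)" for i
      unfolding r_def by (intro bounded_form_diff_left[OF B] f g proj_sq[OF e])
    have r_le: "cmod (r i) \<le> C * (nrm M (f i) * nrm N (g i))" for i
    proof -
      have "cmod (r i) \<le> C * (nrm M (\<lambda>x. f i x - proj M d e (f i) x) * nrm N (g i))"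
        unfolding r_def by (intro bounded_form_bound[OF B] sq_diff f g proj_sq[OF e])
      also have "\<dots> \<le> C * (nrm M (f i) * nrm N (g i))"
        using C by (intro mult_left_mono mult_right_mono nrm_residual_le[OF e f]) auto
      finally show ?thesis .
    qed
    have r0: "r i = 0" if "i < n" for i
      unfolding r using bounded_form_cong_AE_left[OF B f proj_sq[OF e] g fe[OF that]] by simp
    have "(\<lambda>i. ?B (f i) (g i)) sums (\<Sum>i. ?B (f i) (g i))"
      using summable_norm_cancel[OF summable_form[OF B h]] by (rule summable_sums)
    from sums_diff[OF this P0] have "r sums (\<Sum>i. ?B (f i) (g i))" by (simp add: r[abs_def])
    from sums_split_initial_segment[OF this, of n]
    have rn: "(\<lambda>i. r (i + n)) sums (\<Sum>i. ?B (f i) (g i))" using r0 by simp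
    have s: "summable (\<lambda>i. C * (nrm M (f (i + n)) * nrm N (g (i + n))))"
      using summable_ignore_initial_segment[OF tensor_series_summable_mult[OF h]] by (rule summable_mult)
    have "summable (\<lambda>i. norm (r (i + n)))"
      using r_le by (intro summable_comparison_test'[OF s]) auto
    then show ?thesis
      using summable_norm[of "\<lambda>i. r (i + n)"] suminf_le[of "\<lambda>i. norm (r (i + n))", OF r_le _ s] rn
      by (simp add: sums_iff)
  qed
  have "(\<lambda>n. \<Sum>i. C * (nrm M (f (i + n)) * nrm N (g (i + n)))) \<longlonglongrightarrow> 0"
    using suminf_exist_split2[OF summable_mult[OF tensor_series_summable_mult[OF h], of C]] .
  then have "cmod (\<Sum>i. ?B (f i) (g i)) \<le> 0"
    using le by (intro LIMSEQ_le_const) auto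
  then show ?thesis by simp
qed

text \<open>Merge one series with the negative of the other. Almost everywhere equality is the right
  hypothesis: \<open>Gamma_mult\<close> picks a function by a condition on the product measure, and
  its pairings must not depend on that choice.\<close>

lemma form_series_unique:
  assumes T: "T \<in> bounded_ops M N" and 1: "tensor_series M N XY f g h" and 2: "tensor_series M N XY f' g' h'"
    and eq: "AE z in M \<Otimes>\<^sub>M N. h z = h' z"
  shows "(\<Sum>i. form M N T (f i) (g i)) = (\<Sum>i. form M N T (f' i) (g' i))"
proof -
  obtain C where B: "bounded_form M N C (form M N T)"
    using bounded_form_ex[OF T] by metis
  let ?B = "form M N T" and ?f = "\<lambda>i x. (-1) * f' i x"
  have f: "f' i \<in> sq M" and g: "g' i \<in> sq N" for i using 2 by (auto simp: tensor_series_def)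
  have 3: "tensor_series M N XY ?f g' (\<lambda>z. - h' z)"
    using tensor_series_scale[OF 2, of "-1" 1] by simp
  have "(\<Sum>i. ?B (interleave f ?f i) (interleave g g' i)) = 0"
    by (rule form_series_zero[OF T tensor_series_add[OF 1 3]]) (use eq in auto)
  moreover have "(\<lambda>i. ?B (interleave f ?f i) (interleave g g' i)) sums
      ((\<Sum>i. ?B (f i) (g i)) + (\<Sum>i. ?B (?f i) (g' i)))"
    using summable_sums[OF summable_norm_cancel[OF summable_form[OF B 1]]]
      summable_sums[OF summable_norm_cancel[OF summable_form[OF B 3]]]
    by (rule sums_interleave_app[where F = ?B and a = f and b = ?f and c = g and d = g'])
  moreover have "(\<Sum>i. ?B (?f i) (g' i)) = - (\<Sum>i. ?B (f' i) (g' i))"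
    using suminf_minus[OF summable_norm_cancel[OF summable_form[OF B 2]]]
      bounded_form_scale_left[OF B f g, of "-1"] by simp
  ultimately show ?thesis by (simp add: sums_iff)
qed

lemma form_rep:
  assumes "T \<in> bounded_ops M N" "u \<in> L2 M" "v \<in> L2 N"
  shows "L2_inner N (T u) (L2_cnj N v) = form M N T (L2_rep u) (L2_rep v)"
proof -
  have v: "(\<lambda>y. cnj (L2_rep v y)) \<in> sq N" using assms by auto
  have t: "L2_rep (T u) \<in> sq N" using bounded_ops_L2[OF assms(1,2)] by auto
  show ?thesis
    unfolding L2_inner_def form_def L2_cnj_def L2_class_rep[OF assms(2)]
    using L2_rep_class[OF v] t assms(3)
    by (intro integral_cong_AE borel_measurable_times sq_measurable sq_cnj) auto
qed

text \<open>Replaces the description by an equation: any series of square-integrable functions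
  computes the pairing, whatever representatives \<open>L2_rep\<close> would choose.\<close>

lemma pairing_sums:
  assumes T: "T \<in> bounded_ops M N" and h: "tensor_series M N XY f g h"
  shows "(\<lambda>i. form M N T (f i) (g i)) sums pairing M N T h"
proof -
  obtain C where B: "bounded_form M N C (form M N T)"
    using bounded_form_ex[OF T] by metis
  have val: "(\<Sum>i. L2_inner N (T (u i)) (L2_cnj N (v i))) = (\<Sum>i. form M N T (f i) (g i))"
    if uv: "Gamma_series M N u v h" for u v
  proof -
    have "L2_inner N (T (u i)) (L2_cnj N (v i)) = form M N T (L2_rep (u i)) (L2_rep (v i))" for i
      using uv by (intro form_rep T) (auto simp: Gamma_series_iff)
    then show ?thesis
      using form_series_unique[OF T _ h, of "\<lambda>i. L2_rep (u i)" "\<lambda>i. L2_rep (v i)" h] uv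
      by (simp add: Gamma_series_iff)
  qed
  have "pairing M N T h = (\<Sum>i. form M N T (f i) (g i))"
    unfolding pairing_def
  proof (rule the_equality)
    show "\<exists>u v. Gamma_series M N u v h \<and> (\<Sum>i. form M N T (f i) (g i))
        = (\<Sum>i. L2_inner N (T (u i)) (L2_cnj N (v i)))"
      using Gamma_series_class[OF h] val by metis
  qed (use val in auto)
  then show ?thesis
    using summable_sums[OF summable_norm_cancel[OF summable_form[OF B h]]] by simp
qed

section \<open>Linear structure of the predual and of the pairing\<close>

lemma GammaE:
  assumes "h \<in> Gamma M N" obtains f g where "tensor_series M N XY f g h"
  using assms by (auto simp: Gamma_iff)

lemma GammaI: "tensor_series M N XY f g h \<Longrightarrow> h \<in> Gamma M N"
  by (auto simp: Gamma_iff)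

lemma Gamma_add [intro]: "h \<in> Gamma M N \<Longrightarrow> k \<in> Gamma M N \<Longrightarrow> (\<lambda>z. h z + k z) \<in> Gamma M N"
  unfolding Gamma_iff using tensor_series_add by blast

lemma Gamma_scale [intro]: "h \<in> Gamma M N \<Longrightarrow> (\<lambda>z. c * h z) \<in> Gamma M N"
  unfolding Gamma_iff using tensor_series_scale[where a = c and b = 1] by fastforce

lemma Gamma_zero [intro]: "(\<lambda>z. 0) \<in> Gamma M N"
  unfolding Gamma_iff using tensor_series_zero by blast

lemma Gamma_diff [intro]: "h \<in> Gamma M N \<Longrightarrow> k \<in> Gamma M N \<Longrightarrow> (\<lambda>z. h z - k z) \<in> Gamma M N"
  using Gamma_add[of h "\<lambda>z. (-1) * k z"] Gamma_scale[of k "-1"] by simp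

lemma Gamma_indicator [intro]:
  "h \<in> Gamma M N \<Longrightarrow> A \<in> sets M \<Longrightarrow> B \<in> sets N \<Longrightarrow> (\<lambda>z. indicator (A \<times> B) z * h z) \<in> Gamma M N"
  unfolding Gamma_iff using tensor_series_indicator by blast

lemma Gamma_tensor [intro]: "u \<in> sq M \<Longrightarrow> v \<in> sq N \<Longrightarrow> (\<lambda>z. u (fst z) * v (snd z)) \<in> Gamma M N"
  unfolding Gamma_iff using tensor_series_single by blast

lemma real_subspace_Gamma: "real_subspace (Gamma M N)"
  unfolding real_subspace_def by auto

lemma pairing_cong_AE:
  assumes T: "T \<in> bounded_ops M N" and "h \<in> Gamma M N" "k \<in> Gamma M N"
    and eq: "AE z in M \<Otimes>\<^sub>M N. h z = k z"
  shows "pairing M N T h = pairing M N T k"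
proof -
  obtain f g where 1: "tensor_series M N XY f g h" using assms(2) by (rule GammaE)
  obtain f' g' where 2: "tensor_series M N XY f' g' k" using assms(3) by (rule GammaE)
  show ?thesis
    using pairing_sums[OF T 1] pairing_sums[OF T 2] form_series_unique[OF T 1 2 eq] by (simp add: sums_iff)
qed

lemma pairing_add:
  assumes T: "T \<in> bounded_ops M N" and "h \<in> Gamma M N" "k \<in> Gamma M N"
  shows "pairing M N T (\<lambda>z. h z + k z) = pairing M N T h + pairing M N T k"
proof -
  obtain f g where 1: "tensor_series M N XY f g h" using assms(2) by (rule GammaE)
  obtain f' g' where 2: "tensor_series M N XY f' g' k" using assms(3) by (rule GammaE)
  show ?thesis
    using sums_unique2[OF pairing_sums[OF T tensor_series_add[OF 1 2]]
        sums_interleave_app[where F = "form M N T", OF pairing_sums[OF T 1] pairing_sums[OF T 2]]] .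
qed

lemma pairing_scale:
  assumes T: "T \<in> bounded_ops M N" and "h \<in> Gamma M N"
  shows "pairing M N T (\<lambda>z. c * h z) = c * pairing M N T h"
proof -
  obtain f g where 1: "tensor_series M N XY f g h" using assms(2) by (rule GammaE)
  obtain C where B: "bounded_form M N C (form M N T)" using bounded_form_ex[OF T] by metis
  have "form M N T (\<lambda>x. c * f i x) (g i) = c * form M N T (f i) (g i)" for i
    using 1 by (intro bounded_form_scale_left[OF B]) (auto simp: tensor_series_def)
  then show ?thesis
    using sums_unique2[OF pairing_sums[OF T tensor_series_scale[OF 1, of c 1]]] sums_mult[OF pairing_sums[OF T 1], of c]
    by simp
qed

lemma pairing_diff:
  assumes T: "T \<in> bounded_ops M N" and h: "h \<in> Gamma M N" and k: "k \<in> Gamma M N"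
  shows "pairing M N T (\<lambda>z. h z - k z) = pairing M N T h - pairing M N T k"
  using pairing_add[OF T h Gamma_scale[OF k, of "-1"]] pairing_scale[OF T k, of "-1"] by simp

lemma pairing_tensor:
  assumes T: "T \<in> bounded_ops M N" and u: "u \<in> sq M" and v: "v \<in> sq N"
  shows "pairing M N T (\<lambda>z. u (fst z) * v (snd z)) = form M N T u v"
proof -
  obtain C where B: "bounded_form M N C (form M N T)" using bounded_form_ex[OF T] by metis
  have "form M N T (if i = 0 then u else (\<lambda>x. 0)) (if i = 0 then v else (\<lambda>y. 0))
      = (if i = 0 then form M N T u v else 0)" for i :: nat
    using bounded_form_zero_left[OF B sq_zero] by simp
  then show ?thesis
    using sums_unique2[OF pairing_sums[OF T tensor_series_single[OF u v]]]
      sums_single[of 0 "\<lambda>_. form M N T u v"] by simp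
qed

lemma pairing_AE_zero:
  assumes "T \<in> bounded_ops M N" "h \<in> Gamma M N" "AE z in M \<Otimes>\<^sub>M N. h z = 0"
  shows "pairing M N T h = 0"
  using pairing_cong_AE[OF assms(1,2) Gamma_zero assms(3)] pairing_scale[OF assms(1) Gamma_zero, of 0] by simp

lemma
  assumes S: "S \<in> bounded_ops M N" and T: "T \<in> bounded_ops M N" and h: "h \<in> Gamma M N"
  shows pairing_op_add: "op_add M N S T \<in> bounded_ops M N \<Longrightarrow>
      pairing M N (op_add M N S T) h = pairing M N S h + pairing M N T h"
    and pairing_op_scale: "op_scale M N c T \<in> bounded_ops M N \<Longrightarrow>
      pairing M N (op_scale M N c T) h = c * pairing M N T h"
proof -
  obtain f g where 1: "tensor_series M N XY f g h" using h by (rule GammaE)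
  then have f: "f i \<in> sq M" and g: "g i \<in> sq N" for i by (auto simp: tensor_series_def)
  show "pairing M N (op_add M N S T) h = pairing M N S h + pairing M N T h"
    if ST: "op_add M N S T \<in> bounded_ops M N"
    using sums_unique2[OF pairing_sums[OF ST 1]] sums_add[OF pairing_sums[OF S 1] pairing_sums[OF T 1]]
    by (simp add: form_op_add[OF S T f g])
  show "pairing M N (op_scale M N c T) h = c * pairing M N T h"
    if ST: "op_scale M N c T \<in> bounded_ops M N"
    using sums_unique2[OF pairing_sums[OF ST 1]] sums_mult[OF pairing_sums[OF T 1], of c]
    by (simp add: form_op_scale[OF T f g])
qed

text \<open>Together with \<open>op_mult_indicator_eq_0\<close> this translates the condition in
  \<open>M_max\<close> into vanishing pairings with functions cut down to a rectangle.\<close>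

lemma pairing_indicator_eq_0:
  assumes T: "T \<in> bounded_ops M N" and A: "A \<in> sets M" and B: "B \<in> sets N" and h: "h \<in> Gamma M N"
    and 0: "op_mult M N (indicator B) T (indicator A) = op_zero M N"
  shows "pairing M N T (\<lambda>z. indicator (A \<times> B) z * h z) = 0"
proof -
  obtain f g where 1: "tensor_series M N XY f g h" using h by (rule GammaE)
  then have f: "f i \<in> sq M" and g: "g i \<in> sq N" for i by (auto simp: tensor_series_def)
  have "form M N T (\<lambda>x. indicator A x * f i x) (\<lambda>y. indicator B y * g i y) = 0" for i
    using form_op_mult_indicator[OF T A B f[of i] g[of i]] form_op_zero[OF f[of i] g[of i]] by (simp add: 0)
  then show ?thesis
    using sums_unique2[OF pairing_sums[OF T tensor_series_indicator[OF 1 A B]]] by simp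
qed

lemma op_mult_indicator_eq_0:
  assumes T: "T \<in> bounded_ops M N" and A: "A \<in> sets M" and B: "B \<in> sets N"
    and 0: "\<And>h. h \<in> Gamma M N \<Longrightarrow> pairing M N T (\<lambda>z. indicator (A \<times> B) z * h z) = 0"
  shows "op_mult M N (indicator B) T (indicator A) = op_zero M N"
proof (rule op_eqI[OF op_mult_indicator_ext[OF T A B] op_zero_ext])
  fix f g assume f: "f \<in> sq M" and g: "g \<in> sq N"
  have "(\<lambda>z. (indicator A (fst z) * f (fst z)) * (indicator B (snd z) * g (snd z)))
      = (\<lambda>z. indicator (A \<times> B) z * (f (fst z) * g (snd z)))"
    by (auto simp: fun_eq_iff indicator_def)
  then have "form M N T (\<lambda>x. indicator A x * f x) (\<lambda>y. indicator B y * g y) = 0"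
    using pairing_tensor[OF T sq_indicator[OF A f] sq_indicator[OF B g]] 0[OF Gamma_tensor[OF f g]] by simp
  then show "form M N (op_mult M N (indicator B) T (indicator A)) f g = form M N (op_zero M N) f g"
    by (simp add: form_op_mult_indicator[OF T A B f g] form_op_zero[OF f g])
qed

lemma pairing_le_series:
  assumes T: "T \<in> bounded_ops M N" and B: "bounded_form M N C (form M N T)"
    and h: "tensor_series M N XY f g h"
  shows "cmod (pairing M N T h) \<le> C * (\<Sum>i. nrm M (f i) * nrm N (g i))"
proof -
  have "cmod (pairing M N T h) \<le> (\<Sum>i. cmod (form M N T (f i) (g i)))"
    using summable_norm[OF summable_form[OF B h]] pairing_sums[OF T h] by (simp add: sums_iff)
  also have "\<dots> \<le> (\<Sum>i. C * (nrm M (f i) * nrm N (g i)))"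
    using h by (intro suminf_le bounded_form_bound[OF B] summable_form[OF B h]
        summable_mult[OF tensor_series_summable_mult[OF h]]) (auto simp: tensor_series_def)
  also have "\<dots> = C * (\<Sum>i. nrm M (f i) * nrm N (g i))"
    by (rule suminf_mult[OF tensor_series_summable_mult[OF h]])
  finally show ?thesis .
qed

section \<open>The projective norm\<close>

lemma Gamma_norm_eq:
  "Gamma_norm M N h = Inf {(\<Sum>i. nrm M (f i) * nrm N (g i)) | f g. tensor_series M N XY f g h}"
proof -
  have "{(\<Sum>i. L2_norm M (u i) * L2_norm N (v i)) | u v. Gamma_series M N u v h}
      = {(\<Sum>i. nrm M (f i) * nrm N (g i)) | f g. tensor_series M N XY f g h}" (is "?A = ?B")
  proof
    show "?A \<subseteq> ?B" by (auto simp: Gamma_series_iff L2_norm_rep)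
    show "?B \<subseteq> ?A"
    proof
      fix r assume "r \<in> ?B"
      then obtain f g where h: "tensor_series M N XY f g h" and r: "r = (\<Sum>i. nrm M (f i) * nrm N (g i))"
        by blast
      have "L2_norm M (L2_class M (f i)) = nrm M (f i)" "L2_norm N (L2_class N (g i)) = nrm N (g i)" for i
        using h by (auto simp: tensor_series_def L2_norm_class)
      then show "r \<in> ?A"
        using Gamma_series_class[OF h] unfolding r
        by (intro CollectI exI[of _ "\<lambda>i. L2_class M (f i)"] exI[of _ "\<lambda>i. L2_class N (g i)"]) simp
    qed
  qed
  then show ?thesis unfolding Gamma_norm_def by simp
qed

lemma bdd_below_Gamma_norm:
  "bdd_below {(\<Sum>i. nrm M (f i) * nrm N (g i)) | f g. tensor_series M N XY f g h}"
  by (rule bdd_belowI[of _ 0]) (auto intro!: suminf_nonneg tensor_series_summable_mult)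

lemma Gamma_norm_le: "tensor_series M N XY f g h \<Longrightarrow> Gamma_norm M N h \<le> (\<Sum>i. nrm M (f i) * nrm N (g i))"
  unfolding Gamma_norm_eq by (rule cInf_lower[OF _ bdd_below_Gamma_norm]) blast

lemma Gamma_norm_le_cost: "tensor_series M N XY f g h \<Longrightarrow> Gamma_norm M N h \<le> series_cost M N f g"
  using Gamma_norm_le suminf_nrm_mult_le_cost order_trans by blast

lemma Gamma_norm_nonneg: "h \<in> Gamma M N \<Longrightarrow> 0 \<le> Gamma_norm M N h"
  unfolding Gamma_norm_eq
  by (rule cInf_greatest) (auto elim!: GammaE intro!: suminf_nonneg tensor_series_summable_mult)

lemma pairing_le_Gamma_norm:
  assumes T: "T \<in> bounded_ops M N" and B: "bounded_form M N C (form M N T)" and C: "0 \<le> C"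
    and h: "h \<in> Gamma M N"
  shows "cmod (pairing M N T h) \<le> C * Gamma_norm M N h"
proof (cases "C = 0")
  case True
  obtain f g where "tensor_series M N XY f g h" using h by (rule GammaE)
  from pairing_le_series[OF T B this] True show ?thesis by simp
next
  case False
  then have C: "0 < C" using C by simp
  have "cmod (pairing M N T h) / C \<le> Gamma_norm M N h"
    unfolding Gamma_norm_eq
  proof (rule cInf_greatest)
    show "{(\<Sum>i. nrm M (f i) * nrm N (g i)) | f g. tensor_series M N XY f g h} \<noteq> {}"
      using h by (auto elim!: GammaE)
    fix r assume "r \<in> {(\<Sum>i. nrm M (f i) * nrm N (g i)) | f g. tensor_series M N XY f g h}"
    then show "cmod (pairing M N T h) / C \<le> r"
      using pairing_le_series[OF T B] C by (auto simp: field_simps)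
  qed
  then show ?thesis using C by (simp add: field_simps)
qed

text \<open>For positive \<open>a\<close> the minimum over \<open>t\<close> of the half sum of
  squares is \<open>a * b\<close>, attained at \<open>t^2 = b / a\<close>. Adding \<delta> to both
  numbers keeps \<open>t\<close> positive and finite when \<open>a\<close> or \<open>b\<close> is
  zero.\<close>

lemma le_mult_of_scaled:
  fixes a b :: real
  assumes a: "0 \<le> a" and b: "0 \<le> b" and C: "0 \<le> C"
    and le: "\<And>t. 0 < t \<Longrightarrow> x \<le> C * (((t * a)\<^sup>2 + (b / t)\<^sup>2) / 2)"
  shows "x \<le> C * (a * b)"
proof (rule field_le_epsilon)
  fix \<epsilon> :: real assume \<epsilon>: "0 < \<epsilon>"
  \<comment> \<open>Chosen so that the error \<open>\<delta> * C * (a + b) / 2\<close> stays below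
    \<epsilon>; the summand \<open>1\<close> keeps the denominator positive.\<close>
  define \<delta> where "\<delta> = \<epsilon> / (C * (a + b) + 1)"
  have den: "0 < C * (a + b) + 1" using a b C by (simp add: add_nonneg_pos)
  have \<delta>: "0 < \<delta>" using \<epsilon> den by (simp add: \<delta>_def)
  define t where "t = sqrt ((b + \<delta>) / (a + \<delta>))"
  have t: "0 < t" "t\<^sup>2 = (b + \<delta>) / (a + \<delta>)" using a b \<delta> by (auto simp: t_def)
  have "(t * a)\<^sup>2 = (b + \<delta>) * (a * (a / (a + \<delta>)))"
    using t(2) by (simp only: power_mult_distrib) (simp add: power2_eq_square)
  also have "\<dots> \<le> (b + \<delta>) * (a * 1)"
    using a b \<delta> by (intro mult_left_mono) auto
  finally have 1: "(t * a)\<^sup>2 \<le> (b + \<delta>) * a" by simp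
  have "(b / t)\<^sup>2 = (a + \<delta>) * (b * (b / (b + \<delta>)))"
    using t(2) by (simp only: power_divide) (simp add: power2_eq_square)
  also have "\<dots> \<le> (a + \<delta>) * (b * 1)"
    using a b \<delta> by (intro mult_left_mono) auto
  finally have 2: "(b / t)\<^sup>2 \<le> (a + \<delta>) * b" by simp
  have "x \<le> C * (((t * a)\<^sup>2 + (b / t)\<^sup>2) / 2)" by (rule le[OF t(1)])
  also have "\<dots> \<le> C * (((b + \<delta>) * a + (a + \<delta>) * b) / 2)"
    using C 1 2 by (intro mult_left_mono) auto
  also have "\<dots> = C * (a * b) + \<delta> * (C * (a + b)) / 2" by (simp add: algebra_simps add_divide_distrib)
  also have "\<delta> * (C * (a + b)) / 2 \<le> \<delta> * (C * (a + b) + 1)"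
  proof -
    have "0 \<le> C * (a + b)" using a b C by simp
    then have "\<delta> * (C * (a + b) / 2) \<le> \<delta> * (C * (a + b) + 1)"
      using \<delta> by (intro mult_left_mono) linarith+
    then show ?thesis by simp
  qed
  also have "\<delta> * (C * (a + b) + 1) = \<epsilon>" using den by (simp add: \<delta>_def)
  finally show "x \<le> C * (a * b) + \<epsilon>" by simp
qed

section \<open>Functionals on the predual as operators\<close>

lemma Gamma_sum: "finite I \<Longrightarrow> (\<And>i. i \<in> I \<Longrightarrow> h i \<in> Gamma M N) \<Longrightarrow> (\<lambda>z. \<Sum>i\<in>I. h i z) \<in> Gamma M N"
  by (induction I rule: finite_induct) auto

text \<open>The dual of the predual is the space of bounded operators. The values of
  \<open>F\<close> on elementary tensors form a bounded bilinear form, hence an operator; the cost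
  bound on remainders extends the agreement from finite sums to all of the predual.\<close>

lemma functional_representation:
  assumes add: "\<And>h k. h \<in> Gamma M N \<Longrightarrow> k \<in> Gamma M N \<Longrightarrow> F (\<lambda>z. h z + k z) = F h + F k"
    and scale: "\<And>c h. h \<in> Gamma M N \<Longrightarrow> F (\<lambda>z. c * h z) = c * F h"
    and bound: "\<And>f g h. tensor_series M N XY f g h \<Longrightarrow> cmod (F h) \<le> C * series_cost M N f g"
    and C: "0 \<le> C"
  shows "\<exists>T\<in>bounded_ops M N. (\<forall>u\<in>L2 M. L2_norm N (T u) \<le> C * L2_norm M u) \<and>
    (\<forall>h\<in>Gamma M N. pairing M N T h = F h)"
proof -
  define B where "B f g = F (\<lambda>z. f (fst z) * g (snd z))" for f g
  have "bounded_form M N C B"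
    unfolding bounded_form_def
  proof (intro conjI ballI allI)
    fix f f' g assume f: "f \<in> sq M" "f' \<in> sq M" and g: "g \<in> sq N"
    show "B (\<lambda>x. f x + f' x) g = B f g + B f' g"
      using add[OF Gamma_tensor[OF f(1) g] Gamma_tensor[OF f(2) g]] by (simp add: B_def distrib_right)
  next
    fix c f g assume f: "f \<in> sq M" and g: "g \<in> sq N"
    show "B (\<lambda>x. c * f x) g = c * B f g"
      using scale[OF Gamma_tensor[OF f g], of c] by (simp add: B_def mult.assoc)
    show "B f (\<lambda>x. c * g x) = c * B f g"
      using scale[OF Gamma_tensor[OF f g], of c] by (simp add: B_def mult.left_commute)
  next
    fix f g g' assume f: "f \<in> sq M" and g: "g \<in> sq N" "g' \<in> sq N"
    show "B f (\<lambda>x. g x + g' x) = B f g + B f g'"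
      using add[OF Gamma_tensor[OF f g(1)] Gamma_tensor[OF f g(2)]] by (simp add: B_def distrib_left)
  next
    fix f g assume f: "f \<in> sq M" and g: "g \<in> sq N"
    show "cmod (B f g) \<le> C * (nrm M f * nrm N g)"
    proof (rule le_mult_of_scaled[OF nrm_nonneg nrm_nonneg C])
      fix t :: real assume t: "0 < t"
      \<comment> \<open>The same elementary tensor with its norm redistributed between the factors;
        optimising over \<open>t\<close> turns the half sum of squares into the product of the
        norms.\<close>
      let ?f = "\<lambda>x. of_real t * f x" and ?g = "\<lambda>y. of_real (1 / t) * g y"
      have "(\<lambda>z. ?f (fst z) * ?g (snd z)) = (\<lambda>z. f (fst z) * g (snd z))"
        using t by (simp add: fun_eq_iff)
      then have "cmod (B f g) \<le> C * (((nrm M ?f)\<^sup>2 + (nrm N ?g)\<^sup>2) / 2)"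
        using bound[OF tensor_series_single[OF sq_scale[OF f, of "of_real t"] sq_scale[OF g, of "of_real (1 / t)"]]]
        unfolding series_cost_single B_def by simp
      then show "cmod (B f g) \<le> C * (((t * nrm M f)\<^sup>2 + (nrm N g / t)\<^sup>2) / 2)"
        using t unfolding nrm_scale by (simp add: norm_divide)
    qed
  qed
  from bounded_form_op[OF this C] obtain T where T: "T \<in> bounded_ops M N"
    and Tn: "\<forall>u\<in>L2 M. L2_norm N (T u) \<le> C * L2_norm M u"
    and TB: "\<And>f g. f \<in> sq M \<Longrightarrow> g \<in> sq N \<Longrightarrow> form M N T f g = B f g" by blast
  have "pairing M N T h = F h" if hG: "h \<in> Gamma M N" for h
  proof -
    obtain f g where h: "tensor_series M N XY f g h" using hG by (rule GammaE)
    then have f: "f i \<in> sq M" and g: "g i \<in> sq N" for i by (auto simp: tensor_series_def)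
    define s where "s n z = (\<Sum>i<n. f i (fst z) * g i (snd z))" for n z
    have sG: "s n \<in> Gamma M N" for n
      unfolding s_def by (intro Gamma_sum Gamma_tensor f g) auto
    have Fs: "F (s n) = (\<Sum>i<n. form M N T (f i) (g i))" for n
    proof (induction n)
      case 0
      then show ?case using scale[OF Gamma_zero, of 0] by (simp add: s_def[abs_def])
    next
      case (Suc n)
      then show ?case
        using add[OF sG[of n] Gamma_tensor[OF f[of n] g[of n]]] TB[OF f g]
        by (simp add: s_def[abs_def] B_def)
    qed
    \<comment> \<open>The remainder after \<open>n\<close> terms is represented by the shifted
      series, whose cost is the tail of a convergent series.\<close>
    have "(\<lambda>n. F h - F (s n)) \<longlonglongrightarrow> 0"
    proof (rule Lim_null_comparison)
      show "\<forall>\<^sub>F n in sequentially. norm (F h - F (s n)) \<le> C * (\<Sum>i. ((nrm M (f (i + n)))\<^sup>2 + (nrm N (g (i + n)))\<^sup>2) / 2)"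
      proof (rule always_eventually, rule allI)
        fix n
        have "F (\<lambda>z. (h z - s n z) + s n z) = F (\<lambda>z. h z - s n z) + F (s n)"
          using hG sG by (intro add) auto
        then have "F (\<lambda>z. h z - s n z) = F h - F (s n)" by simp
        then show "norm (F h - F (s n)) \<le> C * (\<Sum>i. ((nrm M (f (i + n)))\<^sup>2 + (nrm N (g (i + n)))\<^sup>2) / 2)"
          using bound[OF tensor_series_shift[OF h, of n]] by (simp add: s_def series_cost_def)
      qed
      show "(\<lambda>n. C * (\<Sum>i. ((nrm M (f (i + n)))\<^sup>2 + (nrm N (g (i + n)))\<^sup>2) / 2)) \<longlonglongrightarrow> 0"
        by (rule tendsto_mult_right_zero) (rule suminf_exist_split2[OF tensor_series_summable[OF h]])
    qed
    from tendsto_diff[OF tendsto_const[of "F h"] this] have "(\<lambda>n. F (s n)) \<longlonglongrightarrow> F h" by simp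
    moreover have "(\<lambda>n. F (s n)) \<longlonglongrightarrow> pairing M N T h"
      using pairing_sums[OF T h] unfolding Fs sums_def .
    ultimately show ?thesis by (rule LIMSEQ_unique[rotated])
  qed
  then show ?thesis using T Tn by blast
qed

subsection \<open>Duality between the predual and the bounded operators\<close>

text \<open>Only values on \<open>K\<close> are constrained, so this is a seminorm that ignores what
  a function does elsewhere; \<open>qcost_eq_0\<close> identifies its kernel. On the whole space it
  dominates \<open>Gamma_norm\<close>.\<close>

definition qcost :: "('a \<times> 'b) set \<Rightarrow> ('a \<times> 'b \<Rightarrow> complex) \<Rightarrow> real" where
  "qcost K h = Inf {series_cost M N f g | f g. tensor_series M N K f g h}"

lemma bdd_below_qcost: "bdd_below {series_cost M N f g | f g. tensor_series M N K f g h}"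
  by (rule bdd_belowI[of _ 0]) (auto intro: series_cost_nonneg)

lemma qcost_le: "tensor_series M N K f g h \<Longrightarrow> qcost K h \<le> series_cost M N f g"
  unfolding qcost_def by (rule cInf_lower[OF _ bdd_below_qcost]) blast

lemma qcost_nonempty:
  assumes "K \<subseteq> XY" "h \<in> Gamma M N"
  shows "{series_cost M N f g | f g. tensor_series M N K f g h} \<noteq> {}"
  using assms(2) tensor_series_mono[OF _ assms(1)] by (auto simp: Gamma_iff) blast

lemma qcost_greatest:
  assumes "K \<subseteq> XY" "h \<in> Gamma M N" "\<And>f g. tensor_series M N K f g h \<Longrightarrow> c \<le> series_cost M N f g"
  shows "c \<le> qcost K h"
  unfolding qcost_def using qcost_nonempty[OF assms(1,2)] assms(3) by (intro cInf_greatest) auto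

lemma qcost_nonneg: "K \<subseteq> XY \<Longrightarrow> h \<in> Gamma M N \<Longrightarrow> 0 \<le> qcost K h"
  by (rule qcost_greatest) (auto intro: series_cost_nonneg)

lemma sublinear_qcost:
  assumes K: "K \<subseteq> XY" shows "sublinear_on (Gamma M N) (qcost K)"
  unfolding sublinear_on_def
proof (intro conjI ballI allI impI)
  fix h k assume h: "h \<in> Gamma M N" and k: "k \<in> Gamma M N"
  have "qcost K (\<lambda>z. h z + k z) - series_cost M N f g \<le> qcost K k"
    if fg: "tensor_series M N K f g h" for f g
  proof (rule qcost_greatest[OF K k])
    fix f' g' assume fg': "tensor_series M N K f' g' k"
    show "qcost K (\<lambda>z. h z + k z) - series_cost M N f g \<le> series_cost M N f' g'"
      using qcost_le[OF tensor_series_add[OF fg fg']] series_cost_add[OF fg fg'] by simp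
  qed
  then have "qcost K (\<lambda>z. h z + k z) - qcost K k \<le> qcost K h"
    by (intro qcost_greatest[OF K h]) (simp add: algebra_simps)
  then show "qcost K (\<lambda>z. h z + k z) \<le> qcost K h + qcost K k" by simp
next
  fix t :: real and h assume t: "0 \<le> t" and h: "h \<in> Gamma M N"
  have le: "qcost K (\<lambda>z. of_real t * h z) \<le> t * qcost K h" if t: "0 < t" and h: "h \<in> Gamma M N" for t h
  proof -
    have "qcost K (\<lambda>z. of_real t * h z) / t \<le> qcost K h"
    proof (rule qcost_greatest[OF K h])
      fix f g assume fg: "tensor_series M N K f g h"
      \<comment> \<open>A factor \<open>t\<close> on one side alone would not scale the half sum of
        squares by \<open>t\<close>; hence \<open>sqrt t\<close> on both sides.\<close>
      define a where "a = complex_of_real (sqrt t)"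
      have a: "a * a = of_real t" "(cmod a)\<^sup>2 = t"
        using t by (auto simp: a_def simp flip: of_real_mult)
      show "qcost K (\<lambda>z. of_real t * h z) / t \<le> series_cost M N f g"
        using qcost_le[OF tensor_series_scale[OF fg, of a a]] t
        unfolding series_cost_scale[OF fg] a by (simp add: field_simps)
    qed
    then show ?thesis using t by (simp add: field_simps)
  qed
  show "qcost K (\<lambda>z. of_real t * h z) = t * qcost K h"
  proof (cases "t = 0")
    case True
    have "qcost K (\<lambda>z. 0) \<le> 0"
      using qcost_le[OF tensor_series_zero] by (simp add: series_cost_def)
    then show ?thesis using True qcost_nonneg[OF K Gamma_zero] by simp
  next
    case False
    then have t: "0 < t" using t by simp
    have "qcost K (\<lambda>z. of_real (1/t) * (of_real t * h z)) \<le> (1/t) * qcost K (\<lambda>z. of_real t * h z)"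
      using t h by (intro le) auto
    moreover have "(\<lambda>z. of_real (1/t) * (of_real t * h z)) = h"
      using t by (auto simp: fun_eq_iff)
    ultimately have "t * qcost K h \<le> qcost K (\<lambda>z. of_real t * h z)"
      using t by (simp add: field_simps)
    then show ?thesis using le[OF t h] by simp
  qed
qed

text \<open>With \<open>K\<close> the whole space this is the norming property of the duality; for a general \<open>K\<close>
  it produces operators supported on \<open>K\<close>.\<close>

theorem duality_attained:
  assumes K: "K \<subseteq> XY" and q: "q \<in> Gamma M N"
  shows "\<exists>T\<in>bounded_ops M N. (\<forall>u\<in>L2 M. L2_norm N (T u) \<le> L2_norm M u) \<and>
    Re (pairing M N T q) = qcost K q \<and>
    (\<forall>k\<in>Gamma M N. marginally_null M N {z \<in> K. k z \<noteq> 0} \<longrightarrow> pairing M N T k = 0)"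
proof -
  obtain L where add: "\<And>f g. f \<in> Gamma M N \<Longrightarrow> g \<in> Gamma M N \<Longrightarrow> L (\<lambda>z. f z + g z) = L f + L g"
    and scale: "\<And>t f. f \<in> Gamma M N \<Longrightarrow> L (\<lambda>z. of_real t * f z) = t * L f"
    and le: "\<And>f. f \<in> Gamma M N \<Longrightarrow> L f \<le> qcost K f" and Lq: "L q = qcost K q"
    using Hahn_Banach_sublinear[OF sublinear_qcost[OF K] real_subspace_Gamma q] by blast
  \<comment> \<open>The complex functional with real part \<open>L\<close>, namely
    \<open>L k - \<i> * L (\<i> k)\<close>.\<close>
  define F where "F k = Complex (L k) (- L (\<lambda>z. \<i> * k z))" for k
  have Fadd: "F (\<lambda>z. h z + k z) = F h + F k" if h: "h \<in> Gamma M N" and k: "k \<in> Gamma M N" for h k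
    using add[OF h k] add[OF Gamma_scale[OF h, of \<i>] Gamma_scale[OF k, of \<i>]]
    by (simp add: F_def distrib_left complex_eq_iff)
  have Lc: "L (\<lambda>z. c * h z) = Re c * L h + Im c * L (\<lambda>z. \<i> * h z)" if h: "h \<in> Gamma M N" for c h
  proof -
    have "(\<lambda>z. c * h z) = (\<lambda>z. of_real (Re c) * h z + of_real (Im c) * (\<i> * h z))"
      by (auto simp: fun_eq_iff complex_eq_iff algebra_simps)
    then show ?thesis
      using add[OF Gamma_scale[OF h, of "of_real (Re c)"] Gamma_scale[OF Gamma_scale[OF h, of \<i>], of "of_real (Im c)"]]
        scale[OF h] scale[OF Gamma_scale[OF h, of \<i>]] by simp
  qed
  have Fscale: "F (\<lambda>z. c * h z) = c * F h" if h: "h \<in> Gamma M N" for c h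
    using Lc[OF h, of c] Lc[OF h, of "\<i> * c"]
    by (simp add: F_def complex_eq_iff mult.assoc[symmetric])
  have Fbound: "cmod (F h) \<le> 1 * series_cost M N f g" if fg: "tensor_series M N XY f g h" for f g h
  proof (cases "F h = 0")
    case True
    then show ?thesis using series_cost_nonneg[OF fg] by simp
  next
    case False
    \<comment> \<open>Rotation by a unimodular number makes the value of \<open>F\<close> real and
      nonnegative, so that the bound on the real part applies. Rotating only the first factors
      leaves the cost unchanged.\<close>
    define c where "c = cnj (F h) / of_real (cmod (F h))"
    have c: "cmod c = 1" using False by (simp add: c_def norm_divide)
    have h: "h \<in> Gamma M N" using fg by (rule GammaI)
    have ser: "tensor_series M N XY (\<lambda>i x. c * f i x) (\<lambda>i y. 1 * g i y) (\<lambda>z. c * 1 * h z)"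
      by (rule tensor_series_scale[OF fg])
    have "c * F h = of_real (cmod (F h))"
      using False by (simp add: c_def complex_norm_square[symmetric] mult.commute[of "cnj (F h)"] power2_eq_square)
    then have "cmod (F h) = Re (F (\<lambda>z. c * h z))" using Fscale[OF h, of c] by simp
    also have "\<dots> = L (\<lambda>z. c * h z)" by (simp add: F_def)
    also have "\<dots> \<le> qcost K (\<lambda>z. c * h z)" by (intro le Gamma_scale h)
    also have "\<dots> \<le> series_cost M N (\<lambda>i x. c * f i x) (\<lambda>i y. 1 * g i y)"
      using qcost_le[OF tensor_series_mono[OF ser K]] by simp
    also have "\<dots> = series_cost M N f g"
      unfolding series_cost_def nrm_scale c by simp
    finally show ?thesis by simp
  qed
  have Fzero: "F k = 0" if k: "k \<in> Gamma M N" and 0: "marginally_null M N {z \<in> K. k z \<noteq> 0}" for k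
  proof -
    have L0: "L (\<lambda>z. c * k z) \<le> 0" for c
    proof -
      \<comment> \<open>On \<open>K\<close> the zero series already represents \<open>c * k\<close>,
        at cost zero.\<close>
      have "marginally_null M N {z \<in> K. 0 \<noteq> c * k z}"
        by (rule marginally_null_subset[OF 0]) auto
      from qcost_le[OF tensor_series_cong[OF tensor_series_zero this]]
      have "qcost K (\<lambda>z. c * k z) \<le> 0" by (simp add: series_cost_def)
      then show ?thesis using le[OF Gamma_scale[OF k, of c]] by simp
    qed
    have "L (\<lambda>z. c * k z) = 0" for c
      using L0[of c] L0[of "- c"] scale[OF Gamma_scale[OF k, of c], of "-1"] by simp
    from this[of 1] this[of \<i>] show ?thesis by (simp add: F_def complex_eq_iff)
  qed
  have "\<exists>T\<in>bounded_ops M N. (\<forall>u\<in>L2 M. L2_norm N (T u) \<le> 1 * L2_norm M u) \<and>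
      (\<forall>h\<in>Gamma M N. pairing M N T h = F h)"
    by (rule functional_representation[where F = F and C = 1, OF Fadd Fscale Fbound zero_le_one])
  then obtain T where T: "T \<in> bounded_ops M N" "\<forall>u\<in>L2 M. L2_norm N (T u) \<le> 1 * L2_norm M u"
    "\<And>h. h \<in> Gamma M N \<Longrightarrow> pairing M N T h = F h"
    by blast
  then show ?thesis
    using Fzero q Lq by (intro bexI[of _ T]) (auto simp: F_def)
qed

text \<open>Take representations of cost below \<open>2^-j\<close>. The functions
  \<open>\<Sum>i. |f j i x|^2\<close> then have integrals summable in \<open>j\<close>, so they tend
  to zero for almost every \<open>x\<close>, and likewise in \<open>y\<close>. Half the sum of the
  two dominates \<open>|q (x, y)|\<close> on \<open>K\<close>, off a marginally null set. Each
  exceptional set lives in one variable, hence the marginal conclusion.\<close>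

lemma qcost_eq_0:
  assumes K: "K \<subseteq> XY" and q: "q \<in> Gamma M N" and 0: "qcost K q = 0"
  shows "marginally_null M N {z \<in> K. q z \<noteq> 0}"
proof -
  have "\<exists>f g. tensor_series M N K f g q \<and> series_cost M N f g < (1/2) ^ j" for j
  proof -
    have "Inf {series_cost M N f g | f g. tensor_series M N K f g q} < (1/2) ^ j"
      using 0 unfolding qcost_def by simp
    then show ?thesis
      unfolding cInf_less_iff[OF qcost_nonempty[OF K q] bdd_below_qcost] by blast
  qed
  then obtain f g where fg: "\<And>j. tensor_series M N K (f j) (g j) q"
    and cost: "\<And>j. series_cost M N (f j) (g j) < (1/2) ^ j" by metis
  have f: "f j i \<in> sq M" and g: "g j i \<in> sq N" and sf: "summable (\<lambda>i. (nrm M (f j i))\<^sup>2)"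
    and sg: "summable (\<lambda>i. (nrm N (g j i))\<^sup>2)" for i j
    using fg[of j] by (auto simp: tensor_series_def)
  have cf: "(\<Sum>i. (nrm M (f j i))\<^sup>2) \<le> 2 * (1/2) ^ j" and cg: "(\<Sum>i. (nrm N (g j i))\<^sup>2) \<le> 2 * (1/2) ^ j" for j
  proof -
    have "(\<Sum>i. (nrm M (f j i))\<^sup>2) + (\<Sum>i. (nrm N (g j i))\<^sup>2) = 2 * series_cost M N (f j) (g j)"
      unfolding series_cost_def suminf_divide[OF summable_add[OF sf sg]]
      by (simp add: suminf_add[OF sf sg])
    moreover have "0 \<le> (\<Sum>i. (nrm M (f j i))\<^sup>2)" "0 \<le> (\<Sum>i. (nrm N (g j i))\<^sup>2)"
      using sf sg by (auto intro: suminf_nonneg)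
    ultimately show "(\<Sum>i. (nrm M (f j i))\<^sup>2) \<le> 2 * (1/2) ^ j" "(\<Sum>i. (nrm N (g j i))\<^sup>2) \<le> 2 * (1/2) ^ j"
      using cost[of j] by linarith+
  qed
  have to0: "AE x in L. (\<lambda>j. \<Sum>i. (cmod (F j i x))\<^sup>2) \<longlonglongrightarrow> 0"
    if F: "\<And>j i. F j i \<in> sq L" and sF: "\<And>j. summable (\<lambda>i. (nrm L (F j i))\<^sup>2)"
      and c: "\<And>j. (\<Sum>i. (nrm L (F j i))\<^sup>2) \<le> 2 * (1/2) ^ j"
    for F :: "nat \<Rightarrow> nat \<Rightarrow> 'c \<Rightarrow> complex" and L
  proof -
    \<comment> \<open>Packs the square sum into one square-integrable function, so that
      \<open>AE_summable_sq\<close> can be applied a second time, now over \<open>j\<close>. The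
      absolute value covers points where the inner series diverges.\<close>
    define G where "G j x = complex_of_real (sqrt \<bar>\<Sum>i. (cmod (F j i x))\<^sup>2\<bar>)" for j x
    have [measurable]: "F j i \<in> borel_measurable L" for j i using F by (rule sq_measurable)
    have G2: "(cmod (G j x))\<^sup>2 = \<bar>\<Sum>i. (cmod (F j i x))\<^sup>2\<bar>" for j x
      by (simp add: G_def)
    have Gs: "G j \<in> sq L" for j
    proof -
      have "G j \<in> borel_measurable L" unfolding G_def by measurable
      moreover have "integrable L (\<lambda>x. (cmod (G j x))\<^sup>2)"
        unfolding G2 using integrable_suminf_sq[OF F sF] by (rule integrable_abs)
      ultimately show ?thesis by (simp add: sq_def)
    qed
    have "(nrm L (G j))\<^sup>2 \<le> 2 * (1/2) ^ j" for j
    proof -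
      have "(nrm L (G j))\<^sup>2 = (\<integral>x. (\<Sum>i. (cmod (F j i x))\<^sup>2) \<partial>L)"
        unfolding nrm_square G2
      proof (rule integral_cong_AE)
        show "AE x in L. \<bar>\<Sum>i. (cmod (F j i x))\<^sup>2\<bar> = (\<Sum>i. (cmod (F j i x))\<^sup>2)"
          using AE_summable_sq[OF F sF, of j] by eventually_elim (simp add: suminf_nonneg)
      qed measurable
      then show ?thesis using integral_suminf_sq[OF F sF, of j] c[of j] by simp
    qed
    then have le: "norm ((nrm L (G j))\<^sup>2) \<le> 2 * (1/2) ^ j" for j
      by (simp only: real_norm_def abs_power2)
    have "summable (\<lambda>j. 2 * (1/2::real) ^ j)"
      by (rule summable_mult, rule summable_geometric) simp
    then have "summable (\<lambda>j. (nrm L (G j))\<^sup>2)"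
      by (rule summable_comparison_test') (rule le)
    from AE_summable_sq[OF Gs this] show ?thesis
    proof eventually_elim
      case (elim x)
      from summable_LIMSEQ_zero[OF this] show ?case
        unfolding G2 by (rule tendsto_rabs_zero_cancel)
    qed
  qed
  have "marginally_null M N (\<Union>j. {z \<in> K. \<not> (\<lambda>i. f j i (fst z) * g j i (snd z)) sums q z})"
    by (intro marginally_null_UN tensor_series_sums fg)
  moreover have "marginally_null M N ({z \<in> K. q z \<noteq> 0} - (\<Union>j. {z \<in> K. \<not> (\<lambda>i. f j i (fst z) * g j i (snd z)) sums q z}))"
  proof (rule marginally_nullI)
    show "AE x in M. (\<lambda>j. \<Sum>i. (cmod (f j i x))\<^sup>2) \<longlonglongrightarrow> 0 \<and> (\<forall>j. summable (\<lambda>i. (cmod (f j i x))\<^sup>2))"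
      using to0[OF f sf cf] AE_summable_sq[OF f sf] by (auto simp: AE_all_countable)
    show "AE y in N. (\<lambda>j. \<Sum>i. (cmod (g j i y))\<^sup>2) \<longlonglongrightarrow> 0 \<and> (\<forall>j. summable (\<lambda>i. (cmod (g j i y))\<^sup>2))"
      using to0[OF g sg cg] AE_summable_sq[OF g sg] by (auto simp: AE_all_countable)
    fix x y
    assume "(x, y) \<in> {z \<in> K. q z \<noteq> 0} - (\<Union>j. {z \<in> K. \<not> (\<lambda>i. f j i (fst z) * g j i (snd z)) sums q z})"
    then have ne: "q (x, y) \<noteq> 0" and s: "\<And>j. (\<lambda>i. f j i x * g j i y) sums q (x, y)" by auto
    assume x: "(\<lambda>j. \<Sum>i. (cmod (f j i x))\<^sup>2) \<longlonglongrightarrow> 0 \<and> (\<forall>j. summable (\<lambda>i. (cmod (f j i x))\<^sup>2))"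
      and y: "(\<lambda>j. \<Sum>i. (cmod (g j i y))\<^sup>2) \<longlonglongrightarrow> 0 \<and> (\<forall>j. summable (\<lambda>i. (cmod (g j i y))\<^sup>2))"
    have le: "cmod (q (x, y)) \<le> ((\<Sum>i. (cmod (f j i x))\<^sup>2) + (\<Sum>i. (cmod (g j i y))\<^sup>2)) / 2" for j
    proof -
      have sx: "summable (\<lambda>i. (cmod (f j i x))\<^sup>2)" and sy: "summable (\<lambda>i. (cmod (g j i y))\<^sup>2)"
        using x y by auto
      have "cmod (q (x, y)) \<le> (\<Sum>i. cmod (f j i x * g j i y))"
        using summable_norm[OF summable_tensor[OF sx sy]] s[of j] by (simp add: sums_iff)
      also have "\<dots> \<le> (\<Sum>i. ((cmod (f j i x))\<^sup>2 + (cmod (g j i y))\<^sup>2) / 2)"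
        by (intro suminf_le norm_mult_le_half_squares summable_tensor sx sy summable_divide summable_add)
      also have "\<dots> = ((\<Sum>i. (cmod (f j i x))\<^sup>2) + (\<Sum>i. (cmod (g j i y))\<^sup>2)) / 2"
        by (simp add: suminf_divide suminf_add sx sy summable_add)
      finally show ?thesis .
    qed
    have "(\<lambda>j. ((\<Sum>i. (cmod (f j i x))\<^sup>2) + (\<Sum>i. (cmod (g j i y))\<^sup>2)) / 2) \<longlonglongrightarrow> (0 + 0) / 2"
      using x y by (intro tendsto_divide tendsto_add tendsto_const) auto
    from LIMSEQ_le_const[OF this] le have "cmod (q (x, y)) \<le> (0 + 0) / 2" by blast
    then show False using ne by simp
  qed (use K in auto)
  ultimately have "marginally_null M N ((\<Union>j. {z \<in> K. \<not> (\<lambda>i. f j i (fst z) * g j i (snd z)) sums q z})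
      \<union> ({z \<in> K. q z \<noteq> 0} - (\<Union>j. {z \<in> K. \<not> (\<lambda>i. f j i (fst z) * g j i (snd z)) sums q z})))"
    by (rule marginally_null_Un)
  then show ?thesis by (rule marginally_null_subset) blast
qed

lemma AE_zero_of_pairing:
  assumes q: "q \<in> Gamma M N" and 0: "\<And>T. T \<in> bounded_ops M N \<Longrightarrow> pairing M N T q = 0"
  shows "AE z in M \<Otimes>\<^sub>M N. q z = 0"
proof -
  have "qcost XY q = 0"
    using duality_attained[OF order_refl q] 0 by force
  from mn_AE[OF qcost_eq_0[OF order_refl q this]] AE_space show ?thesis
    by eventually_elim (auto simp: space_pair_measure)
qed

subsection \<open>The weak* topology\<close>

abbreviation Gtop :: "(('a \<times> 'b \<Rightarrow> complex) \<Rightarrow> complex) topology" where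
  "Gtop \<equiv> product_topology (\<lambda>_. euclidean) (Gamma M N)"

text \<open>The weak* topology is pulled back along this map into a product of complex planes, where
  neighbourhoods and compactness are available.\<close>

definition ev :: "('a, 'b) op \<Rightarrow> ('a \<times> 'b \<Rightarrow> complex) \<Rightarrow> complex" where
  "ev T = (\<lambda>h\<in>Gamma M N. pairing M N T h)"

lemma ev_apply [simp]: "h \<in> Gamma M N \<Longrightarrow> ev T h = pairing M N T h"
  by (simp add: ev_def)

lemma ev_in_topspace [simp]: "ev T \<in> topspace Gtop"
  by (simp add: ev_def)

lemma openin_weak_star:
  "openin (weak_star M N) W \<longleftrightarrow> (\<exists>V. openin Gtop V \<and> W = {T \<in> bounded_ops M N. ev T \<in> V})"
  unfolding weak_star_def openin_pullback_topology ev_def by (auto simp: vimage_def Int_def conj_commute)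

lemma topspace_weak_star: "topspace (weak_star M N) = bounded_ops M N"
  unfolding weak_star_def topspace_pullback_topology by auto

text \<open>A basic open set restricts finitely many coordinates. Exact agreement in those is all
  that separation from a linear subspace has to exploit.\<close>

lemma openin_Gtop_finite:
  assumes V: "openin Gtop V" and x: "x \<in> V"
  obtains H where "finite H" "H \<subseteq> Gamma M N"
    "\<And>y. y \<in> topspace Gtop \<Longrightarrow> (\<forall>h\<in>H. y h = x h) \<Longrightarrow> y \<in> V"
proof -
  obtain U where U: "finite {h \<in> Gamma M N. U h \<noteq> UNIV}" "x \<in> PiE (Gamma M N) U" "PiE (Gamma M N) U \<subseteq> V"
    using V x unfolding openin_product_topology_alt by (auto simp: topspace_euclidean)
  show thesis
  proof (rule that[OF U(1)])
    fix y assume y: "y \<in> topspace Gtop" and eq: "\<forall>h\<in>{h \<in> Gamma M N. U h \<noteq> UNIV}. y h = x h"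
    have "y h \<in> U h" if "h \<in> Gamma M N" for h
      using eq that U(2) by (cases "U h = UNIV") auto
    then have "y \<in> PiE (Gamma M N) U" using y by (auto simp: PiE_iff)
    then show "y \<in> V" using U(3) by blast
  qed auto
qed

text \<open>The finite-dimensional core: the tuples \<open>pairing M N T (h i)\<close> for
  \<open>T\<close> in \<open>U\<close> form a subspace that misses the tuple of \<open>T0\<close>,
  so some combination of the \<open>h i\<close> kills \<open>U\<close> but not \<open>T0\<close>.
  The induction eliminates one coordinate at a time.\<close>

lemma subspace_separation:
  assumes U: "op_subspace M N U" and T0: "T0 \<in> bounded_ops M N"
  shows "(\<And>i. i < (n::nat) \<Longrightarrow> h i \<in> Gamma M N) \<Longrightarrow>
    (\<And>T. T \<in> U \<Longrightarrow> \<exists>i<n. pairing M N T (h i) \<noteq> pairing M N T0 (h i)) \<Longrightarrow>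
    \<exists>k\<in>Gamma M N. (\<forall>T\<in>U. pairing M N T k = 0) \<and> pairing M N T0 k \<noteq> 0"
proof (induction n arbitrary: h)
  case 0
  then show ?case using U unfolding op_subspace_def by blast
next
  case (Suc n)
  have Ub: "T \<in> bounded_ops M N" if "T \<in> U" for T using U that unfolding op_subspace_def by blast
  have Uadd: "op_add M N S T \<in> U" if "S \<in> U" "T \<in> U" for S T using U that unfolding op_subspace_def by blast
  have Usc: "op_scale M N c T \<in> U" if "T \<in> U" for c T using U that unfolding op_subspace_def by blast
  have h: "h i \<in> Gamma M N" if "i < n" for i using Suc.prems(1) that by simp
  have hn: "h n \<in> Gamma M N" using Suc.prems(1) by simp
  show ?case
  proof (cases "\<forall>T\<in>U. pairing M N T (h n) = 0")
    case True
    show ?thesis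
    proof (cases "pairing M N T0 (h n) = 0")
      case T00: True
      show ?thesis
      proof (rule Suc.IH[OF h])
        fix T assume T: "T \<in> U"
        then obtain i where i: "i < Suc n" "pairing M N T (h i) \<noteq> pairing M N T0 (h i)"
          using Suc.prems(2) by blast
        then have "i \<noteq> n" using True T T00 by auto
        then have "i < n" using i(1) by simp
        then show "\<exists>i<n. pairing M N T (h i) \<noteq> pairing M N T0 (h i)" using i(2) by blast
      qed
    qed (use True hn in blast)
  next
    case False
    then obtain S0 where S0: "S0 \<in> U" "pairing M N S0 (h n) \<noteq> 0" by blast
    \<comment> \<open>A pivot with value \<open>1\<close> at \<open>h n\<close>; subtracting
      \<open>c i * h n\<close> from \<open>h i\<close> then gives functions on which
      \<open>S\<close> vanishes.\<close>
    define S where "S = op_scale M N (1 / pairing M N S0 (h n)) S0"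
    have S: "S \<in> U" unfolding S_def by (rule Usc[OF S0(1)])
    have S1: "pairing M N S (h n) = 1"
      unfolding S_def using pairing_op_scale[OF Ub[OF S0(1)] Ub[OF S0(1)] hn Ub[OF Usc[OF S0(1)]]] S0 by simp
    define c where "c i = pairing M N S (h i)" for i
    define h' where "h' i = (\<lambda>z. h i z - c i * h n z)" for i
    have ph': "pairing M N T (h' i) = pairing M N T (h i) - c i * pairing M N T (h n)"
      if "T \<in> bounded_ops M N" "i < n" for T i
      unfolding h'_def using pairing_diff[OF that(1) h[OF that(2)] Gamma_scale[OF hn, of "c i"]]
        pairing_scale[OF that(1) hn] by simp
    show ?thesis
    proof (rule Suc.IH[of h'])
      show "h' i \<in> Gamma M N" if "i < n" for i unfolding h'_def using h[OF that] hn by auto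
      fix T assume T: "T \<in> U"
      show "\<exists>i<n. pairing M N T (h' i) \<noteq> pairing M N T0 (h' i)"
      proof (rule ccontr)
        assume "\<not> ?thesis"
        then have eq: "pairing M N T (h' i) = pairing M N T0 (h' i)" if "i < n" for i using that by blast
        \<comment> \<open>Adding \<open>d\<close> times the pivot corrects the last coordinate of
          \<open>T\<close> and leaves the reduced ones alone, so agreement on the reduced functions
          would give full agreement.\<close>
        define d where "d = pairing M N T0 (h n) - pairing M N T (h n)"
        define T' where "T' = op_add M N T (op_scale M N d S)"
        have T': "T' \<in> U" unfolding T'_def by (intro Uadd Usc T S)
        have pT': "pairing M N T' k = pairing M N T k + d * pairing M N S k" if k: "k \<in> Gamma M N" for k
          unfolding T'_def
          using pairing_op_add[OF Ub[OF T] Ub[OF Usc[OF S]] k Ub[OF Uadd[OF T Usc[OF S]]]]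
            pairing_op_scale[OF Ub[OF S] Ub[OF S] k Ub[OF Usc[OF S]]] by simp
        have "pairing M N T' (h i) = pairing M N T0 (h i)" if "i < Suc n" for i
        proof (cases "i = n")
          case True
          then show ?thesis using pT'[OF hn] S1 by (simp add: d_def)
        next
          case False
          then have i: "i < n" using that by simp
          show ?thesis
            using pT'[OF h[OF i]] eq[OF i] ph'[OF Ub[OF T] i] ph'[OF T0 i]
            by (simp add: d_def algebra_simps flip: c_def)
        qed
        then show False using Suc.prems(2)[OF T'] by blast
      qed
    qed
  qed
qed

text \<open>A weak* neighbourhood of \<open>T0\<close> that avoids \<open>U\<close> tests only
  finitely many pairings, and no member of \<open>U\<close> agrees with \<open>T0\<close> on all of
  them. This leaves the finite-dimensional statement.\<close>

theorem weak_star_bipolar: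
  assumes U: "op_subspace M N U" and cl: "closedin (weak_star M N) U"
    and T0: "T0 \<in> bounded_ops M N" "T0 \<notin> U"
  obtains k where "k \<in> Gamma M N" "\<And>T. T \<in> U \<Longrightarrow> pairing M N T k = 0" "pairing M N T0 k \<noteq> 0"
proof -
  have "openin (weak_star M N) (bounded_ops M N - U)"
    using cl by (simp add: closedin_def topspace_weak_star)
  then obtain V where V: "openin Gtop V" "bounded_ops M N - U = {T \<in> bounded_ops M N. ev T \<in> V}"
    unfolding openin_weak_star by blast
  then have "ev T0 \<in> V" using T0 by blast
  from openin_Gtop_finite[OF V(1) this] obtain H where H: "finite H" "H \<subseteq> Gamma M N"
    "\<And>y. y \<in> topspace Gtop \<Longrightarrow> (\<forall>h\<in>H. y h = ev T0 h) \<Longrightarrow> y \<in> V" by blast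
  obtain h and n :: nat where h: "H = h ` {i. i < n}"
    using finite_imp_nat_seg_image_inj_on[OF H(1)] by blast
  have "\<exists>i<n. pairing M N T (h i) \<noteq> pairing M N T0 (h i)" if T: "T \<in> U" for T
  proof (rule ccontr)
    assume "\<not> ?thesis"
    then have "\<forall>k\<in>H. ev T k = ev T0 k" using H(2) h by auto
    then have "ev T \<in> V" by (intro H(3) ev_in_topspace)
    then have "T \<in> bounded_ops M N - U" using V(2) U T unfolding op_subspace_def by blast
    then show False using T by simp
  qed
  moreover have "h i \<in> Gamma M N" if "i < n" for i using h H(2) that by auto
  ultimately have "\<exists>k\<in>Gamma M N. (\<forall>T\<in>U. pairing M N T k = 0) \<and> pairing M N T0 k \<noteq> 0"
    by (intro subspace_separation[OF U T0(1), of n h])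
  then show thesis using that by blast
qed

text \<open>Banach-Alaoglu for a bounded sequence: the pairings lie in a product of discs, compact
  by Tychonoff, and a cluster point there inherits linearity and the bound, hence is an operator.
  The index set \<open>J\<close> lets the cluster point be taken along a chosen subsequence.\<close>

theorem weak_star_cluster_point:
  fixes S :: "nat \<Rightarrow> ('a, 'b) op"
  assumes S: "\<And>n. S n \<in> bounded_ops M N" and C: "0 \<le> C"
    and B: "\<And>n. bounded_form M N C (form M N (S n))" and J: "infinite J"
  obtains T where "T \<in> bounded_ops M N"
    "\<And>W m. openin (weak_star M N) W \<Longrightarrow> T \<in> W \<Longrightarrow> \<exists>n\<in>J. m \<le> n \<and> S n \<in> W"
proof -
  define K where "K = PiE (Gamma M N) (\<lambda>h. cball (0::complex) (C * Gamma_norm M N h))"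
  have K: "compactin Gtop K"
    unfolding K_def compactin_PiE by auto
  have SK: "ev (S n) \<in> K" for n
    unfolding K_def using pairing_le_Gamma_norm[OF S B C] by (auto simp: ev_def)
  \<comment> \<open>The closed tails along \<open>J\<close> are nested, so they have the finite
    intersection property.\<close>
  define Cl where "Cl (m::nat) = Gtop closure_of {ev (S n) | n. n \<in> J \<and> m \<le> n}" for m
  have "K \<inter> \<Inter>(range Cl) \<noteq> {}"
  proof (rule compactin_fip[THEN iffD1, OF K, THEN conjunct2, rule_format], intro conjI ballI allI impI)
    show "closedin Gtop X" if "X \<in> range Cl" for X using that by (auto simp: Cl_def)
    fix \<F> assume F: "finite \<F> \<and> \<F> \<subseteq> range Cl"
    then obtain I where I: "finite I" "\<F> = Cl ` I" by (meson finite_subset_image)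
    obtain n where n: "n \<in> J" "Max (insert 0 I) \<le> n"
      using J by (meson infinite_nat_iff_unbounded_le)
    have "ev (S n) \<in> Cl m" if "m \<in> I" for m
    proof -
      have "m \<le> Max (insert 0 I)" using I that by (intro Max_ge) auto
      then have "m \<le> n" using n by simp
      then have "ev (S n) \<in> {ev (S n) | n. n \<in> J \<and> m \<le> n}" using n by blast
      then show ?thesis unfolding Cl_def in_closure_of using ev_in_topspace by blast
    qed
    then show "K \<inter> \<Inter>\<F> \<noteq> {}" using SK I by blast
  qed
  then obtain \<xi> where \<xi>K: "\<xi> \<in> K" and \<xi>C: "\<And>m. \<xi> \<in> Cl m" by blast
  have near: "\<exists>n\<in>J. m \<le> n \<and> ev (S n) \<in> V" if "openin Gtop V" "\<xi> \<in> V" for V m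
    using \<xi>C[of m] that unfolding Cl_def in_closure_of by blast
  \<comment> \<open>Any finite set of coordinates of \<xi> can be approximated by a single
    \<open>S n\<close>; algebraic identities involve only finitely many coordinates and therefore
    pass to \<xi>.\<close>
  have approx: "\<exists>n. \<forall>h\<in>H. cmod (pairing M N (S n) h - \<xi> h) < \<epsilon>"
    if H: "finite H" "H \<subseteq> Gamma M N" and \<epsilon>: "0 < \<epsilon>" for H \<epsilon>
  proof -
    let ?U = "\<lambda>h. if h \<in> H then ball (\<xi> h) \<epsilon> else UNIV"
    have "openin Gtop (PiE (Gamma M N) ?U)"
      by (rule openin_PiE_gen[THEN iffD2]) (use H in auto)
    moreover have "\<xi> \<in> PiE (Gamma M N) ?U"
      using \<xi>K \<epsilon> by (auto simp: K_def PiE_iff)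
    ultimately obtain n where "ev (S n) \<in> PiE (Gamma M N) ?U" using near by blast
    then have "pairing M N (S n) h \<in> ball (\<xi> h) \<epsilon>" if "h \<in> H" for h
      using that H(2) by (auto simp: PiE_iff split: if_splits dest!: bspec[where x = h])
    then show ?thesis by (auto simp: dist_norm norm_minus_commute)
  qed
  have zero: "x = 0" if x: "\<And>\<epsilon>. 0 < \<epsilon> \<Longrightarrow> cmod x \<le> c * \<epsilon>" and c: "0 \<le> c" for x c
  proof -
    have "cmod x \<le> 0 + e" if "0 < e" for e
    proof -
      have "cmod x \<le> c * (e / (c + 1))" using \<open>0 < e\<close> c by (intro x) simp
      also have "\<dots> \<le> e" using \<open>0 < e\<close> c by (simp add: field_simps)
      finally show ?thesis by simp
    qed
    then have "cmod x \<le> 0" by (rule field_le_epsilon)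
    then show ?thesis by simp
  qed
  have \<xi>add: "\<xi> (\<lambda>z. h z + k z) = \<xi> h + \<xi> k" if h: "h \<in> Gamma M N" and k: "k \<in> Gamma M N" for h k
  proof -
    have "\<xi> (\<lambda>z. h z + k z) - (\<xi> h + \<xi> k) = 0"
    proof (rule zero[where c = 3])
      fix \<epsilon> :: real assume "0 < \<epsilon>"
      then obtain n where "\<forall>g\<in>{h, k, \<lambda>z. h z + k z}. cmod (pairing M N (S n) g - \<xi> g) < \<epsilon>"
        using approx[of "{h, k, \<lambda>z. h z + k z}" \<epsilon>] h k by auto
      then have *: "cmod (pairing M N (S n) h - \<xi> h) < \<epsilon>" "cmod (pairing M N (S n) k - \<xi> k) < \<epsilon>"
        "cmod (pairing M N (S n) (\<lambda>z. h z + k z) - \<xi> (\<lambda>z. h z + k z)) < \<epsilon>" by auto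
      have "\<xi> (\<lambda>z. h z + k z) - (\<xi> h + \<xi> k)
          = ((pairing M N (S n) h - \<xi> h) + (pairing M N (S n) k - \<xi> k))
            - (pairing M N (S n) (\<lambda>z. h z + k z) - \<xi> (\<lambda>z. h z + k z))"
        using pairing_add[OF S h k] by simp
      also have "cmod \<dots> \<le> (cmod (pairing M N (S n) h - \<xi> h) + cmod (pairing M N (S n) k - \<xi> k))
            + cmod (pairing M N (S n) (\<lambda>z. h z + k z) - \<xi> (\<lambda>z. h z + k z))"
        by (intro order_trans[OF norm_triangle_ineq4] add_right_mono norm_triangle_ineq)
      finally show "cmod (\<xi> (\<lambda>z. h z + k z) - (\<xi> h + \<xi> k)) \<le> 3 * \<epsilon>" using * by linarith
    qed simp
    then show ?thesis by simp
  qed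
  have \<xi>scale: "\<xi> (\<lambda>z. c * h z) = c * \<xi> h" if h: "h \<in> Gamma M N" for c h
  proof -
    have "\<xi> (\<lambda>z. c * h z) - c * \<xi> h = 0"
    proof (rule zero[where c = "cmod c + 1"])
      fix \<epsilon> :: real assume "0 < \<epsilon>"
      then obtain n where "\<forall>g\<in>{h, \<lambda>z. c * h z}. cmod (pairing M N (S n) g - \<xi> g) < \<epsilon>"
        using approx[of "{h, \<lambda>z. c * h z}" \<epsilon>] h by auto
      then have *: "cmod (pairing M N (S n) h - \<xi> h) < \<epsilon>"
        "cmod (pairing M N (S n) (\<lambda>z. c * h z) - \<xi> (\<lambda>z. c * h z)) < \<epsilon>" by auto
      have "\<xi> (\<lambda>z. c * h z) - c * \<xi> h
          = c * (pairing M N (S n) h - \<xi> h) - (pairing M N (S n) (\<lambda>z. c * h z) - \<xi> (\<lambda>z. c * h z))"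
        using pairing_scale[OF S h] by (simp add: algebra_simps)
      also have "cmod \<dots> \<le> cmod c * cmod (pairing M N (S n) h - \<xi> h)
          + cmod (pairing M N (S n) (\<lambda>z. c * h z) - \<xi> (\<lambda>z. c * h z))"
        using norm_triangle_ineq4 by (metis norm_mult)
      also have "\<dots> \<le> cmod c * \<epsilon> + \<epsilon>" using * by (intro add_mono mult_left_mono) auto
      finally show "cmod (\<xi> (\<lambda>z. c * h z) - c * \<xi> h) \<le> (cmod c + 1) * \<epsilon>" by (simp add: algebra_simps)
    qed simp
    then show ?thesis by simp
  qed
  have \<xi>bound: "cmod (\<xi> h) \<le> C * series_cost M N f g" if h: "tensor_series M N XY f g h" for f g h
  proof -
    have "cmod (\<xi> h) \<le> C * Gamma_norm M N h"
      using \<xi>K GammaI[OF h] by (auto simp: K_def PiE_iff)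
    also have "\<dots> \<le> C * series_cost M N f g"
      by (intro mult_left_mono Gamma_norm_le_cost h C)
    finally show ?thesis .
  qed
  have "\<exists>T\<in>bounded_ops M N. (\<forall>u\<in>L2 M. L2_norm N (T u) \<le> C * L2_norm M u) \<and>
      (\<forall>h\<in>Gamma M N. pairing M N T h = \<xi> h)"
    by (rule functional_representation[where F = \<xi>, OF \<xi>add \<xi>scale \<xi>bound C])
  then obtain T where T: "T \<in> bounded_ops M N" "\<And>h. h \<in> Gamma M N \<Longrightarrow> pairing M N T h = \<xi> h" by blast
  have evT: "ev T = \<xi>"
  proof
    fix h show "ev T h = \<xi> h"
      using T(2) \<xi>K by (cases "h \<in> Gamma M N") (auto simp: ev_def K_def PiE_iff extensional_def)
  qed
  show thesis
  proof (rule that[OF T(1)])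
    fix W m assume "openin (weak_star M N) W" "T \<in> W"
    then obtain V where V: "openin Gtop V" "W = {T \<in> bounded_ops M N. ev T \<in> V}" "\<xi> \<in> V"
      unfolding openin_weak_star evT[symmetric] by blast
    then show "\<exists>n\<in>J. m \<le> n \<and> S n \<in> W" using near[of V m] S by auto
  qed
qed

end

subsection \<open>Functions vanishing near the support\<close>

text \<open>Outer regularity makes the sets \<open>A i\<close> relatively open outside small sets (as in Lusin's
  theorem); inner regularity then provides compact sets.\<close>

lemma standard_compact_exhaustion:
  assumes std: "standard_measure_space M" and A: "\<And>i::nat. A i \<in> sets M" and P: "AE x in M. P x"
  shows "\<exists>T K. (\<forall>r::nat. K r \<in> sets M \<and> compactin T (K r) \<and> (\<forall>x\<in>K r. P x) \<and>
      (\<forall>i. \<exists>U. openin T U \<and> A i \<inter> K r = U \<inter> K r)) \<and>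
    (AE x in M. \<forall>\<^sub>F r in sequentially. x \<in> K r)"
proof -
  obtain T where T: "topspace T = space M" "completely_metrizable_space T"
    and sT: "sets M = sigma_sets (topspace T) {U. openin T U}"
    and outer: "\<And>B. B \<in> sets M \<Longrightarrow> emeasure M B = (INF U\<in>{U. openin T U \<and> B \<subseteq> U}. emeasure M U)"
    and inner: "\<And>B. B \<in> sets M \<Longrightarrow> emeasure M B = (SUP K\<in>{K. compactin T K \<and> K \<subseteq> B}. emeasure M K)"
    using std unfolding standard_measure_space_def by blast
  interpret sigma_finite_measure M using std unfolding standard_measure_space_def by blast
  have openM: "U \<in> sets M" if "openin T U" for U
    using that unfolding sT by (intro sigma_sets.Basic) simp
  have "Hausdorff_space T"
    using T(2) completely_metrizable_imp_metrizable_space metrizable_imp_Hausdorff_space by blast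
  then have compM: "K \<in> sets M" if "compactin T K" for K
  proof -
    have "closedin T K" using that \<open>Hausdorff_space T\<close> by (simp add: compactin_imp_closedin)
    then have "openin T (space M - K)" "K \<subseteq> space M" using T(1) by (auto simp: closedin_def)
    then have "space M - (space M - K) \<in> sets M" "space M - (space M - K) = K"
      using sets.compl_sets[OF openM] by blast+
    then show ?thesis by simp
  qed
  obtain X where X: "range X \<subseteq> sets M" "(\<Union>i. X i) = space M" "\<And>i::nat. emeasure M (X i) \<noteq> \<infinity>" "incseq X"
    by (rule sigma_finite_incseq) auto
  have Xm [measurable]: "X r \<in> sets M" for r using X(1) by auto
  obtain Z where Z: "Z \<in> null_sets M" "{x \<in> space M. \<not> P x} \<subseteq> Z"
    using P unfolding eventually_ae_filter by auto
  have [measurable]: "Z \<in> sets M" "A i \<in> sets M" for i using Z A by auto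
  \<comment> \<open>For fixed \<open>r\<close> these add up over \<open>i\<close> to
    \<open>2^-r\<close>.\<close>
  define \<epsilon> :: "nat \<Rightarrow> nat \<Rightarrow> ennreal" where "\<epsilon> r i = ennreal ((1/2) ^ (r + Suc i))" for r i
  have "\<exists>U. openin T U \<and> A i \<inter> X r \<subseteq> U \<and> emeasure M (U - A i \<inter> X r) \<le> \<epsilon> r i" for r i
  proof -
    have fin: "emeasure M (A i \<inter> X r) \<noteq> \<infinity>"
      using emeasure_mono[of "A i \<inter> X r" "X r" M] X(3)[of r] Xm by (auto simp: top_unique)
    have "(INF U\<in>{U. openin T U \<and> A i \<inter> X r \<subseteq> U}. emeasure M U) = emeasure M (A i \<inter> X r) + 0"
      using outer[of "A i \<inter> X r"] by simp
    also have "\<dots> < emeasure M (A i \<inter> X r) + \<epsilon> r i"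
      unfolding ennreal_add_left_cancel_less using fin by (simp add: \<epsilon>_def)
    finally have "(INF U\<in>{U. openin T U \<and> A i \<inter> X r \<subseteq> U}. emeasure M U) < emeasure M (A i \<inter> X r) + \<epsilon> r i" .
    then obtain U where U: "openin T U" "A i \<inter> X r \<subseteq> U" "emeasure M U < emeasure M (A i \<inter> X r) + \<epsilon> r i"
      by (auto simp: INF_less_iff)
    have "emeasure M (U - A i \<inter> X r) = emeasure M U - emeasure M (A i \<inter> X r)"
      using U openM[OF U(1)] fin by (intro emeasure_Diff) auto
    also have "\<dots> \<le> \<epsilon> r i"
      using U(3) fin by (subst ennreal_minus_le_iff) (auto simp: less_top)
    finally show ?thesis using U by blast
  qed
  then have "\<exists>U. \<forall>r i. openin T (U r i) \<and> A i \<inter> X r \<subseteq> U r i \<and> emeasure M (U r i - A i \<inter> X r) \<le> \<epsilon> r i"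
    by (intro choice allI)
  then obtain U where U: "\<And>r i. openin T (U r i)" "\<And>r i. A i \<inter> X r \<subseteq> U r i"
    "\<And>r i. emeasure M (U r i - A i \<inter> X r) \<le> \<epsilon> r i" by blast
  have [measurable]: "U r i \<in> sets M" for r i by (rule openM[OF U(1)])
  \<comment> \<open>On \<open>D r\<close> every \<open>A i\<close> has the same trace as the open
    set \<open>U r i\<close>, since the excess of \<open>U r i\<close> has been removed; removing
    \<open>Z\<close> makes \<open>P\<close> hold everywhere on it.\<close>
  define D where "D r = X r - Z - (\<Union>i. U r i - A i \<inter> X r)" for r
  have Dm [measurable]: "D r \<in> sets M" for r unfolding D_def by measurable
  have Dfin: "emeasure M (D r) \<noteq> \<infinity>" for r
  proof -
    have "D r \<subseteq> X r" by (auto simp: D_def)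
    from emeasure_mono[OF this Xm] X(3)[of r] show ?thesis by (auto simp: top_unique)
  qed
  have "\<exists>K. compactin T K \<and> K \<subseteq> D r \<and> emeasure M (D r - K) \<le> ennreal ((1/2) ^ r)" for r
  proof -
    \<comment> \<open>Inner regularity enters through a value strictly below the measure of
      \<open>D r\<close>, which exists only if that measure is positive; a null \<open>D r\<close>
      gets the empty compact set.\<close>
    have "\<exists>K. compactin T K \<and> K \<subseteq> D r \<and> emeasure M (D r) \<le> emeasure M K + ennreal ((1/2) ^ r)"
    proof (cases "emeasure M (D r) = 0")
      case True
      then show ?thesis by (intro exI[of _ "{}"]) auto
    next
      case False
      have "emeasure M (D r) - ennreal ((1/2) ^ r) < emeasure M (D r)"
      proof (rule ennreal_between)
        show "0 < emeasure M (D r)" using False by (simp only: zero_less_iff_neq_zero not_False_eq_True)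
        show "emeasure M (D r) < top" using Dfin[of r] by (simp only: less_top[symmetric] infinity_ennreal_def not_False_eq_True)
      qed simp
      also have "\<dots> = (SUP K\<in>{K. compactin T K \<and> K \<subseteq> D r}. emeasure M K)" by (rule inner[OF Dm])
      finally obtain K where K: "compactin T K" "K \<subseteq> D r" "emeasure M (D r) - ennreal ((1/2) ^ r) < emeasure M K"
        by (auto simp: less_SUP_iff)
      from less_imp_le[OF K(3)] have "emeasure M (D r) \<le> ennreal ((1/2) ^ r) + emeasure M K"
        unfolding ennreal_minus_le_iff by (rule conjunct1)
      then have "emeasure M (D r) \<le> emeasure M K + ennreal ((1/2) ^ r)"
        by (simp only: add.commute)
      then show ?thesis using K by blast
    qed
    then obtain K where K: "compactin T K" "K \<subseteq> D r" "emeasure M (D r) \<le> emeasure M K + ennreal ((1/2) ^ r)"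
      by blast
    have Kfin: "emeasure M K \<noteq> \<infinity>"
      using emeasure_mono[OF K(2) Dm] Dfin[of r] by (auto simp: top_unique)
    have "emeasure M (D r - K) = emeasure M (D r) - emeasure M K"
      using K compM[OF K(1)] Kfin by (intro emeasure_Diff) auto
    also have "\<dots> \<le> ennreal ((1/2) ^ r)"
      using K(3) Kfin by (subst ennreal_minus_le_iff) auto
    finally show ?thesis using K by blast
  qed
  then have "\<exists>K. \<forall>r. compactin T (K r) \<and> K r \<subseteq> D r \<and> emeasure M (D r - K r) \<le> ennreal ((1/2) ^ r)"
    by (intro choice allI)
  then obtain K where K: "\<And>r. compactin T (K r)" "\<And>r. K r \<subseteq> D r" "\<And>r. emeasure M (D r - K r) \<le> ennreal ((1/2) ^ r)"
    by blast
  have Km [measurable]: "K r \<in> sets M" for r by (rule compM[OF K(1)])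
  have small: "emeasure M (X r - K r) \<le> ennreal (2 * (1/2) ^ r)" for r
  proof -
    have "emeasure M (\<Union>i. U r i - A i \<inter> X r) \<le> (\<Sum>i. emeasure M (U r i - A i \<inter> X r))"
      by (rule emeasure_subadditive_countably) auto
    also have "\<dots> \<le> (\<Sum>i. \<epsilon> r i)" by (intro suminf_le U(3)) auto
    also have "\<dots> = ennreal ((1/2) ^ r)"
    proof -
      have "(\<lambda>i. (1/2) ^ r * (1/2::real) ^ Suc i) sums ((1/2) ^ r * 1)"
        by (intro sums_mult power_half_series)
      then have s: "(\<lambda>i. (1/2::real) ^ (r + Suc i)) sums ((1/2) ^ r)" by (simp add: power_add)
      then have "(\<Sum>i. ennreal ((1/2) ^ (r + Suc i))) = ennreal (\<Sum>i. (1/2) ^ (r + Suc i))"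
        by (intro suminf_ennreal2) (auto simp: sums_iff)
      then show ?thesis using s by (simp add: \<epsilon>_def sums_iff)
    qed
    finally have small_U: "emeasure M (\<Union>i. U r i - A i \<inter> X r) \<le> ennreal ((1/2) ^ r)" .
    have "X r - K r \<subseteq> (D r - K r) \<union> (Z \<union> (\<Union>i. U r i - A i \<inter> X r))" by (auto simp: D_def)
    then have "emeasure M (X r - K r) \<le> emeasure M ((D r - K r) \<union> (Z \<union> (\<Union>i. U r i - A i \<inter> X r)))"
      by (rule emeasure_mono) measurable
    also have "\<dots> \<le> emeasure M (D r - K r) + emeasure M (Z \<union> (\<Union>i. U r i - A i \<inter> X r))"
      by (rule emeasure_subadditive) measurable
    also have "\<dots> \<le> emeasure M (D r - K r) + (emeasure M Z + emeasure M (\<Union>i. U r i - A i \<inter> X r))"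
      by (rule add_left_mono, rule emeasure_subadditive) measurable
    also have "\<dots> \<le> ennreal ((1/2) ^ r) + (0 + ennreal ((1/2) ^ r))"
      using Z(1) by (intro add_mono K(3) small_U) (simp add: null_setsD1)
    also have "\<dots> = ennreal (2 * (1/2) ^ r)" by (simp flip: ennreal_plus)
    finally show ?thesis .
  qed
  have fin: "emeasure M (X r - K r) < \<infinity>" for r
    using small[of r] by (rule order_le_less_trans) simp
  have gs: "summable (\<lambda>r. 2 * (1/2::real) ^ r)"
    by (rule summable_mult, rule summable_geometric) simp
  have "summable (\<lambda>r. measure M (X r - K r))"
  proof (rule summable_comparison_test'[OF gs])
    fix r show "norm (measure M (X r - K r)) \<le> 2 * (1/2) ^ r"
      using small[of r] by (simp add: measure_def enn2real_leI)
  qed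
  \<comment> \<open>Borel-Cantelli: almost every point lies in only finitely many
    \<open>X r - K r\<close>. As the \<open>X r\<close> increase to the whole space, it lies in
    \<open>K r\<close> from some index on.\<close>
  from borel_cantelli_AE1[OF _ fin this]
  have "AE x in M. \<forall>\<^sub>F r in sequentially. x \<in> space M - (X r - K r)" by simp
  then have AEK: "AE x in M. \<forall>\<^sub>F r in sequentially. x \<in> K r"
    using AE_space
  proof eventually_elim
    case (elim x)
    then obtain r0 where "x \<in> X r0" using X(2) by blast
    then have "\<forall>\<^sub>F r in sequentially. x \<in> X r"
      using X(4) by (intro eventually_sequentiallyI[of r0]) (auto dest: incseqD)
    with elim(1) show ?case by eventually_elim auto
  qed
  show ?thesis
  proof (intro exI[of _ T] exI[of _ K] conjI allI ballI Km K(1) AEK)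
    show "P x" if "x \<in> K r" for r x
      using that K(2)[of r] Z sets.sets_into_space[OF Xm[of r]] by (auto simp: D_def)
    show "\<exists>V. openin T V \<and> A i \<inter> K r = V \<inter> K r" for r i
      using K(2)[of r] U(1)[of r i] U(2)[of i r] by (intro exI[of _ "U r i"]) (auto simp: D_def)
  qed
qed

text \<open>Each rectangle has the same trace on \<open>K \<times> L\<close> as an open one, so
  compactness of the product applies although the rectangles themselves are merely
  measurable.\<close>

lemma finite_subcover_rectangles:
  assumes K: "compactin S K" and L: "compactin T L"
    and A: "\<And>i::nat. \<exists>U. openin S U \<and> A i \<inter> K = U \<inter> K" and B: "\<And>i. \<exists>V. openin T V \<and> B i \<inter> L = V \<inter> L"
    and cover: "K \<times> L \<subseteq> (\<Union>i. A i \<times> B i)"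
  shows "\<exists>n. K \<times> L \<subseteq> (\<Union>i<n. A i \<times> B i)"
proof -
  obtain U where U: "\<And>i. openin S (U i)" "\<And>i. A i \<inter> K = U i \<inter> K" using A by metis
  obtain V where V: "\<And>i. openin T (V i)" "\<And>i. B i \<inter> L = V i \<inter> L" using B by metis
  have eq: "(A i \<times> B i) \<inter> (K \<times> L) = (U i \<times> V i) \<inter> (K \<times> L)" for i
    using U(2)[of i] V(2)[of i] by blast
  have "compactin (prod_topology S T) (K \<times> L)"
    using K L by (simp add: compactin_Times)
  moreover have "openin (prod_topology S T) X" if "X \<in> range (\<lambda>i. U i \<times> V i)" for X
    using that U(1) V(1) by (auto intro: openin_prod_Times_iff[THEN iffD2])
  moreover have "K \<times> L \<subseteq> \<Union>(range (\<lambda>i. U i \<times> V i))"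
  proof
    fix z assume z: "z \<in> K \<times> L"
    then obtain i where "z \<in> A i \<times> B i" using cover by blast
    then have "z \<in> U i \<times> V i" using z eq[of i] by blast
    then show "z \<in> \<Union>(range (\<lambda>i. U i \<times> V i))" by blast
  qed
  ultimately obtain \<F> where F: "finite \<F>" "\<F> \<subseteq> range (\<lambda>i. U i \<times> V i)" "K \<times> L \<subseteq> \<Union>\<F>"
    unfolding compactin_def by meson
  then obtain I where I: "finite I" "\<F> = (\<lambda>i. U i \<times> V i) ` I" by (meson finite_subset_image)
  obtain n where n: "I \<subseteq> {..<n}" using finite_nat_iff_bounded I(1) by blast
  show ?thesis
  proof (intro exI[of _ n] subsetI)
    fix z assume z: "z \<in> K \<times> L"
    then obtain i where "i \<in> I" "z \<in> U i \<times> V i" using F(3) I(2) by blast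
    then show "z \<in> (\<Union>i<n. A i \<times> B i)" using z eq[of i] n by blast
  qed
qed

lemma nrm_indicator_tendsto:
  assumes f: "f \<in> sq M" and K: "\<And>r::nat. K r \<in> sets M" and AE: "AE x in M. \<forall>\<^sub>F r in sequentially. x \<in> K r"
  shows "(\<lambda>r. nrm M (\<lambda>x. f x - indicator (K r) x * f x)) \<longlonglongrightarrow> 0"
proof -
  have [measurable]: "f \<in> borel_measurable M" "K r \<in> sets M" for r using f K by (auto intro: sq_measurable)
  have "(\<lambda>r. \<integral>x. (cmod (f x - indicator (K r) x * f x))\<^sup>2 \<partial>M) \<longlonglongrightarrow> (\<integral>x. 0 \<partial>M)"
  proof (rule integral_dominated_convergence[where w = "\<lambda>x. (cmod (f x))\<^sup>2"])
    show "AE x in M. (\<lambda>r. (cmod (f x - indicator (K r) x * f x))\<^sup>2) \<longlonglongrightarrow> 0"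
      using AE
    proof eventually_elim
      case (elim x)
      then have "\<forall>\<^sub>F r in sequentially. (cmod (f x - indicator (K r) x * f x))\<^sup>2 = 0"
        by eventually_elim simp
      then show ?case by (rule tendsto_eventually)
    qed
    show "AE x in M. norm ((cmod (f x - indicator (K r) x * f x))\<^sup>2) \<le> (cmod (f x))\<^sup>2" for r
      by (rule AE_I2) (auto simp: indicator_def)
  qed (use f in \<open>auto intro: sq_integrable\<close>)
  from tendsto_real_sqrt[OF this] show ?thesis by (simp add: nrm_def)
qed

section \<open>Reduction to compact rectangles\<close>

context L2_pair begin

text \<open>Dominated convergence gives each term of the series; the bounds
  \<open>C * nrm M (f i) * nrm N (g i)\<close> do not depend on \<open>r\<close>, so Tannery's
  theorem allows the limit under the sum.\<close>

lemma pairing_indicator_tendsto: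
  assumes T: "T \<in> bounded_ops M N" and h: "h \<in> Gamma M N"
    and K: "\<And>r. K r \<in> sets M" "AE x in M. \<forall>\<^sub>F r in sequentially. x \<in> K r"
    and L: "\<And>r. L r \<in> sets N" "AE y in N. \<forall>\<^sub>F r in sequentially. y \<in> L r"
  shows "(\<lambda>r. pairing M N T (\<lambda>z. indicator (K r \<times> L r) z * h z)) \<longlonglongrightarrow> pairing M N T h"
proof -
  obtain f g where fg: "tensor_series M N XY f g h" using h by (rule GammaE)
  then have f: "f i \<in> sq M" and g: "g i \<in> sq N" for i by (auto simp: tensor_series_def)
  obtain C where C: "0 \<le> C" and B: "bounded_form M N C (form M N T)" using bounded_form_ex[OF T] by metis
  let ?B = "form M N T" and ?f = "\<lambda>r i x. indicator (K r) x * f i x" and ?g = "\<lambda>r i y. indicator (L r) y * g i y"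
  have f': "?f r i \<in> sq M" and g': "?g r i \<in> sq N" for r i using f g K L by auto
  have nf: "nrm M (?f r i) \<le> nrm M (f i)" for r i by (rule nrm_mono[OF f' f]) (auto simp: indicator_def)
  have ng: "nrm N (?g r i) \<le> nrm N (g i)" for r i by (rule nrm_mono[OF g' g]) (auto simp: indicator_def)
  have lim: "(\<lambda>r. ?B (?f r i) (?g r i)) \<longlonglongrightarrow> ?B (f i) (g i)" for i
  proof -
    have "(\<lambda>r. ?B (f i) (g i) - ?B (?f r i) (?g r i)) \<longlonglongrightarrow> 0"
    proof (rule Lim_null_comparison)
      show "\<forall>\<^sub>F r in sequentially. norm (?B (f i) (g i) - ?B (?f r i) (?g r i))
          \<le> C * (nrm M (\<lambda>x. f i x - ?f r i x) * nrm N (g i)) + C * (nrm M (f i) * nrm N (\<lambda>y. g i y - ?g r i y))"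
      proof (rule always_eventually, rule allI)
        fix r
        have 1: "?B (\<lambda>x. f i x - ?f r i x) (g i) = ?B (f i) (g i) - ?B (?f r i) (g i)"
          by (rule bounded_form_diff_left[OF B f f' g])
        have 2: "?B (?f r i) (\<lambda>y. g i y - ?g r i y) = ?B (?f r i) (g i) - ?B (?f r i) (?g r i)"
          by (rule bounded_form_diff_right[OF B f' g g'])
        have eq: "?B (f i) (g i) - ?B (?f r i) (?g r i)
            = ?B (\<lambda>x. f i x - ?f r i x) (g i) + ?B (?f r i) (\<lambda>y. g i y - ?g r i y)"
          unfolding 1 2 by simp
        have b1: "norm (?B (\<lambda>x. f i x - ?f r i x) (g i)) \<le> C * (nrm M (\<lambda>x. f i x - ?f r i x) * nrm N (g i))"
          by (rule bounded_form_bound[OF B sq_diff[OF f f'] g])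
        have b2: "norm (?B (?f r i) (\<lambda>y. g i y - ?g r i y)) \<le> C * (nrm M (?f r i) * nrm N (\<lambda>y. g i y - ?g r i y))"
          by (rule bounded_form_bound[OF B f' sq_diff[OF g g']])
        have b3: "C * (nrm M (?f r i) * nrm N (\<lambda>y. g i y - ?g r i y)) \<le> C * (nrm M (f i) * nrm N (\<lambda>y. g i y - ?g r i y))"
          by (rule mult_left_mono[OF mult_right_mono[OF nf nrm_nonneg] C])
        show "norm (?B (f i) (g i) - ?B (?f r i) (?g r i))
          \<le> C * (nrm M (\<lambda>x. f i x - ?f r i x) * nrm N (g i)) + C * (nrm M (f i) * nrm N (\<lambda>y. g i y - ?g r i y))"
          unfolding eq by (rule order_trans[OF norm_triangle_ineq add_mono[OF b1 order_trans[OF b2 b3]]])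
      qed
      have "(\<lambda>r. C * (nrm M (\<lambda>x. f i x - ?f r i x) * nrm N (g i)) + C * (nrm M (f i) * nrm N (\<lambda>y. g i y - ?g r i y)))
          \<longlonglongrightarrow> C * (0 * nrm N (g i)) + C * (nrm M (f i) * 0)"
        by (intro tendsto_add tendsto_mult tendsto_const nrm_indicator_tendsto f g K L)
      then show "(\<lambda>r. C * (nrm M (\<lambda>x. f i x - ?f r i x) * nrm N (g i)) + C * (nrm M (f i) * nrm N (\<lambda>y. g i y - ?g r i y)))
          \<longlonglongrightarrow> 0" by simp
    qed
    from tendsto_diff[OF tendsto_const[of "?B (f i) (g i)"] this] show ?thesis by simp
  qed
  have bound: "norm (?B (?f r i) (?g r i)) \<le> C * (nrm M (f i) * nrm N (g i))" for r i
    by (rule order_trans[OF bounded_form_bound[OF B f' g'] mult_left_mono[OF mult_mono[OF nf ng nrm_nonneg nrm_nonneg] C]])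
  have "(\<lambda>r. \<Sum>i. ?B (?f r i) (?g r i)) \<longlonglongrightarrow> (\<Sum>i. ?B (f i) (g i))"
    using tannerys_theorem[of "\<lambda>i r. ?B (?f r i) (?g r i)" "\<lambda>i. ?B (f i) (g i)" sequentially,
        OF lim _ summable_mult[OF tensor_series_summable_mult[OF fg], of C]] bound
    by (auto simp: always_eventually)
  moreover have "pairing M N T (\<lambda>z. indicator (K r \<times> L r) z * h z) = (\<Sum>i. ?B (?f r i) (?g r i))" for r
    using pairing_sums[OF T tensor_series_indicator[OF fg K(1) L(1)], of r r] by (simp add: sums_iff)
  moreover have "pairing M N T h = (\<Sum>i. ?B (f i) (g i))"
    using pairing_sums[OF T fg] by (simp add: sums_iff)
  ultimately show ?thesis by simp
qed

text \<open>Rectangles are cut away one at a time. Each cut subtracts a function with zero pairing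
  and preserves membership in the predual and vanishing on \<open>E\<close>, so \<open>good\<close>
  applies again; after \<open>n\<close> cuts nothing is left.\<close>

lemma pairing_eq_0_finite_cover:
  assumes T: "T \<in> bounded_ops M N" and R: "\<And>i::nat. A i \<in> sets M \<and> B i \<in> sets N"
    and good: "\<And>i k. k \<in> Gamma M N \<Longrightarrow> (AE z in M \<Otimes>\<^sub>M N. z \<in> E \<longrightarrow> k z = 0)
      \<Longrightarrow> pairing M N T (\<lambda>z. indicator (A i \<times> B i) z * k z) = 0"
    and k: "k \<in> Gamma M N" "AE z in M \<Otimes>\<^sub>M N. z \<in> E \<longrightarrow> k z = 0"
    and supp: "\<And>z. k z \<noteq> 0 \<Longrightarrow> z \<in> (\<Union>i<n. A i \<times> B i)"
  shows "pairing M N T k = 0"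
proof -
  define c where "c m z = (if z \<in> (\<Union>i<m. A i \<times> B i) then 0 else k z)" for m z
  have "c m \<in> Gamma M N \<and> (AE z in M \<Otimes>\<^sub>M N. z \<in> E \<longrightarrow> c m z = 0) \<and> pairing M N T (c m) = pairing M N T k" for m
  proof (induction m)
    case 0
    have "c 0 = k" by (simp add: c_def[abs_def])
    then show ?case using k by simp
  next
    case (Suc m)
    have eq: "c (Suc m) = (\<lambda>z. c m z - indicator (A m \<times> B m) z * c m z)"
      by (rule ext) (auto simp: c_def lessThan_Suc indicator_def)
    have ind: "(\<lambda>z. indicator (A m \<times> B m) z * c m z) \<in> Gamma M N"
      using Suc R by (intro Gamma_indicator) auto
    have "pairing M N T (c (Suc m)) = pairing M N T (c m)"
      unfolding eq using pairing_diff[OF T _ ind] good[of "c m" m] Suc by simp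
    moreover have "AE z in M \<Otimes>\<^sub>M N. z \<in> E \<longrightarrow> c (Suc m) z = 0"
      using Suc by (auto simp: eq)
    moreover have "c (Suc m) \<in> Gamma M N" unfolding eq using Suc ind by auto
    ultimately show ?case using Suc by simp
  qed
  moreover have "c n = (\<lambda>z. 0)" using supp by (auto simp: c_def fun_eq_iff)
  ultimately show ?thesis
    using pairing_AE_zero[OF T Gamma_zero] by (metis (mono_tags, lifting) AE_I2)
qed

lemma omega_open_cover:
  assumes "omega_open M N E"
  shows "\<exists>\<alpha> \<beta>. (\<forall>i::nat. \<alpha> i \<in> sets M \<and> \<beta> i \<in> sets N) \<and>
    marginally_null M N (E - (\<Union>i. \<alpha> i \<times> \<beta> i)) \<and> marginally_null M N ((\<Union>i. \<alpha> i \<times> \<beta> i) - E)"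
proof -
  obtain \<alpha> \<beta> where ab: "\<And>i::nat. \<alpha> i \<in> sets M \<and> \<beta> i \<in> sets N"
    "marginally_null M N (E - (\<Union>i. \<alpha> i \<times> \<beta> i) \<union> ((\<Union>i. \<alpha> i \<times> \<beta> i) - E))"
    using assms unfolding omega_open_def marginally_equivalent_def by blast
  show ?thesis
    by (intro exI[of _ \<alpha>] exI[of _ \<beta>] conjI allI marginally_null_subset[OF ab(2)]) (use ab(1) in auto)
qed

text \<open>Since \<open>\<kappa> \<subseteq> E\<close>, rectangles filling \<open>E\<close> and
  rectangles filling the complement of \<kappa> together cover the space marginally. On the former
  \<open>k\<close> is zero, on the latter \<open>T\<close> is zero. Cutting rectangles away needs a
  finite cover, which compact rectangles provide; these exhaust the space and the pairing passes to
  the limit.\<close>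

theorem pairing_eq_0_of_vanishing_near_support:
  assumes stdM: "standard_measure_space M" and stdN: "standard_measure_space N"
    and \<kappa>: "omega_closed M N \<kappa>" and E: "omega_open M N E" "\<kappa> \<subseteq> E"
    and T: "T \<in> M_max M N \<kappa>" and k: "k \<in> Gamma M N" "AE z in M \<Otimes>\<^sub>M N. z \<in> E \<longrightarrow> k z = 0"
  shows "pairing M N T k = 0"
proof -
  have Tb: "T \<in> bounded_ops M N" using T by (simp add: M_max_def)
  have EXY: "E \<subseteq> XY" using E by (simp add: omega_open_def)
  have \<kappa>XY: "\<kappa> \<subseteq> XY" "omega_open M N (XY - \<kappa>)" using \<kappa> by (auto simp: omega_closed_def)
  obtain \<alpha> \<beta> where ab: "\<And>i::nat. \<alpha> i \<in> sets M \<and> \<beta> i \<in> sets N"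
    "marginally_null M N (E - (\<Union>i. \<alpha> i \<times> \<beta> i))" "marginally_null M N ((\<Union>i. \<alpha> i \<times> \<beta> i) - E)"
    using omega_open_cover[OF E(1)] by blast
  obtain \<gamma> \<delta> where cd: "\<And>i::nat. \<gamma> i \<in> sets M \<and> \<delta> i \<in> sets N"
    "marginally_null M N (XY - \<kappa> - (\<Union>i. \<gamma> i \<times> \<delta> i))" "marginally_null M N ((\<Union>i. \<gamma> i \<times> \<delta> i) - (XY - \<kappa>))"
    using omega_open_cover[OF \<kappa>XY(2)] by blast
  \<comment> \<open>Even indices carry the rectangles of \<open>E\<close>, odd ones those of the
    complement of \<kappa>.\<close>
  define A where "A = interleave \<alpha> \<gamma>"
  define B where "B = interleave \<beta> \<delta>"
  have R: "A i \<in> sets M \<and> B i \<in> sets N" for i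
    using ab(1) cd(1) by (auto simp: A_def B_def interleave_def)
  have cov: "(\<Union>i. \<alpha> i \<times> \<beta> i) \<union> (\<Union>i. \<gamma> i \<times> \<delta> i) \<subseteq> (\<Union>i. A i \<times> B i)"
  proof -
    have "\<alpha> i \<times> \<beta> i \<subseteq> (\<Union>i. A i \<times> B i)" for i
      using UN_upper[of "2 * i" UNIV "\<lambda>i. A i \<times> B i", OF UNIV_I] by (simp add: A_def B_def interleave_def)
    moreover have "\<gamma> i \<times> \<delta> i \<subseteq> (\<Union>i. A i \<times> B i)" for i
      using UN_upper[of "Suc (2 * i)" UNIV "\<lambda>i. A i \<times> B i", OF UNIV_I] by (simp add: A_def B_def interleave_def)
    ultimately show ?thesis by (intro Un_least UN_least)
  qed
  have "marginally_null M N (XY - (\<Union>i. A i \<times> B i))"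
    by (rule marginally_null_subset[OF marginally_null_Un[OF ab(2) cd(2)]]) (use cov E(2) in blast)
  from marginally_nullD[OF this] obtain P Q where PQ: "AE x in M. P x" "AE y in N. Q y"
    "\<And>x y. (x, y) \<in> XY - (\<Union>i. A i \<times> B i) \<Longrightarrow> P x \<Longrightarrow> Q y \<Longrightarrow> False"
    by blast
  have Am: "A i \<in> sets M" for i using R by blast
  obtain S K where K': "\<forall>r::nat. K r \<in> sets M \<and> compactin S (K r) \<and> (\<forall>x\<in>K r. P x) \<and>
      (\<forall>i. \<exists>U. openin S U \<and> A i \<inter> K r = U \<inter> K r)"
    and Kev: "AE x in M. \<forall>\<^sub>F r in sequentially. x \<in> K r"
    using standard_compact_exhaustion[where A = A, OF stdM Am PQ(1)] by (elim exE conjE)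
  have K: "K r \<in> sets M" "compactin S (K r)" "x \<in> K r \<Longrightarrow> P x"
    "\<exists>U. openin S U \<and> A i \<inter> K r = U \<inter> K r" for r x i
    using K'[rule_format, of r] by simp_all
  have Bm: "B i \<in> sets N" for i using R by blast
  obtain S' L where L': "\<forall>r::nat. L r \<in> sets N \<and> compactin S' (L r) \<and> (\<forall>x\<in>L r. Q x) \<and>
      (\<forall>i. \<exists>U. openin S' U \<and> B i \<inter> L r = U \<inter> L r)"
    and Lev: "AE x in N. \<forall>\<^sub>F r in sequentially. x \<in> L r"
    using standard_compact_exhaustion[where A = B, OF stdN Bm PQ(2)] by (elim exE conjE)
  have L: "L r \<in> sets N" "compactin S' (L r)" "x \<in> L r \<Longrightarrow> Q x"
    "\<exists>U. openin S' U \<and> B i \<inter> L r = U \<inter> L r" for r x i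
    using L'[rule_format, of r] by simp_all
  have good: "pairing M N T (\<lambda>z. indicator (A i \<times> B i) z * k z) = 0"
    if k: "k \<in> Gamma M N" and 0: "AE z in M \<Otimes>\<^sub>M N. z \<in> E \<longrightarrow> k z = 0" for k i
  proof (cases "even i")
    case True
    then have AB: "A i \<times> B i \<subseteq> (\<Union>i. \<alpha> i \<times> \<beta> i)" by (auto simp: A_def B_def interleave_def)
    have "AE z in M \<Otimes>\<^sub>M N. indicator (A i \<times> B i) z * k z = 0"
      using mn_AE[OF ab(3)] 0
    proof eventually_elim
      case (elim z)
      then show ?case using AB by (cases "z \<in> A i \<times> B i") auto
    qed
    then show ?thesis using R k by (intro pairing_AE_zero[OF Tb] Gamma_indicator) auto
  next
    case False
    then have AB: "A i \<times> B i \<subseteq> (\<Union>i. \<gamma> i \<times> \<delta> i)" by (auto simp: A_def B_def interleave_def)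
    have "marginally_null M N ((A i \<times> B i) \<inter> \<kappa>)"
      by (rule marginally_null_subset[OF cd(3)]) (use AB in blast)
    then have "op_mult M N (indicator (B i)) T (indicator (A i)) = op_zero M N"
      using T R unfolding M_max_def by blast
    then show ?thesis using R k by (intro pairing_indicator_eq_0[OF Tb]) auto
  qed
  have "pairing M N T (\<lambda>z. indicator (K r \<times> L r) z * k z) = 0" for r
  proof -
    have "K r \<times> L r \<subseteq> (\<Union>i. A i \<times> B i)"
    proof
      fix z assume z: "z \<in> K r \<times> L r"
      then obtain x y where xy: "z = (x, y)" "x \<in> K r" "y \<in> L r" by blast
      then have "z \<in> XY" using sets.sets_into_space[OF K(1)] sets.sets_into_space[OF L(1)] by blast
      show "z \<in> (\<Union>i. A i \<times> B i)"
      proof (rule ccontr)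
        assume "z \<notin> (\<Union>i. A i \<times> B i)"
        with \<open>z \<in> XY\<close> have "(x, y) \<in> XY - (\<Union>i. A i \<times> B i)" using xy(1) by blast
        from PQ(3)[OF this K(3)[OF xy(2)] L(3)[OF xy(3)]] show False .
      qed
    qed
    from finite_subcover_rectangles[OF K(2) L(2) K(4) L(4) this]
    obtain n where n: "K r \<times> L r \<subseteq> (\<Union>i<n. A i \<times> B i)" by blast
    show ?thesis
    proof (rule pairing_eq_0_finite_cover[OF Tb R good])
      show "(\<lambda>z. indicator (K r \<times> L r) z * k z) \<in> Gamma M N" using k K L by auto
      show "AE z in M \<Otimes>\<^sub>M N. z \<in> E \<longrightarrow> indicator (K r \<times> L r) z * k z = 0" using k(2) by auto
      show "z \<in> (\<Union>i<n. A i \<times> B i)" if "indicator (K r \<times> L r) z * k z \<noteq> 0" for z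
        using that n by (auto simp: indicator_def split: if_splits)
    qed
  qed
  then have "(\<lambda>r. 0) \<longlonglongrightarrow> pairing M N T k"
    using pairing_indicator_tendsto[OF Tb k(1) K(1) Kev L(1) Lev] by simp
  then show ?thesis using LIMSEQ_unique tendsto_const by blast
qed

end

subsection \<open>Continuity of functions in the predual\<close>

text \<open>By second countability an open set in the product is a countable union of open boxes,
  and a box pulls back to a measurable rectangle.\<close>

lemma open_preimage_rectangles:
  fixes F :: "'a \<Rightarrow> 'c :: second_countable_topology" and G :: "'b \<Rightarrow> 'd :: second_countable_topology"
  assumes F: "F \<in> borel_measurable M" and G: "G \<in> borel_measurable N" and S: "open S"
  shows "\<exists>\<alpha> \<beta>. (\<forall>i::nat. \<alpha> i \<in> sets M \<and> \<beta> i \<in> sets N) \<and>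
    {z \<in> space M \<times> space N. (F (fst z), G (snd z)) \<in> S} = (\<Union>i. \<alpha> i \<times> \<beta> i)"
proof -
  obtain B1 :: "'c set set" where B1: "countable B1" "topological_basis B1" using ex_countable_basis by blast
  obtain B2 :: "'d set set" where B2: "countable B2" "topological_basis B2" using ex_countable_basis by blast
  \<comment> \<open>The empty box guarantees a nonempty set to enumerate.\<close>
  define R where "R = insert ({}, {}) {p \<in> B1 \<times> B2. fst p \<times> snd p \<subseteq> S}"
  have "countable {p \<in> B1 \<times> B2. fst p \<times> snd p \<subseteq> S}"
    by (rule countable_subset[of _ "B1 \<times> B2"]) (use B1 B2 in auto)
  then have R: "countable R" "R \<noteq> {}" by (auto simp: R_def)
  define e where "e = from_nat_into R"
  have e: "range e = R" unfolding e_def by (rule range_from_nat_into[OF R(2,1)])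
  have Rop: "open (fst p) \<and> open (snd p) \<and> fst p \<times> snd p \<subseteq> S" if "p \<in> R" for p
    using that topological_basis_open[OF B1(2)] topological_basis_open[OF B2(2)] unfolding R_def by auto
  have eop: "open (fst (e i))" "open (snd (e i))" "fst (e i) \<times> snd (e i) \<subseteq> S" for i
    using Rop[of "e i"] e by auto
  define \<alpha> where "\<alpha> i = F -` fst (e i) \<inter> space M" for i
  define \<beta> where "\<beta> i = G -` snd (e i) \<inter> space N" for i
  have "\<alpha> i \<in> sets M" "\<beta> i \<in> sets N" for i
    unfolding \<alpha>_def \<beta>_def using eop[of i] by (auto intro!: measurable_sets[OF F] measurable_sets[OF G])
  moreover have "{z \<in> space M \<times> space N. (F (fst z), G (snd z)) \<in> S} = (\<Union>i. \<alpha> i \<times> \<beta> i)"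
  proof
    show "(\<Union>i. \<alpha> i \<times> \<beta> i) \<subseteq> {z \<in> space M \<times> space N. (F (fst z), G (snd z)) \<in> S}"
    proof (rule UN_least)
      fix i show "\<alpha> i \<times> \<beta> i \<subseteq> {z \<in> space M \<times> space N. (F (fst z), G (snd z)) \<in> S}"
        using eop(3)[of i] by (auto simp: \<alpha>_def \<beta>_def)
    qed
    show "{z \<in> space M \<times> space N. (F (fst z), G (snd z)) \<in> S} \<subseteq> (\<Union>i. \<alpha> i \<times> \<beta> i)"
    proof
      fix z assume z: "z \<in> {z \<in> space M \<times> space N. (F (fst z), G (snd z)) \<in> S}"
      then have zX: "fst z \<in> space M" "snd z \<in> space N" and zS: "(F (fst z), G (snd z)) \<in> S" by auto
      obtain A B where AB: "open A" "open B" "(F (fst z), G (snd z)) \<in> A \<times> B" "A \<times> B \<subseteq> S"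
        by (rule open_prod_elim[OF S zS])
      have AB': "F (fst z) \<in> A" "G (snd z) \<in> B" using AB(3) by simp_all
      obtain U where U: "U \<in> B1" "F (fst z) \<in> U" "U \<subseteq> A" by (rule topological_basisE[OF B1(2) AB(1) AB'(1)])
      obtain V where V: "V \<in> B2" "G (snd z) \<in> V" "V \<subseteq> B" by (rule topological_basisE[OF B2(2) AB(2) AB'(2)])
      have "U \<times> V \<subseteq> S" using U(3) V(3) AB(4) by blast
      then have "(U, V) \<in> range e" using U(1) V(1) unfolding e R_def by simp
      then obtain i where i: "e i = (U, V)" by (metis rangeE)
      have "fst z \<in> \<alpha> i" "snd z \<in> \<beta> i" using zX U(2) V(2) by (simp_all add: \<alpha>_def \<beta>_def i)
      then have "z \<in> \<alpha> i \<times> \<beta> i" by (simp add: mem_Times_iff)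
      then show "z \<in> (\<Union>i. \<alpha> i \<times> \<beta> i)" by blast
    qed
  qed
  ultimately show ?thesis by blast
qed

lemma continuous_on_fst_coordinate: "continuous_on UNIV (\<lambda>p::('i \<Rightarrow> complex) \<times> 'd::topological_space. fst p i)"
  by (rule continuous_on_compose2[OF continuous_on_product_coordinates continuous_on_fst[OF continuous_on_id]]) auto

lemma continuous_on_snd_coordinate: "continuous_on UNIV (\<lambda>p::'d::topological_space \<times> ('i \<Rightarrow> complex). snd p i)"
  by (rule continuous_on_compose2[OF continuous_on_product_coordinates continuous_on_snd[OF continuous_on_id]]) auto

text \<open>A sum is nonzero exactly when some partial sum exceeds a bound for the remainder. The
  bound splits into a part from \<open>a\<close> and a part from \<open>b\<close>, so each test is a
  strict inequality between finitely many numbers, each determined by one of the two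
  sequences.\<close>

lemma suminf_ne_0_iff_partial_sum:
  assumes a: "summable (\<lambda>i. (cmod (a i))\<^sup>2)" and b: "summable (\<lambda>i. (cmod (b i))\<^sup>2)"
  shows "(\<Sum>i. a i * b i) \<noteq> 0 \<longleftrightarrow>
    (\<exists>n. ((\<Sum>i. (cmod (a (i + n)))\<^sup>2) + (\<Sum>i. (cmod (b (i + n)))\<^sup>2)) / 2 < cmod (\<Sum>i<n. a i * b i))"
proof -
  note an = summable_ignore_initial_segment[OF a]
  note bn = summable_ignore_initial_segment[OF b]
  have s: "summable (\<lambda>i. a i * b i)" by (rule summable_norm_cancel[OF summable_tensor[OF a b]])
  define t where "t n = ((\<Sum>i. (cmod (a (i + n)))\<^sup>2) + (\<Sum>i. (cmod (b (i + n)))\<^sup>2)) / 2" for n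
  have tail: "cmod ((\<Sum>i. a i * b i) - (\<Sum>i<n. a i * b i)) \<le> t n" for n
  proof -
    have "(\<Sum>i. a i * b i) - (\<Sum>i<n. a i * b i) = (\<Sum>i. a (i + n) * b (i + n))"
      using suminf_split_initial_segment[OF s, of n] by simp
    also have "cmod \<dots> \<le> (\<Sum>i. cmod (a (i + n) * b (i + n)))"
      by (rule summable_norm[OF summable_tensor[OF an bn]])
    also have "\<dots> \<le> (\<Sum>i. ((cmod (a (i + n)))\<^sup>2 + (cmod (b (i + n)))\<^sup>2) / 2)"
      by (rule suminf_le[OF norm_mult_le_half_squares summable_tensor[OF an bn] summable_divide[OF summable_add[OF an bn]]])
    also have "\<dots> = t n"
      unfolding t_def suminf_add[OF an bn] by (rule suminf_divide[OF summable_add[OF an bn]])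
    finally show ?thesis .
  qed
  show ?thesis
    unfolding t_def[symmetric]
  proof
    assume ne: "(\<Sum>i. a i * b i) \<noteq> 0"
    have "t \<longlonglongrightarrow> (0 + 0) / 2"
      unfolding t_def[abs_def]
      by (intro tendsto_divide tendsto_add tendsto_const suminf_exist_split2 a b) simp
    moreover have "(\<lambda>n. cmod (\<Sum>i<n. a i * b i)) \<longlonglongrightarrow> cmod (\<Sum>i. a i * b i)"
      by (rule tendsto_norm[OF summable_LIMSEQ[OF s]])
    ultimately have "(\<lambda>n. cmod (\<Sum>i<n. a i * b i) - t n) \<longlonglongrightarrow> cmod (\<Sum>i. a i * b i) - (0 + 0) / 2"
      by (intro tendsto_diff)
    from order_tendstoD(1)[OF this, of 0] ne
    have "\<forall>\<^sub>F n in sequentially. t n < cmod (\<Sum>i<n. a i * b i)" by simp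
    then show "\<exists>n. t n < cmod (\<Sum>i<n. a i * b i)"
      by (rule eventually_happens'[OF sequentially_bot])
  next
    assume "\<exists>n. t n < cmod (\<Sum>i<n. a i * b i)"
    then obtain n where n: "t n < cmod (\<Sum>i<n. a i * b i)" by blast
    show "(\<Sum>i. a i * b i) \<noteq> 0"
    proof
      assume "(\<Sum>i. a i * b i) = 0"
      then show False using tail[of n] n by simp
    qed
  qed
qed

context L2_pair begin

text \<open>Elements of the predual are \<omega>-continuous in this sense: nonvanishing is a
  countable disjunction of open conditions on measurable data of \<open>x\<close> and of
  \<open>y\<close> separately.\<close>

lemma nonzero_set_rectangles:
  assumes k: "k \<in> Gamma M N"
  shows "\<exists>\<alpha> \<beta>. (\<forall>i::nat. \<alpha> i \<in> sets M \<and> \<beta> i \<in> sets N) \<and>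
    marginally_equivalent M N {z \<in> XY. k z \<noteq> 0} (\<Union>i. \<alpha> i \<times> \<beta> i)"
proof -
  obtain f g where fg: "tensor_series M N XY f g k" using k by (rule GammaE)
  then have f: "f i \<in> sq M" and g: "g i \<in> sq N" and sf: "summable (\<lambda>i. (nrm M (f i))\<^sup>2)"
    and sg: "summable (\<lambda>i. (nrm N (g i))\<^sup>2)" for i by (auto simp: tensor_series_def)
  have [measurable]: "f i \<in> borel_measurable M" "g i \<in> borel_measurable N" for i
    using f g by (auto intro: sq_measurable)
  \<comment> \<open>Coordinates below \<open>n\<close> hold the first terms and coordinate
    \<open>n\<close> holds the tail sum, so that the test of
    \<open>suminf_ne_0_iff_partial_sum\<close> becomes the open set \<open>S n\<close>.\<close>
  define F where "F n x i = (if i < n then f i x else complex_of_real (\<Sum>i. (cmod (f (i + n) x))\<^sup>2))" for n :: nat and x and i :: nat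
  define G where "G n y i = (if i < n then g i y else complex_of_real (\<Sum>i. (cmod (g (i + n) y))\<^sup>2))" for n :: nat and y and i :: nat
  define S where "S n = {p :: (nat \<Rightarrow> complex) \<times> (nat \<Rightarrow> complex).
      (Re (fst p n) + Re (snd p n)) / 2 < cmod (\<Sum>i<n. fst p i * snd p i)}" for n :: nat
  have "open (S n)" for n
    unfolding S_def
    by (intro open_Collect_less continuous_intros continuous_on_fst_coordinate continuous_on_snd_coordinate) auto
  moreover have "F n \<in> borel_measurable M" for n
    by (rule measurable_coordinatewise_then_product) (simp add: F_def)
  moreover have "G n \<in> borel_measurable N" for n
    by (rule measurable_coordinatewise_then_product) (simp add: G_def)
  ultimately have "\<exists>\<alpha> \<beta>. (\<forall>i::nat. \<alpha> i \<in> sets M \<and> \<beta> i \<in> sets N) \<and>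
    {z \<in> XY. (F n (fst z), G n (snd z)) \<in> S n} = (\<Union>i. \<alpha> i \<times> \<beta> i)" for n
    by (intro open_preimage_rectangles)
  then have "\<forall>n. \<exists>\<alpha>. \<exists>\<beta>. (\<forall>i::nat. \<alpha> i \<in> sets M \<and> \<beta> i \<in> sets N) \<and>
    {z \<in> XY. (F n (fst z), G n (snd z)) \<in> S n} = (\<Union>i. \<alpha> i \<times> \<beta> i)" by blast
  from choice[OF this] obtain \<alpha> where "\<forall>n. \<exists>\<beta>. (\<forall>i::nat. \<alpha> n i \<in> sets M \<and> \<beta> i \<in> sets N) \<and>
    {z \<in> XY. (F n (fst z), G n (snd z)) \<in> S n} = (\<Union>i. \<alpha> n i \<times> \<beta> i)" by (rule exE)
  from choice[OF this] obtain \<beta> where ab': "\<forall>n. (\<forall>i::nat. \<alpha> n i \<in> sets M \<and> \<beta> n i \<in> sets N) \<and>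
    {z \<in> XY. (F n (fst z), G n (snd z)) \<in> S n} = (\<Union>i. \<alpha> n i \<times> \<beta> n i)" by (rule exE)
  have ab: "\<alpha> n i \<in> sets M \<and> \<beta> n i \<in> sets N"
    and eq: "{z \<in> XY. (F n (fst z), G n (snd z)) \<in> S n} = (\<Union>i. \<alpha> n i \<times> \<beta> n i)" for n i
    using ab'[rule_format, of n] by (auto simp only:)
  \<comment> \<open>The pairing function merges the double sequence of rectangles into a single
    one.\<close>
  define \<alpha>' where "\<alpha>' j = \<alpha> (fst (prod_decode j)) (snd (prod_decode j))" for j
  define \<beta>' where "\<beta>' j = \<beta> (fst (prod_decode j)) (snd (prod_decode j))" for j
  have UN: "(\<Union>j. \<alpha>' j \<times> \<beta>' j) = (\<Union>n. {z \<in> XY. (F n (fst z), G n (snd z)) \<in> S n})"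
  proof -
    have "\<alpha>' j \<times> \<beta>' j \<subseteq> (\<Union>n. \<Union>i. \<alpha> n i \<times> \<beta> n i)" for j
      unfolding \<alpha>'_def \<beta>'_def by blast
    moreover have "\<alpha> n i \<times> \<beta> n i \<subseteq> (\<Union>j. \<alpha>' j \<times> \<beta>' j)" for n i
      using UN_upper[of "prod_encode (n, i)" UNIV "\<lambda>j. \<alpha>' j \<times> \<beta>' j", OF UNIV_I] by (simp add: \<alpha>'_def \<beta>'_def)
    ultimately show ?thesis
      unfolding eq by (intro antisym UN_least)
  qed
  have "marginally_null M N (({z \<in> XY. k z \<noteq> 0} - (\<Union>j. \<alpha>' j \<times> \<beta>' j)) \<union> ((\<Union>j. \<alpha>' j \<times> \<beta>' j) - {z \<in> XY. k z \<noteq> 0})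
      - {z \<in> XY. \<not> (\<lambda>i. f i (fst z) * g i (snd z)) sums k z})" (is "marginally_null M N ?E")
  proof (rule marginally_nullI[OF _ AE_summable_sq[OF f sf] AE_summable_sq[OF g sg]])
    show "?E \<subseteq> XY" unfolding UN by blast
    fix x y assume xy: "(x, y) \<in> ?E"
      and x: "summable (\<lambda>i. (cmod (f i x))\<^sup>2)" and y: "summable (\<lambda>i. (cmod (g i y))\<^sup>2)"
    have XY: "(x, y) \<in> XY" using xy unfolding UN by blast
    then have "(\<Sum>i. f i x * g i y) = k (x, y)" using xy by (auto simp: sums_iff)
    then have "k (x, y) \<noteq> 0 \<longleftrightarrow> (\<exists>n. (F n x, G n y) \<in> S n)"
      using suminf_ne_0_iff_partial_sum[OF x y] by (simp add: S_def F_def G_def)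
    then show False using xy XY unfolding UN by auto
  qed
  from marginally_null_Un[OF this tensor_series_sums[OF fg]]
  have "marginally_equivalent M N {z \<in> XY. k z \<noteq> 0} (\<Union>j. \<alpha>' j \<times> \<beta>' j)"
    unfolding marginally_equivalent_def by (rule marginally_null_subset) blast
  then show ?thesis using ab by (intro exI[of _ \<alpha>'] exI[of _ \<beta>']) (auto simp: \<alpha>'_def \<beta>'_def)
qed

end

subsection \<open>Schur maps and Ditkin sets\<close>

lemma L2_norm_L2_zero: "L2_norm M (L2_zero M) = 0"
  unfolding L2_zero_def by (simp add: L2_norm_class)

lemma L2_zero_in: "L2_zero M \<in> L2 M"
  unfolding L2_zero_def by (rule L2_class_in) simp

lemma L2_norm_mult_const:
  assumes "u \<in> L2 M" shows "L2_norm M (L2_mult M (\<lambda>_. c) u) = cmod c * L2_norm M u"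
proof -
  have "L2_rep u \<in> sq M" using assms by auto
  then show ?thesis
    unfolding L2_mult_def L2_norm_rep[of M u]
    using L2_norm_class[OF sq_scale, of "L2_rep u" M c] nrm_scale[of M c "L2_rep u"] by simp
qed

lemma L2_norm_le_op_norm:
  assumes S: "S \<in> bounded_ops M N" and u: "u \<in> L2 M"
  shows "L2_norm N (S u) \<le> op_norm M N S * L2_norm M u"
proof -
  obtain C where C: "0 \<le> C" "\<And>u. u \<in> L2 M \<Longrightarrow> L2_norm N (S u) \<le> C * L2_norm M u"
    using bounded_form_ex[OF S] by metis
  show ?thesis
  proof (cases "L2_norm M u = 0")
    case True
    then show ?thesis using C(2)[OF u] by simp
  next
    case False
    then have pos: "0 < L2_norm M u" using nrm_nonneg[of M "L2_rep u"] by (simp add: L2_norm_rep less_le)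
    let ?c = "complex_of_real (1 / L2_norm M u)"
    let ?v = "L2_mult M (\<lambda>_. ?c) u"
    have v: "?v \<in> L2 M" unfolding L2_mult_def using u by (intro L2_class_in sq_scale) auto
    have "L2_norm M ?v = 1" unfolding L2_norm_mult_const[OF u] using pos by (simp add: norm_divide)
    moreover have "L2_norm N (S w) \<le> C" if "w \<in> L2 M" "L2_norm M w \<le> 1" for w
      using C(2)[OF that(1)] mult_left_mono[OF that(2) C(1)] by simp
    then have "bdd_above ((\<lambda>u. L2_norm N (S u)) ` {u \<in> L2 M. L2_norm M u \<le> 1})"
      by (intro bdd_aboveI[of _ C]) auto
    ultimately have "L2_norm N (S ?v) \<le> op_norm M N S"
      unfolding op_norm_def using v by (intro cSUP_upper) auto
    moreover have "L2_norm N (S ?v) = L2_norm N (S u) / L2_norm M u"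
      unfolding bounded_ops_scale[OF S u] L2_norm_mult_const[OF bounded_ops_L2[OF S u]]
      using pos by (simp add: norm_divide)
    ultimately have "L2_norm N (S u) / L2_norm M u \<le> op_norm M N S" by (simp only:)
    then show ?thesis using pos by (simp only: pos_divide_le_eq)
  qed
qed

lemma op_norm_le_1:
  assumes "\<And>u. u \<in> L2 M \<Longrightarrow> L2_norm N (T u) \<le> L2_norm M u"
  shows "op_norm M N T \<le> 1"
  unfolding op_norm_def
proof (rule cSUP_least)
  show "{u \<in> L2 M. L2_norm M u \<le> 1} \<noteq> {}"
    using L2_zero_in[of M] L2_norm_L2_zero[of M] by auto
qed (use assms in \<open>force intro: order_trans\<close>)

section \<open>Multipliers of idempotent Schur maps\<close>

context L2_pair begin

lemma Ref_superset:
  assumes "U \<subseteq> bounded_ops M N" shows "U \<subseteq> Ref M N U"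
proof
  fix T assume T: "T \<in> U"
  have "L2_diff N (T u) (T u) = L2_zero N" for u
    by (simp add: L2_diff_def L2_zero_def)
  then show "T \<in> Ref M N U"
    using T assms unfolding Ref_def by (auto intro!: bexI[of _ T] simp: L2_norm_L2_zero)
qed

text \<open>Multiplying such a function by a multiplier encodes the multiplier as an element of the
  predual without loss. Its factors come from positive integrable functions bounded by
  \<open>1\<close>, whose squares are then integrable as well.\<close>

lemma nowhere_zero_Gamma:
  "\<exists>h\<in>Gamma M N. \<forall>z. h z \<noteq> 0"
proof -
  have ex: "\<exists>f. f \<in> sq L \<and> (\<forall>x. f x \<noteq> 0)" if "sigma_finite_measure L" for L :: "'c measure"
  proof -
    interpret sigma_finite_measure L by fact
    obtain f :: "'c \<Rightarrow> real" where f: "f \<in> borel_measurable L" "\<And>x. f x > 0" "\<And>x. f x \<le> 1" "integrable L f"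
      using obtain_positive_integrable_function by metis
    have "(\<lambda>x. complex_of_real (f x)) \<in> sq L"
    proof (rule sq_bound[OF _ f(4)])
      show "(cmod (complex_of_real (f x)))\<^sup>2 \<le> f x" for x
        using f(2)[of x] f(3)[of x] by (simp add: power2_eq_square)
    qed (use f in measurable)
    then show ?thesis using f(2) by (intro exI[of _ "\<lambda>x. complex_of_real (f x)"]) (auto simp: less_imp_neq[symmetric] order_less_imp_not_eq2)
  qed
  obtain f where f: "f \<in> sq M" "\<And>x. f x \<noteq> 0" using ex M1.sigma_finite_measure_axioms by blast
  obtain g where g: "g \<in> sq N" "\<And>y. g y \<noteq> 0" using ex M2.sigma_finite_measure_axioms by blast
  show ?thesis
    by (rule bexI[OF _ Gamma_tensor[OF f(1) g(1)]]) (use f g in auto)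
qed

lemma
  assumes "schur_multiplier M N \<phi>" "h \<in> Gamma M N"
  shows Gamma_mult_in: "Gamma_mult M N \<phi> h \<in> Gamma M N"
    and Gamma_mult_AE: "AE z in M \<Otimes>\<^sub>M N. Gamma_mult M N \<phi> h z = \<phi> z * h z"
proof -
  have "\<exists>k. k \<in> Gamma M N \<and> (AE z in M \<Otimes>\<^sub>M N. k z = \<phi> z * h z)"
    using assms unfolding schur_multiplier_def by blast
  from someI_ex[OF this] show "Gamma_mult M N \<phi> h \<in> Gamma M N"
    "AE z in M \<Otimes>\<^sub>M N. Gamma_mult M N \<phi> h z = \<phi> z * h z"
    unfolding Gamma_mult_def by blast+
qed

lemma
  assumes "is_schur_map M N \<phi> \<Phi>" "T \<in> bounded_ops M N"
  shows schur_map_bounded: "\<Phi> T \<in> bounded_ops M N"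
    and schur_map_pairing: "h \<in> Gamma M N \<Longrightarrow> pairing M N (\<Phi> T) h = pairing M N T (Gamma_mult M N \<phi> h)"
  using assms unfolding is_schur_map_def by auto

text \<open>Apply \<open>1 - \<phi>\<close> and then \<open>1 - \<psi>\<close>; each is a difference
  inside the predual.\<close>

lemma schur_multiplier_complement:
  assumes \<phi>: "schur_multiplier M N \<phi>" and \<psi>: "schur_multiplier M N \<psi>"
  shows "schur_multiplier M N (\<lambda>z. (1 - \<phi> z) * (1 - \<psi> z))"
  unfolding schur_multiplier_def
proof (intro conjI ballI)
  have [measurable]: "\<phi> \<in> borel_measurable (M \<Otimes>\<^sub>M N)" "\<psi> \<in> borel_measurable (M \<Otimes>\<^sub>M N)"
    using \<phi> \<psi> by (auto simp: schur_multiplier_def Linf_def)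
  obtain C D where C: "AE z in M \<Otimes>\<^sub>M N. cmod (\<phi> z) \<le> C" and D: "AE z in M \<Otimes>\<^sub>M N. cmod (\<psi> z) \<le> D"
    using \<phi> \<psi> by (auto simp: schur_multiplier_def Linf_def)
  have "AE z in M \<Otimes>\<^sub>M N. cmod ((1 - \<phi> z) * (1 - \<psi> z)) \<le> (1 + C) * (1 + D)"
    using C D
  proof eventually_elim
    case (elim z)
    have "cmod (1 - \<phi> z) \<le> 1 + C" "cmod (1 - \<psi> z) \<le> 1 + D"
      using norm_triangle_ineq4[of 1 "\<phi> z"] norm_triangle_ineq4[of 1 "\<psi> z"] elim by auto
    then show ?case
      unfolding norm_mult by (rule mult_mono') auto
  qed
  then show "(\<lambda>z. (1 - \<phi> z) * (1 - \<psi> z)) \<in> Linf (M \<Otimes>\<^sub>M N)"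
    unfolding Linf_def by auto
  fix h assume h: "h \<in> Gamma M N"
  define h1 where "h1 z = h z - Gamma_mult M N \<phi> h z" for z
  have h1: "h1 \<in> Gamma M N" unfolding h1_def using h Gamma_mult_in[OF \<phi> h] by auto
  have "AE z in M \<Otimes>\<^sub>M N. h1 z - Gamma_mult M N \<psi> h1 z = (1 - \<phi> z) * (1 - \<psi> z) * h z"
    using Gamma_mult_AE[OF \<phi> h] Gamma_mult_AE[OF \<psi> h1]
    by eventually_elim (simp add: h1_def algebra_simps)
  then show "\<exists>k\<in>Gamma M N. AE z in M \<Otimes>\<^sub>M N. k z = (1 - \<phi> z) * (1 - \<psi> z) * h z"
    using h1 Gamma_mult_in[OF \<psi> h1] by (intro bexI[of _ "\<lambda>z. h1 z - Gamma_mult M N \<psi> h1 z"]) auto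
qed

text \<open>Idempotence dualises to equal pairings of \<open>\<phi> * \<phi> * h\<close> and
  \<open>\<phi> * h\<close> with every operator. These functions thus agree almost everywhere, and
  the nowhere zero \<open>h\<close> can be divided out.\<close>

lemma idempotent_schur_multiplier_AE:
  assumes \<phi>: "schur_multiplier M N \<phi>" and \<Phi>: "is_schur_map M N \<phi> \<Phi>"
    and idem: "\<And>T. T \<in> bounded_ops M N \<Longrightarrow> \<Phi> (\<Phi> T) = \<Phi> T"
  shows "AE z in M \<Otimes>\<^sub>M N. \<phi> z = 0 \<or> \<phi> z = 1"
proof -
  obtain h where h: "h \<in> Gamma M N" "\<And>z. h z \<noteq> 0" using nowhere_zero_Gamma by blast
  let ?k = "Gamma_mult M N \<phi> h"
  have k: "?k \<in> Gamma M N" by (rule Gamma_mult_in[OF \<phi> h(1)])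
  let ?l = "Gamma_mult M N \<phi> ?k"
  have l: "?l \<in> Gamma M N" by (rule Gamma_mult_in[OF \<phi> k])
  have "AE z in M \<Otimes>\<^sub>M N. ?l z - ?k z = 0"
  proof (rule AE_zero_of_pairing)
    show "(\<lambda>z. ?l z - ?k z) \<in> Gamma M N" using k l by auto
    fix T assume T: "T \<in> bounded_ops M N"
    note \<Phi>T = schur_map_bounded[OF \<Phi> T]
    have "pairing M N T ?l = pairing M N (\<Phi> (\<Phi> T)) h"
      using schur_map_pairing[OF \<Phi> T k] schur_map_pairing[OF \<Phi> \<Phi>T h(1)] by simp
    also have "\<dots> = pairing M N T ?k"
      unfolding idem[OF T] by (rule schur_map_pairing[OF \<Phi> T h(1)])
    finally show "pairing M N T (\<lambda>z. ?l z - ?k z) = 0"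
      using pairing_diff[OF T l k] by simp
  qed
  then show ?thesis
    using Gamma_mult_AE[OF \<phi> h(1)] Gamma_mult_AE[OF \<phi> k]
  proof eventually_elim
    case (elim z)
    then have "\<phi> z * (\<phi> z - 1) * h z = 0" by (simp add: algebra_simps)
    then show ?case using h(2)[of z] by auto
  qed
qed

lemma M_min_subset:
  assumes "masa_bimodule M N V" "closedin (weak_star M N) V" "is_support M N \<kappa> V"
  shows "M_min M N \<kappa> \<subseteq> V" "V \<subseteq> M_max M N \<kappa>"
proof -
  show "M_min M N \<kappa> \<subseteq> V" unfolding M_min_def using assms by blast
  have "V \<subseteq> bounded_ops M N" using assms(1) unfolding masa_bimodule_def op_subspace_def by blast
  then show "V \<subseteq> M_max M N \<kappa>" using Ref_superset assms(3) unfolding is_support_def by metis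
qed

section \<open>From strong operator Ditkin to operator synthetic\<close>

theorem strong_operator_Ditkin_imp_synthetic:
  assumes stdM: "standard_measure_space M" and stdN: "standard_measure_space N"
    and V: "masa_bimodule M N V" "closedin (weak_star M N) V" "is_support M N \<kappa> V"
    and Ditkin: "strong_operator_Ditkin M N \<kappa>"
  shows "operator_synthetic M N \<kappa>"
proof -
  \<comment> \<open>The given \<open>V\<close> makes this family nonempty, so that its intersection
    is again a weak* closed subspace and not the universal set.\<close>
  let ?\<U> = "{U. masa_bimodule M N U \<and> closedin (weak_star M N) U \<and> is_support M N \<kappa> U}"
  have V\<U>: "V \<in> ?\<U>" using V by blast
  have sub: "op_subspace M N U" if "U \<in> ?\<U>" for U using that unfolding masa_bimodule_def by blast
  have min_sub: "op_subspace M N (M_min M N \<kappa>)"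
    using sub V\<U> unfolding op_subspace_def M_min_def by blast
  have min_cl: "closedin (weak_star M N) (M_min M N \<kappa>)"
    unfolding M_min_def using V\<U> by (intro closedin_Inter) auto
  have \<kappa>: "omega_closed M N \<kappa>" using V(3) by (simp add: is_support_def)
  obtain w :: "nat \<Rightarrow> 'a \<times> 'b \<Rightarrow> complex" where w': "\<forall>n. schur_multiplier M N (w n)"
    and ex: "\<forall>n. \<exists>E. omega_open M N E \<and> \<kappa> \<subseteq> E \<and> (AE z in M \<Otimes>\<^sub>M N. z \<in> E \<longrightarrow> w n z = 0)"
    and lim: "\<forall>h\<in>Psi_min M N \<kappa>. (\<lambda>n. Gamma_norm M N (\<lambda>z. h z - Gamma_mult M N (w n) h z)) \<longlonglongrightarrow> 0"
    using Ditkin unfolding strong_operator_Ditkin_def by (elim exE conjE)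
  from choice[OF ex] obtain E
    where E': "\<forall>n. omega_open M N (E n) \<and> \<kappa> \<subseteq> E n \<and> (AE z in M \<Otimes>\<^sub>M N. z \<in> E n \<longrightarrow> w n z = 0)"
    by (rule exE)
  have w: "schur_multiplier M N (w n)" and E: "omega_open M N (E n)" "\<kappa> \<subseteq> E n"
    "AE z in M \<Otimes>\<^sub>M N. z \<in> E n \<longrightarrow> w n z = 0" for n
    using w' E' by (simp_all only:)
  have "T \<in> M_min M N \<kappa>" if T: "T \<in> M_max M N \<kappa>" for T
  proof (rule ccontr)
    assume "T \<notin> M_min M N \<kappa>"
    have Tb: "T \<in> bounded_ops M N" using T by (simp add: M_max_def)
    obtain k where k: "k \<in> Gamma M N" "\<And>T. T \<in> M_min M N \<kappa> \<Longrightarrow> pairing M N T k = 0" "pairing M N T k \<noteq> 0"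
      using weak_star_bipolar[OF min_sub min_cl Tb \<open>T \<notin> M_min M N \<kappa>\<close>] by metis
    then have kP: "k \<in> Psi_min M N \<kappa>" by (simp add: Psi_min_def preannihilator_def)
    obtain C where C: "0 \<le> C" "bounded_form M N C (form M N T)" using bounded_form_ex[OF Tb] by metis
    have le: "cmod (pairing M N T k) \<le> C * Gamma_norm M N (\<lambda>z. k z - Gamma_mult M N (w n) k z)" for n
    proof -
      have wk: "Gamma_mult M N (w n) k \<in> Gamma M N" by (rule Gamma_mult_in[OF w k(1)])
      have "AE z in M \<Otimes>\<^sub>M N. z \<in> E n \<longrightarrow> Gamma_mult M N (w n) k z = 0"
        using Gamma_mult_AE[OF w k(1), of n] E(3)[of n] by eventually_elim auto
      then have "pairing M N T (Gamma_mult M N (w n) k) = 0"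
        by (rule pairing_eq_0_of_vanishing_near_support[OF stdM stdN \<kappa> E(1,2) T wk])
      then have "pairing M N T k = pairing M N T (\<lambda>z. k z - Gamma_mult M N (w n) k z)"
        using pairing_diff[OF Tb k(1) wk] by simp
      then show ?thesis
        using pairing_le_Gamma_norm[OF Tb C(2,1) Gamma_diff[OF k(1) wk]] by simp
    qed
    have "(\<lambda>n. C * Gamma_norm M N (\<lambda>z. k z - Gamma_mult M N (w n) k z)) \<longlonglongrightarrow> 0"
      by (rule tendsto_mult_right_zero[OF lim[rule_format, OF kP]])
    from LIMSEQ_le_const[OF this] le have "cmod (pairing M N T k) \<le> 0" by blast
    then show False using k(3) by simp
  qed
  then show ?thesis
    unfolding operator_synthetic_def using M_min_subset[OF V] by blast
qed

text \<open>Arveson's null set theorem.\<close>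

lemma nonzero_op_supported_on:
  assumes K: "K \<subseteq> XY" and q: "q \<in> Gamma M N"
    and nn: "\<not> marginally_null M N {z \<in> K. q z \<noteq> 0}"
  shows "\<exists>T\<in>bounded_ops M N. pairing M N T q \<noteq> 0 \<and>
    (\<forall>k\<in>Gamma M N. marginally_null M N {z \<in> K. k z \<noteq> 0} \<longrightarrow> pairing M N T k = 0)"
proof -
  obtain T where T: "T \<in> bounded_ops M N" "Re (pairing M N T q) = qcost K q"
    "\<forall>k\<in>Gamma M N. marginally_null M N {z \<in> K. k z \<noteq> 0} \<longrightarrow> pairing M N T k = 0"
    using duality_attained[OF K q] by blast
  have "qcost K q \<noteq> 0" using qcost_eq_0[OF K q] nn by blast
  then have "pairing M N T q \<noteq> 0" using T(2) by auto
  then show ?thesis using T(1,3) by blast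
qed

text \<open>If \<kappa> met a rectangle of the nonvanishing set of \<open>k\<close> essentially,
  some \<open>T\<close> supported on the intersection would pair with \<open>h\<close> to a nonzero
  value. On that rectangle \<open>h\<close> and \<open>k\<close> agree almost everywhere, and
  elsewhere \<open>T\<close> sees nothing, so \<open>T\<close> would not kill \<open>k\<close>
  either.\<close>

lemma marginally_null_of_killed:
  assumes \<kappa>: "\<kappa> \<subseteq> XY" and h: "h \<in> Gamma M N" "\<And>z. h z \<noteq> 0"
    and k: "k \<in> Gamma M N" "AE z in M \<Otimes>\<^sub>M N. k z = 0 \<or> k z = h z"
    and kill: "\<And>T. T \<in> M_max M N \<kappa> \<Longrightarrow> pairing M N T k = 0"
  shows "marginally_null M N (\<kappa> \<inter> {z \<in> XY. k z \<noteq> 0})"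
proof -
  obtain \<alpha> \<beta> where ab: "\<And>i::nat. \<alpha> i \<in> sets M \<and> \<beta> i \<in> sets N"
    and eq: "marginally_equivalent M N {z \<in> XY. k z \<noteq> 0} (\<Union>i. \<alpha> i \<times> \<beta> i)"
    using nonzero_set_rectangles[OF k(1)] by blast
  have "marginally_null M N (\<kappa> \<inter> (\<alpha> i \<times> \<beta> i))" for i
  proof (rule ccontr)
    assume nn: "\<not> marginally_null M N (\<kappa> \<inter> (\<alpha> i \<times> \<beta> i))"
    let ?K = "\<kappa> \<inter> (\<alpha> i \<times> \<beta> i)"
    have K: "?K \<subseteq> XY" using \<kappa> by blast
    have "{z \<in> ?K. h z \<noteq> 0} = ?K" using h(2) by blast
    with nn have nn': "\<not> marginally_null M N {z \<in> ?K. h z \<noteq> 0}" by simp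
    obtain T where T: "T \<in> bounded_ops M N" "pairing M N T h \<noteq> 0"
      and T0: "\<And>q. q \<in> Gamma M N \<Longrightarrow> marginally_null M N {z \<in> ?K. q z \<noteq> 0} \<Longrightarrow> pairing M N T q = 0"
      using nonzero_op_supported_on[OF K h(1) nn'] by blast
    have "T \<in> M_max M N \<kappa>"
      unfolding M_max_def
    proof (intro CollectI conjI ballI impI T(1))
      fix A B assume AB: "A \<in> sets M" "B \<in> sets N" and mn: "marginally_null M N ((A \<times> B) \<inter> \<kappa>)"
      show "op_mult M N (indicator B) T (indicator A) = op_zero M N"
      proof (rule op_mult_indicator_eq_0[OF T(1) AB])
        fix q assume q: "q \<in> Gamma M N"
        show "pairing M N T (\<lambda>z. indicator (A \<times> B) z * q z) = 0"
        proof (rule T0[OF Gamma_indicator[OF q AB]])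
          show "marginally_null M N {z \<in> ?K. indicator (A \<times> B) z * q z \<noteq> 0}"
            by (rule marginally_null_subset[OF mn]) (auto simp: indicator_def)
        qed
      qed
    qed
    then have 1: "pairing M N T k = 0" by (rule kill)
    \<comment> \<open>The difference is split along the rectangle. Inside, it is zero only almost
      everywhere, which \<open>pairing_AE_zero\<close> handles; outside, it vanishes at every point
      of the set carrying \<open>T\<close>, which \<open>T0\<close> handles.\<close>
    define d where "d z = h z - k z" for z
    have d: "d \<in> Gamma M N" unfolding d_def using h k by auto
    have Rd: "(\<lambda>z. indicator (\<alpha> i \<times> \<beta> i) z * d z) \<in> Gamma M N" using d ab by auto
    have "pairing M N T (\<lambda>z. indicator (\<alpha> i \<times> \<beta> i) z * d z) = 0"
    proof (rule pairing_AE_zero[OF T(1) Rd])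
      have "marginally_null M N ((\<alpha> i \<times> \<beta> i) - {z \<in> XY. k z \<noteq> 0})"
        using eq unfolding marginally_equivalent_def by (rule marginally_null_subset) blast
      from mn_AE[OF this] k(2)
      show "AE z in M \<Otimes>\<^sub>M N. indicator (\<alpha> i \<times> \<beta> i) z * d z = 0"
        by eventually_elim (auto simp: d_def indicator_def)
    qed
    moreover have "pairing M N T (\<lambda>z. d z - indicator (\<alpha> i \<times> \<beta> i) z * d z) = 0"
    proof (rule T0[OF Gamma_diff[OF d Rd]])
      have eq: "{z \<in> ?K. d z - indicator (\<alpha> i \<times> \<beta> i) z * d z \<noteq> 0} = {}" by (auto simp: indicator_def)
      show "marginally_null M N {z \<in> ?K. d z - indicator (\<alpha> i \<times> \<beta> i) z * d z \<noteq> 0}"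
        unfolding eq by (rule marginally_null_empty)
    qed
    ultimately have "pairing M N T d = 0" using pairing_diff[OF T(1) d Rd] by simp
    then have "pairing M N T h = 0"
      using 1 pairing_diff[OF T(1) h(1) k(1)] by (simp add: d_def[abs_def])
    then show False using T(2) by simp
  qed
  then have "marginally_null M N (\<Union>i. \<kappa> \<inter> (\<alpha> i \<times> \<beta> i))" by (rule marginally_null_UN)
  from marginally_null_Un[OF this eq[unfolded marginally_equivalent_def]] show ?thesis
    by (rule marginally_null_subset) blast
qed

section \<open>From operator synthetic to strong operator Ditkin\<close>

lemma openin_pairing_ball:
  assumes h: "h \<in> Gamma M N"
  shows "openin (weak_star M N) {T \<in> bounded_ops M N. cmod (pairing M N T h) < \<epsilon>}"
proof -
  have "continuous_map Gtop euclidean (\<lambda>y. y h)"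
    using h by (rule continuous_map_product_projection)
  from openin_continuous_map_preimage[OF this, of "ball 0 \<epsilon>"]
  have "openin Gtop {y \<in> topspace Gtop. y h \<in> ball 0 \<epsilon>}" by simp
  moreover have "{T \<in> bounded_ops M N. cmod (pairing M N T h) < \<epsilon>}
      = {T \<in> bounded_ops M N. ev T \<in> {y \<in> topspace Gtop. y h \<in> ball 0 \<epsilon>}}"
    using h ev_in_topspace by auto
  ultimately show ?thesis unfolding openin_weak_star by blast
qed

theorem synthetic_imp_strong_operator_Ditkin:
  assumes V: "masa_bimodule M N V" "is_support M N \<kappa> V" and dec: "I_decomposable M N V"
    and syn: "operator_synthetic M N \<kappa>"
  shows "strong_operator_Ditkin M N \<kappa>"
proof -
  have Vcl: "closedin (weak_star M N) V" using dec by (simp add: I_decomposable_def)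
  have VM: "V = M_max M N \<kappa>" "V = M_min M N \<kappa>"
    using M_min_subset[OF V(1) Vcl V(2)] syn unfolding operator_synthetic_def by auto
  have Vb: "V \<subseteq> bounded_ops M N" using VM(1) by (auto simp: M_max_def)
  have \<kappa>: "\<kappa> \<subseteq> XY" using V(2) by (simp add: is_support_def omega_closed_def)
  obtain \<Phi> W where \<Phi>: "\<And>n::nat. \<Phi> n \<in> idempotent_schur_maps M N" and W: "\<And>n. I_injective M N (W n)"
    and bnd: "(SUP n. schur_map_norm M N (\<Phi> n)) < \<infinity>"
    and VW: "\<And>n. V \<subseteq> {op_add M N S T | S T. S \<in> Ran M N (\<Phi> n) \<and> T \<in> W n}"
    and WV: "\<And>n. W n \<subseteq> V" and limsup: "weak_star_limsup M N (\<lambda>n. Ran M N (\<Phi> n)) \<subseteq> V"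
    using dec unfolding I_decomposable_def by blast
  have "\<forall>n. \<exists>\<phi>. schur_multiplier M N \<phi> \<and> is_schur_map M N \<phi> (\<Phi> n)"
    using \<Phi> unfolding idempotent_schur_maps_def by blast
  then obtain \<phi> where \<phi>: "\<And>n. schur_multiplier M N (\<phi> n)" and \<Phi>s: "\<And>n. is_schur_map M N (\<phi> n) (\<Phi> n)"
    by metis
  have "\<forall>n. \<exists>\<Psi>. \<Psi> \<in> idempotent_schur_maps M N \<and> W n = Ran M N \<Psi>"
    using W unfolding I_injective_def by blast
  then obtain \<Psi> where \<Psi>: "\<And>n. \<Psi> n \<in> idempotent_schur_maps M N" and W\<Psi>: "\<And>n. W n = Ran M N (\<Psi> n)"
    by metis
  have "\<forall>n. \<exists>\<psi>. schur_multiplier M N \<psi> \<and> is_schur_map M N \<psi> (\<Psi> n)"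
    using \<Psi> unfolding idempotent_schur_maps_def by blast
  then obtain \<psi> where \<psi>: "\<And>n. schur_multiplier M N (\<psi> n)" and \<Psi>s: "\<And>n. is_schur_map M N (\<psi> n) (\<Psi> n)"
    by metis
  have \<phi>01: "AE z in M \<Otimes>\<^sub>M N. \<phi> n z = 0 \<or> \<phi> n z = 1" for n
    using \<Phi>[of n] by (intro idempotent_schur_multiplier_AE[OF \<phi> \<Phi>s]) (auto simp: idempotent_schur_maps_def)
  have \<psi>01: "AE z in M \<Otimes>\<^sub>M N. \<psi> n z = 0 \<or> \<psi> n z = 1" for n
    using \<Psi>[of n] by (intro idempotent_schur_multiplier_AE[OF \<psi> \<Psi>s]) (auto simp: idempotent_schur_maps_def)
  define w where "w n z = (1 - \<phi> n z) * (1 - \<psi> n z)" for n z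
  have w: "schur_multiplier M N (w n)" for n
    unfolding w_def by (rule schur_multiplier_complement[OF \<phi> \<psi>])
  obtain h0 where h0: "h0 \<in> Gamma M N" "\<And>z. h0 z \<noteq> 0" using nowhere_zero_Gamma by blast
  \<comment> \<open>An element of \<open>V\<close> is a sum of values of the two Schur maps. Dually
    these multiply by \<open>\<phi> n\<close> and \<open>\<psi> n\<close>, both of which annihilate
    \<open>w n\<close> because they take only the values \<open>0\<close> and
    \<open>1\<close>.\<close>
  have kill: "pairing M N T (Gamma_mult M N (w n) h) = 0" if T: "T \<in> V" and h: "h \<in> Gamma M N" for T n h
  proof -
    let ?k = "Gamma_mult M N (w n) h"
    have k: "?k \<in> Gamma M N" by (rule Gamma_mult_in[OF w h])
    obtain S R where SR: "T = op_add M N (\<Phi> n S) (\<Psi> n R)" "S \<in> bounded_ops M N" "R \<in> bounded_ops M N"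
      using VW[of n] T unfolding W\<Psi> Ran_def by blast
    have "AE z in M \<Otimes>\<^sub>M N. Gamma_mult M N (\<phi> n) ?k z = 0"
      using Gamma_mult_AE[OF \<phi> k, of n] Gamma_mult_AE[OF w h, of n] \<phi>01[of n]
      by eventually_elim (auto simp: w_def)
    then have 1: "pairing M N (\<Phi> n S) ?k = 0"
      using schur_map_pairing[OF \<Phi>s SR(2) k] pairing_AE_zero[OF SR(2) Gamma_mult_in[OF \<phi> k]] by simp
    have "AE z in M \<Otimes>\<^sub>M N. Gamma_mult M N (\<psi> n) ?k z = 0"
      using Gamma_mult_AE[OF \<psi> k, of n] Gamma_mult_AE[OF w h, of n] \<psi>01[of n]
      by eventually_elim (auto simp: w_def)
    then have 2: "pairing M N (\<Psi> n R) ?k = 0"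
      using schur_map_pairing[OF \<Psi>s SR(3) k] pairing_AE_zero[OF SR(3) Gamma_mult_in[OF \<psi> k]] by simp
    show ?thesis
      using 1 2 pairing_op_add[OF schur_map_bounded[OF \<Phi>s SR(2)] schur_map_bounded[OF \<Psi>s SR(3)] k] SR(1) T Vb
      by auto
  qed
  have van: "\<exists>E. omega_open M N E \<and> \<kappa> \<subseteq> E \<and> (AE z in M \<Otimes>\<^sub>M N. z \<in> E \<longrightarrow> w n z = 0)" for n
  proof -
    define k where "k = Gamma_mult M N (w n) h0"
    \<comment> \<open>Almost everywhere \<open>k\<close> is either \<open>0\<close> or
      \<open>h0\<close>, so \<open>d\<close> is nonzero where \<open>w n\<close> is zero: an
      \<omega>-open substitute for the zero set of the multiplier.\<close>
    define d where "d z = h0 z - k z" for z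
    have k: "k \<in> Gamma M N" unfolding k_def by (rule Gamma_mult_in[OF w h0(1)])
    have kAE: "AE z in M \<Otimes>\<^sub>M N. k z = w n z * h0 z" unfolding k_def by (rule Gamma_mult_AE[OF w h0(1)])
    have d: "d \<in> Gamma M N" unfolding d_def using k h0(1) by auto
    have mn: "marginally_null M N (\<kappa> \<inter> {z \<in> XY. k z \<noteq> 0})"
    proof (rule marginally_null_of_killed[OF \<kappa> h0 k])
      show "AE z in M \<Otimes>\<^sub>M N. k z = 0 \<or> k z = h0 z"
        using kAE \<phi>01[of n] \<psi>01[of n] by eventually_elim (auto simp: w_def)
    qed (use kill[OF _ h0(1), of _ n] VM(1) in \<open>auto simp: k_def\<close>)
    obtain \<alpha> \<beta> where ab: "\<forall>i::nat. \<alpha> i \<in> sets M \<and> \<beta> i \<in> sets N"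
      and eq: "marginally_equivalent M N {z \<in> XY. d z \<noteq> 0} (\<Union>i. \<alpha> i \<times> \<beta> i)"
      using nonzero_set_rectangles[OF d] by blast
    \<comment> \<open>Adding \<kappa> makes the inclusion literal. It is harmless: where
      \<open>d\<close> vanishes \<open>k\<close> equals \<open>h0\<close> and is nonzero, so the
      added part is marginally null by \<open>mn\<close>.\<close>
    let ?E = "{z \<in> XY. d z \<noteq> 0} \<union> \<kappa>"
    have \<kappa>d: "\<kappa> - {z \<in> XY. d z \<noteq> 0} \<subseteq> \<kappa> \<inter> {z \<in> XY. k z \<noteq> 0}"
      using \<kappa> h0(2) by (auto simp: d_def)
    have "marginally_equivalent M N ?E (\<Union>i. \<alpha> i \<times> \<beta> i)"
      using marginally_null_Un[OF eq[unfolded marginally_equivalent_def] mn]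
      unfolding marginally_equivalent_def by (rule marginally_null_subset) (use \<kappa>d in blast)
    then have "omega_open M N ?E" unfolding omega_open_def using ab \<kappa> by blast
    moreover have "AE z in M \<Otimes>\<^sub>M N. z \<in> ?E \<longrightarrow> w n z = 0"
      using kAE \<phi>01[of n] \<psi>01[of n] mn_AE[OF mn]
    proof eventually_elim
      case (elim z)
      then show ?case using \<kappa>d by (auto simp: d_def w_def)
    qed
    ultimately show ?thesis by blast
  qed
  \<comment> \<open>A bound independent of \<open>n\<close> on the images of contractions, as
    compactness requires.\<close>
  obtain C where C: "0 \<le> C" and \<Phi>C: "\<And>n T u. T \<in> bounded_ops M N \<Longrightarrow>
      (\<forall>u\<in>L2 M. L2_norm N (T u) \<le> L2_norm M u) \<Longrightarrow> u \<in> L2 M \<Longrightarrow> L2_norm N (\<Phi> n T u) \<le> C * L2_norm M u"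
  proof -
    obtain C where C: "0 \<le> C" "(SUP n. schur_map_norm M N (\<Phi> n)) = ennreal C"
      using bnd by (cases "SUP n. schur_map_norm M N (\<Phi> n)") auto
    have "L2_norm N (\<Phi> n T u) \<le> C * L2_norm M u"
      if T: "T \<in> bounded_ops M N" "\<forall>u\<in>L2 M. L2_norm N (T u) \<le> L2_norm M u" and u: "u \<in> L2 M" for n T u
    proof -
      have "ennreal (op_norm M N (\<Phi> n T)) \<le> schur_map_norm M N (\<Phi> n)"
        unfolding schur_map_norm_def using T op_norm_le_1[of M N T] by (intro SUP_upper) auto
      also have "\<dots> \<le> ennreal C" unfolding C(2)[symmetric] by (rule SUP_upper) simp
      finally have "op_norm M N (\<Phi> n T) \<le> C" using C(1) by (simp add: ennreal_le_iff)
      from mult_right_mono[OF this nrm_nonneg[of M "L2_rep u"]]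
      show ?thesis
        using L2_norm_le_op_norm[OF schur_map_bounded[OF \<Phi>s[of n] T(1)] u] by (simp add: L2_norm_rep)
    qed
    then show thesis by (rule that[OF C(1)])
  qed
  have lim: "(\<lambda>n. Gamma_norm M N (\<lambda>z. h z - Gamma_mult M N (w n) h z)) \<longlonglongrightarrow> 0"
    if hP: "h \<in> Psi_min M N \<kappa>" for h
  proof -
    have h: "h \<in> Gamma M N" and h0V: "\<And>T. T \<in> V \<Longrightarrow> pairing M N T h = 0"
      using hP VM(2) by (auto simp: Psi_min_def preannihilator_def)
    define q where "q n z = h z - Gamma_mult M N (w n) h z" for n z
    have q: "q n \<in> Gamma M N" for n unfolding q_def using h Gamma_mult_in[OF w h] by auto
    have "\<forall>n. \<exists>T. T \<in> bounded_ops M N \<and> (\<forall>u\<in>L2 M. L2_norm N (T u) \<le> L2_norm M u) \<and>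
        Re (pairing M N T (q n)) = qcost XY (q n)"
      using duality_attained[OF order_refl q] by blast
    then obtain T where T: "\<And>n. T n \<in> bounded_ops M N" "\<And>n. \<forall>u\<in>L2 M. L2_norm N (T n u) \<le> L2_norm M u"
      "\<And>n. Re (pairing M N (T n) (q n)) = qcost XY (q n)" by metis
    define S where "S n = \<Phi> n (T n)" for n
    have Sb: "S n \<in> bounded_ops M N" for n unfolding S_def by (rule schur_map_bounded[OF \<Phi>s T(1)])
    \<comment> \<open>Almost everywhere
      \<open>q n = \<phi> n * h + \<psi> n * (h - \<phi> n * h)\<close>. The second summand pairs to
      zero: moving the multipliers onto operators leaves \<open>\<Psi> n (T n)\<close> and
      \<open>\<Psi> n (S n)\<close> paired with \<open>h\<close>, and both lie in
      \<open>W n\<close>, hence in \<open>V\<close>, which \<open>h\<close> annihilates.\<close>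
    have Tq: "pairing M N (T n) (q n) = pairing M N (S n) h" for n
    proof -
      let ?p = "Gamma_mult M N (\<phi> n) h"
      have p: "?p \<in> Gamma M N" by (rule Gamma_mult_in[OF \<phi> h])
      define h1 where "h1 z = h z - ?p z" for z
      have h1: "h1 \<in> Gamma M N" unfolding h1_def using h p by auto
      have \<psi>h1: "Gamma_mult M N (\<psi> n) h1 \<in> Gamma M N" by (rule Gamma_mult_in[OF \<psi> h1])
      have \<psi>p: "Gamma_mult M N (\<psi> n) ?p \<in> Gamma M N" by (rule Gamma_mult_in[OF \<psi> p])
      have \<psi>h: "Gamma_mult M N (\<psi> n) h \<in> Gamma M N" by (rule Gamma_mult_in[OF \<psi> h])
      have \<phi>\<psi>h: "Gamma_mult M N (\<phi> n) (Gamma_mult M N (\<psi> n) h) \<in> Gamma M N" by (rule Gamma_mult_in[OF \<phi> \<psi>h])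
      have \<Psi>b: "\<Psi> n (T n) \<in> bounded_ops M N" by (rule schur_map_bounded[OF \<Psi>s T(1)])
      have \<Psi>0: "pairing M N (\<Psi> n R) h = 0" if "R \<in> bounded_ops M N" for R
        using that WV[of n] by (intro h0V) (auto simp: W\<Psi> Ran_def)
      have "AE z in M \<Otimes>\<^sub>M N. q n z = ?p z + Gamma_mult M N (\<psi> n) h1 z"
        using Gamma_mult_AE[OF w h, of n] Gamma_mult_AE[OF \<phi> h, of n] Gamma_mult_AE[OF \<psi> h1, of n]
      proof eventually_elim
        case (elim z)
        have "Gamma_mult M N (\<psi> n) h1 z = \<psi> n z * (h z - \<phi> n z * h z)"
          unfolding elim(3) h1_def elim(2) ..
        then show ?case
          unfolding q_def elim(1,2) w_def by (simp add: algebra_simps)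
      qed
      then have "pairing M N (T n) (q n) = pairing M N (T n) (\<lambda>z. ?p z + Gamma_mult M N (\<psi> n) h1 z)"
        using p \<psi>h1 by (intro pairing_cong_AE T q) auto
      also have "\<dots> = pairing M N (S n) h + pairing M N (\<Psi> n (T n)) h1"
        using pairing_add[OF T(1) p \<psi>h1] schur_map_pairing[OF \<Phi>s T(1) h] schur_map_pairing[OF \<Psi>s T(1) h1]
        by (simp add: S_def)
      also have "pairing M N (\<Psi> n (T n)) h1 = - pairing M N (\<Psi> n (T n)) ?p"
        using pairing_diff[OF \<Psi>b h p] \<Psi>0[OF T(1)] by (simp add: h1_def[abs_def])
      also have "pairing M N (\<Psi> n (T n)) ?p = pairing M N (T n) (Gamma_mult M N (\<psi> n) ?p)"
        by (rule schur_map_pairing[OF \<Psi>s T(1) p])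
      also have "\<dots> = pairing M N (T n) (Gamma_mult M N (\<phi> n) (Gamma_mult M N (\<psi> n) h))"
      proof (rule pairing_cong_AE[OF T(1) \<psi>p \<phi>\<psi>h])
        show "AE z in M \<Otimes>\<^sub>M N. Gamma_mult M N (\<psi> n) ?p z = Gamma_mult M N (\<phi> n) (Gamma_mult M N (\<psi> n) h) z"
          using Gamma_mult_AE[OF \<psi> p, of n] Gamma_mult_AE[OF \<phi> h, of n] Gamma_mult_AE[OF \<phi> \<psi>h, of n]
            Gamma_mult_AE[OF \<psi> h, of n] by eventually_elim simp
      qed
      also have "\<dots> = pairing M N (\<Psi> n (S n)) h"
        using schur_map_pairing[OF \<Phi>s T(1) \<psi>h] schur_map_pairing[OF \<Psi>s Sb h] by (simp add: S_def)
      also have "\<dots> = 0" by (rule \<Psi>0[OF Sb])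
      finally show ?thesis by simp
    qed
    have a0: "(\<lambda>n. cmod (pairing M N (S n) h)) \<longlonglongrightarrow> 0"
    proof (rule ccontr)
      assume "\<not> (\<lambda>n. cmod (pairing M N (S n) h)) \<longlonglongrightarrow> 0"
      then obtain \<epsilon> where \<epsilon>: "0 < \<epsilon>" "\<And>m. \<exists>n\<ge>m. \<epsilon> \<le> cmod (pairing M N (S n) h)"
        unfolding LIMSEQ_iff by (auto simp: not_less)
      \<comment> \<open>The cluster point is taken along the bad indices only. It is still a cluster
        point of the whole sequence, as the limsup asks, but its neighbourhoods contain
        \<open>S n\<close> with \<open>n\<close> in \<open>J\<close>, where the pairing stays at
        least \<epsilon>.\<close>
      define J where "J = {n. \<epsilon> \<le> cmod (pairing M N (S n) h)}"
      have J: "infinite J" unfolding infinite_nat_iff_unbounded_le J_def using \<epsilon>(2) by blast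
      have B: "bounded_form M N C (form M N (S n))" for n
        unfolding S_def by (intro bounded_form_form schur_map_bounded[OF \<Phi>s T(1)] \<Phi>C T)
      obtain T0 where T0: "T0 \<in> bounded_ops M N"
        "\<And>W m. openin (weak_star M N) W \<Longrightarrow> T0 \<in> W \<Longrightarrow> \<exists>n\<in>J. m \<le> n \<and> S n \<in> W"
        using weak_star_cluster_point[where S = S, OF Sb C B J] by metis
      have "T0 \<in> weak_star_limsup M N (\<lambda>n. Ran M N (\<Phi> n))"
        unfolding weak_star_limsup_def
      proof (intro CollectI conjI exI[of _ S] allI impI T0(1))
        show "S n \<in> Ran M N (\<Phi> n)" for n unfolding S_def Ran_def using T(1) by blast
        show "\<exists>\<^sub>F n in sequentially. S n \<in> W" if "openin (weak_star M N) W \<and> T0 \<in> W" for W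
          unfolding frequently_sequentially using T0(2) that by blast
      qed
      then have "pairing M N T0 h = 0" using limsup h0V by blast
      then have "T0 \<in> {T \<in> bounded_ops M N. cmod (pairing M N T h) < \<epsilon>}" using T0(1) \<epsilon>(1) by simp
      from T0(2)[OF openin_pairing_ball[OF h] this, of 0] show False by (auto simp: J_def)
    qed
    \<comment> \<open>The projective norm is at most the half-sum cost, and the latter is attained
      at \<open>T n\<close>.\<close>
    have "Gamma_norm M N (q n) \<le> cmod (pairing M N (S n) h)" for n
    proof -
      have "Gamma_norm M N (q n) \<le> qcost XY (q n)"
        by (rule qcost_greatest[OF order_refl q]) (rule Gamma_norm_le_cost)
      then show ?thesis using T(3)[of n] Tq[of n] complex_Re_le_cmod[of "pairing M N (S n) h"] by simp
    qed
    then have "(\<lambda>n. Gamma_norm M N (q n)) \<longlonglongrightarrow> 0"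
      using Gamma_norm_nonneg[OF q] by (intro Lim_null_comparison[OF _ a0]) (auto intro!: always_eventually)
    then show ?thesis by (simp add: q_def[abs_def])
  qed
  show ?thesis
    unfolding strong_operator_Ditkin_def using w van lim by (intro exI[of _ w]) auto
qed

end

theorem theorem4p5:
  fixes M :: "'a measure" and N :: "'b measure"
    and \<V> :: "('a, 'b) op set" and \<kappa> :: "('a \<times> 'b) set"
  assumes "standard_measure_space M" and "standard_measure_space N"
    and "masa_bimodule M N \<V>" and "I_decomposable M N \<V>"
    and "is_support M N \<kappa> \<V>"
  shows "operator_synthetic M N \<kappa> \<longleftrightarrow> strong_operator_Ditkin M N \<kappa>"
proof -
  interpret M: sigma_finite_measure M using assms(1) by (simp add: standard_measure_space_def)
  interpret N: sigma_finite_measure N using assms(2) by (simp add: standard_measure_space_def)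
  interpret L2_pair M N ..
  have "closedin (weak_star M N) \<V>" using assms(4) by (simp add: I_decomposable_def)
  then show ?thesis
    using strong_operator_Ditkin_imp_synthetic[OF assms(1-3) _ assms(5)]
      synthetic_imp_strong_operator_Ditkin[OF assms(3,5,4)] by blast
qed

end
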